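(* There is a ring embedding $$D:\ A_f\to \mathrm{Mat}(n,\mathcal{D}_n)$$ of the ring $A_f$ of meromorphic functions on $\Gamma$ with poles on the hypersurface $f=0$ into the ring of differential operators in the variables $x_1,\dots,x_n$ with matrix coefficients of size $n\times n$.
   Context: Let $n$ be a positive integer. Fix $a_1,a_2,b_1,b_2\in\mathbb{C}$ with $(a_i,b_i)\neq(0,0)$ and $(a_1:b_1)\neq(a_2:b_2)$ in $\mathbb{C}P^1$, and a nondegenerate linear map $\mathcal{P}:\mathbb{C}^n\to\mathbb{C}^n$; the induced map $\mathbb{C}P^{n-1}\to\mathbb{C}P^{n-1}$ is also denoted $\mathcal{P}$. Let $\Gamma$ be obtained from $\mathbb{C}P^1\times\mathbb{C}P^{n-1}$ by identifying $(a_1:b_1,t)\sim(a_2:b_2,\mathcal{P}(t))$ for all $t\in\mathbb{C}P^{n-1}$. Assume the eigenvalues $\lambda_1,\dots,\lambda_n$ of $\mathcal{P}$ are pairwise distinct, with eigenvectors $\mathbf{w}_1,\dots,\mathbf{w}_n$. Fix $A\in\mathbb{C}^*$ and a function $f(z_1,z_2,t_1,\dots,t_n)=\sum_{i=1}^n(\alpha_i z_1t_i+\beta_i z_2t_i)$, $\alpha_i,\beta_i\in\mathbb{C}$, such that $f(a_1,b_1,t)-A f(a_2,b_2,\mathcal{P}(t))=0$ for all $t\in\mathbb{C}^n$ and $f(a_1,b_1,\mathbf{w}_j)\neq0$ for $j=1,\dots,n$. Then $f=0$ defines a hypersurface in $\Gamma$. Let $f_i(z_1,z_2,t)=\sum_{k=1}^n(\alpha_{ik}z_1t_k+\beta_{ik}z_2t_k)$,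 $i=1,\dots,n$, be functions such that for some $c_i\in\mathbb{C}$ one has $f_i(a_1,b_1,t)-Af_i(a_2,b_2,\mathcal{P}(t))-c_if(a_1,b_1,t)=0$ for all $t\in\mathbb{C}^n$, and such that $f,f_1,\dots,f_n$ are linearly independent. The parameters $\alpha_i,\beta_i,\alpha_{ik},\beta_{ik}$ are in general position in the following sense: for each $k=1,\dots,n$, regard $f,f_j$ ($1\le j\le n$, $j\neq k$) as $n$ linear forms in $t_1,\dots,t_n$ with coefficients linear forms in $z_1,z_2$; the determinant of their $n\times n$ coefficient matrix, a homogeneous polynomial of degree $n$ in $(z_1,z_2)$, has no multiple roots in $\mathbb{C}P^1$, i.e. it has $n$ distinct roots. Let $x_0\in\mathbb{C}^n$ be a fixed point, let $\mathcal{O}$ be the ring of analytic functions of $x=(x_1,\dots,x_n)$ in a neighbourhood of $x_0$, and let $\mathcal{D}_n=\mathcal{O}[\partial_{x_1},\dots,\partial_{x_n}]$. Fix $\Lambda\in\mathbb{C}$. For $k\ge1$ let $M_\Gamma(k)$ be the set of functions $$\psi(x,P)=\frac{h(x,P)}{f^k(P)}\exp\Big(\sum_{j=1}^n\frac{f_j(P)}{f(P)}x_j\Big),\qquad P=(z_1:z_2,t)\in\mathbb{C}P^1\times\mathbb{C}P^{n-1},$$ where $h(x,P)=\sum_{0\le j\le k,\ |\alpha|=k}h_{j\alpha}(x)z_1^jz_2^{k-j}t^\alpha$ with $h_{j\alpha}\in\mathcal{O}$ ($\alpha$ a multi-index, $t^\alpha=t_1^{\alpha_1}\cdots t_n^{\alpha_n}$),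 satisfying $\psi(x,a_1:b_1,t)-\Lambda\,\psi(x,a_2:b_2,\mathcal{P}(t))=0$ for all $t\in\mathbb{C}P^{n-1}$. Put $M_\Gamma=\bigcup_{k\ge1}M_\Gamma(k)$, a $\mathcal{D}_n$-module (operators act in $x$). It is free of rank $n$, generated by $n$ functions from $M_\Gamma(1)$. $A_f$ is the ring of meromorphic functions on $\Gamma$ with poles only on $f=0$, i.e. rational functions $\lambda$ on $\mathbb{C}P^1\times\mathbb{C}P^{n-1}$ that are regular outside $f=0$ and satisfy $\lambda(a_1:b_1,t)=\lambda(a_2:b_2,\mathcal{P}(t))$. A ring embedding is an injective ring homomorphism. The embedding arises as follows: for a basis $\psi_1,\dots,\psi_n$ of $M_\Gamma$ over $\mathcal{D}_n$ and $\Psi=(\psi_1,\dots,\psi_n)^\top$, $D(\lambda)$ is the unique differential operator with $n\times n$ matrix coefficients such that $D(\lambda)\Psi(x,P)=\lambda(P)\Psi(x,P)$. *)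

theory Defs
  imports "HOL-Analysis.Analysis" "HOL-Algebra.RingHom"
begin

section \<open>Bihomogeneous functions on a product of projective spaces\<close>

text \<open>
  A point of $CP^1 \times CP^{n-1}$, with $n = CARD('n)$, is given by homogeneous coordinates
  \<open>(z1, z2, t)\<close>, where \<open>(z1, z2)\<close> and \<open>t\<close> are nonzero. All functions below are quotients of
  bihomogeneous polynomials of equal bidegree, hence invariant under rescaling.
\<close>

type_synonym 'n point = "complex \<times> complex \<times> (complex ^ 'n)"

definition cp1 :: "complex \<Rightarrow> complex \<Rightarrow> (complex \<times> complex) set"
  where "cp1 z1 z2 = {(s * z1, s * z2) | s. s \<noteq> 0}"

definition form :: "complex ^ 'n \<Rightarrow> complex ^ 'n \<Rightarrow> 'n::finite point \<Rightarrow> complex"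
  where "form \<alpha> \<beta> = (\<lambda>(z1, z2, t). \<Sum>i\<in>UNIV. \<alpha> $ i * z1 * t $ i + \<beta> $ i * z2 * t $ i)"

definition bipoly ::
    "nat \<Rightarrow> nat \<Rightarrow> (nat \<Rightarrow> ('n \<Rightarrow> nat) \<Rightarrow> complex) \<Rightarrow> 'n::finite point \<Rightarrow> complex"
  where "bipoly d e c = (\<lambda>(z1, z2, t).
    \<Sum>j\<le>d. \<Sum>\<alpha> | (\<Sum>i\<in>UNIV. \<alpha> i) = e.
      c j \<alpha> * z1 ^ j * z2 ^ (d - j) * (\<Prod>i\<in>UNIV. t $ i ^ \<alpha> i))"

definition off :: "('n::finite point \<Rightarrow> complex) \<Rightarrow> 'n point set"
  where "off f = {(z1, z2, t). (z1, z2) \<noteq> (0, 0) \<and> t \<noteq> 0 \<and> f (z1, z2, t) \<noteq> 0}"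

text \<open>
  A rational function is regular at \<open>p\<close> if one of its representations as a quotient of
  bihomogeneous polynomials of equal bidegree has a denominator that does not vanish at \<open>p\<close>.
\<close>

definition regular_off :: "('n::finite point \<Rightarrow> complex) \<Rightarrow> ('n point \<Rightarrow> complex) \<Rightarrow> bool"
  where "regular_off f l \<longleftrightarrow>
    (\<forall>p\<in>off f. \<exists>d e c c'. bipoly d e c' p \<noteq> 0 \<and>
      (\<forall>q\<in>off f. bipoly d e c' q \<noteq> 0 \<longrightarrow> l q = bipoly d e c q / bipoly d e c' q))"

text \<open>
  The parameters \<open>a1 b1 a2 b2 Pm\<close> describe the gluing
  \<open>(a1 : b1, t) ~ (a2 : b2, Pm t)\<close>. The gluing condition is imposed at the
  points \<open>(a1 : b1, t)\<close> off \<open>f = 0\<close>.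
\<close>

definition A_ring ::
    "complex \<Rightarrow> complex \<Rightarrow> complex \<Rightarrow> complex \<Rightarrow> complex ^ 'n ^ 'n \<Rightarrow>
     ('n::finite point \<Rightarrow> complex) \<Rightarrow> ('n point \<Rightarrow> complex) ring"
  where "A_ring a1 b1 a2 b2 Pm f =
    \<lparr> carrier = {l \<in> extensional (off f). regular_off f l \<and>
        (\<forall>t. (a1, b1, t) \<in> off f \<longrightarrow> l (a1, b1, t) = l (a2, b2, Pm *v t))},
      monoid.mult = (\<lambda>l m. \<lambda>p\<in>off f. l p * m p),
      one = (\<lambda>p\<in>off f. 1),
      zero = (\<lambda>p\<in>off f. 0),
      add = (\<lambda>l m. \<lambda>p\<in>off f. l p + m p) \<rparr>"


section \<open>Germs of analytic functions\<close>

definition analytic_near :: "complex ^ 'n \<Rightarrow> (complex ^ 'n::finite \<Rightarrow> complex) \<Rightarrow> bool"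
  where "analytic_near x0 g \<longleftrightarrow> (\<exists>c :: ('n \<Rightarrow> nat) \<Rightarrow> complex. \<exists>r>0. \<forall>x\<in>ball x0 r.
    ((\<lambda>\<alpha>. c \<alpha> * (\<Prod>i\<in>UNIV. (x $ i - x0 $ i) ^ \<alpha> i)) has_sum g x) UNIV)"

type_synonym 'n germ = "(complex ^ 'n \<Rightarrow> complex) set"

definition germ :: "complex ^ 'n \<Rightarrow> (complex ^ 'n::finite \<Rightarrow> complex) \<Rightarrow> 'n germ"
  where "germ x0 g = {h. \<forall>\<^sub>F x in nhds x0. h x = g x}"

definition rep :: "'n germ \<Rightarrow> complex ^ 'n::finite \<Rightarrow> complex"
  where "rep G = (SOME g. g \<in> G)"

definition O_ring :: "complex ^ 'n \<Rightarrow> 'n::finite germ ring"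
  where "O_ring x0 =
    \<lparr> carrier = germ x0 ` {g. analytic_near x0 g},
      monoid.mult = (\<lambda>G H. germ x0 (\<lambda>x. rep G x * rep H x)),
      one = germ x0 (\<lambda>x. 1),
      zero = germ x0 (\<lambda>x. 0),
      add = (\<lambda>G H. germ x0 (\<lambda>x. rep G x + rep H x)) \<rparr>"

definition partial :: "'n \<Rightarrow> (complex ^ 'n::finite \<Rightarrow> complex) \<Rightarrow> complex ^ 'n \<Rightarrow> complex"
  where "partial i g x = deriv (\<lambda>w. g (x + axis i w)) 0"


section \<open>Differential operators\<close>

text \<open>
  The ring \<open>O[\<partial>\<^sub>1, \<dots>, \<partial>\<^sub>n]\<close> acts faithfully on \<open>O\<close>; it is realised as the ring of operators on
  \<open>O\<close> generated by the multiplications by elements of \<open>O\<close> and the partial derivatives.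
\<close>

inductive_set diffops :: "complex ^ 'n \<Rightarrow> ('n::finite germ \<Rightarrow> 'n germ) set"
  for x0 :: "complex ^ 'n::finite"
  where
    multiplication: "G \<in> carrier (O_ring x0) \<Longrightarrow>
      (\<lambda>H\<in>carrier (O_ring x0). G \<otimes>\<^bsub>O_ring x0\<^esub> H) \<in> diffops x0"
  | derivative: "(\<lambda>H\<in>carrier (O_ring x0). germ x0 (partial i (rep H))) \<in> diffops x0"
  | sum: "S \<in> diffops x0 \<Longrightarrow> T \<in> diffops x0 \<Longrightarrow>
      (\<lambda>H\<in>carrier (O_ring x0). S H \<oplus>\<^bsub>O_ring x0\<^esub> T H) \<in> diffops x0"
  | composition: "S \<in> diffops x0 \<Longrightarrow> T \<in> diffops x0 \<Longrightarrow>
      compose (carrier (O_ring x0)) S T \<in> diffops x0"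

definition D_ring :: "complex ^ 'n \<Rightarrow> ('n::finite germ \<Rightarrow> 'n germ) ring"
  where "D_ring x0 =
    \<lparr> carrier = diffops x0,
      monoid.mult = compose (carrier (O_ring x0)),
      one = (\<lambda>H\<in>carrier (O_ring x0). H),
      zero = (\<lambda>H\<in>carrier (O_ring x0). \<zero>\<^bsub>O_ring x0\<^esub>),
      add = (\<lambda>S T. \<lambda>H\<in>carrier (O_ring x0). S H \<oplus>\<^bsub>O_ring x0\<^esub> T H) \<rparr>"

definition Mat_ring :: "'a ring \<Rightarrow> ('n::finite \<Rightarrow> 'n \<Rightarrow> 'a) ring"
  where "Mat_ring R =
    \<lparr> carrier = {X. \<forall>i j. X i j \<in> carrier R},
      monoid.mult = (\<lambda>X Y i k. \<Oplus>\<^bsub>R\<^esub>j\<in>UNIV. X i j \<otimes>\<^bsub>R\<^esub> Y j k),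
      one = (\<lambda>i j. if i = j then \<one>\<^bsub>R\<^esub> else \<zero>\<^bsub>R\<^esub>),
      zero = (\<lambda>i j. \<zero>\<^bsub>R\<^esub>),
      add = (\<lambda>X Y i j. X i j \<oplus>\<^bsub>R\<^esub> Y i j) \<rparr>"

definition ring_embedding :: "('a \<Rightarrow> 'b) \<Rightarrow> 'a ring \<Rightarrow> 'b ring \<Rightarrow> bool"
  where "ring_embedding D R S \<longleftrightarrow> ring_hom_ring R S D \<and> inj_on D (carrier R)"


section \<open>The Baker-Akhiezer module\<close>

definition BA ::
    "('n point \<Rightarrow> complex) \<Rightarrow> ('n \<Rightarrow> 'n point \<Rightarrow> complex) \<Rightarrow> nat \<Rightarrow>
     (nat \<Rightarrow> ('n \<Rightarrow> nat) \<Rightarrow> complex ^ 'n \<Rightarrow> complex) \<Rightarrow> complex ^ 'n \<Rightarrow> 'n::finite point \<Rightarrow> complex"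
  where "BA f fs k h x p =
    bipoly k k (\<lambda>j \<alpha>. h j \<alpha> x) p / f p ^ k * exp (\<Sum>j\<in>UNIV. fs j p / f p * x $ j)"

text \<open>
  Elements of \<open>M\<close> are functions of the point \<open>p\<close> off \<open>f = 0\<close> whose values are germs in \<open>x\<close>;
  differential operators act on these values.
\<close>

definition M_level ::
    "complex \<Rightarrow> complex \<Rightarrow> complex \<Rightarrow> complex \<Rightarrow> complex ^ 'n ^ 'n \<Rightarrow>
     ('n point \<Rightarrow> complex) \<Rightarrow> ('n \<Rightarrow> 'n point \<Rightarrow> complex) \<Rightarrow> complex \<Rightarrow> complex ^ 'n \<Rightarrow> nat \<Rightarrow>
     ('n::finite point \<Rightarrow> 'n germ) set"
  where "M_level a1 b1 a2 b2 Pm f fs \<Lambda> x0 k =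
    {(\<lambda>p\<in>off f. germ x0 (\<lambda>x. BA f fs k h x p)) | h.
      (\<forall>j \<alpha>. analytic_near x0 (h j \<alpha>)) \<and>
      (\<forall>\<^sub>F x in nhds x0. \<forall>t. (a1, b1, t) \<in> off f \<longrightarrow>
        BA f fs k h x (a1, b1, t) - \<Lambda> * BA f fs k h x (a2, b2, Pm *v t) = 0)}"

definition M_module ::
    "complex \<Rightarrow> complex \<Rightarrow> complex \<Rightarrow> complex \<Rightarrow> complex ^ 'n ^ 'n \<Rightarrow>
     ('n point \<Rightarrow> complex) \<Rightarrow> ('n \<Rightarrow> 'n point \<Rightarrow> complex) \<Rightarrow> complex \<Rightarrow> complex ^ 'n \<Rightarrow>
     ('n::finite point \<Rightarrow> 'n germ) set"
  where "M_module a1 b1 a2 b2 Pm f fs \<Lambda> x0 =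
    (\<Union>k\<in>{1..}. M_level a1 b1 a2 b2 Pm f fs \<Lambda> x0 k)"

definition lincomb ::
    "complex ^ 'n \<Rightarrow> 'n::finite point set \<Rightarrow> ('n \<Rightarrow> 'n germ \<Rightarrow> 'n germ) \<Rightarrow>
     ('n \<Rightarrow> 'n point \<Rightarrow> 'n germ) \<Rightarrow> 'n point \<Rightarrow> 'n germ"
  where "lincomb x0 U L \<Psi> = (\<lambda>p\<in>U. \<Oplus>\<^bsub>O_ring x0\<^esub>j\<in>UNIV. L j (\<Psi> j p))"

definition D_basis ::
    "complex ^ 'n \<Rightarrow> 'n::finite point set \<Rightarrow> ('n point \<Rightarrow> 'n germ) set \<Rightarrow>
     ('n \<Rightarrow> 'n point \<Rightarrow> 'n germ) \<Rightarrow> bool"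
  where "D_basis x0 U M \<Psi> \<longleftrightarrow> (\<forall>i. \<Psi> i \<in> M) \<and>
    (\<forall>\<phi>\<in>M. \<exists>!L. (\<forall>i. L i \<in> carrier (D_ring x0)) \<and> \<phi> = lincomb x0 U L \<Psi>)"

definition scale ::
    "complex ^ 'n \<Rightarrow> 'n::finite point set \<Rightarrow> ('n point \<Rightarrow> complex) \<Rightarrow> ('n point \<Rightarrow> 'n germ) \<Rightarrow>
     'n point \<Rightarrow> 'n germ"
  where "scale x0 U l \<psi> = (\<lambda>p\<in>U. germ x0 (\<lambda>x. l p) \<otimes>\<^bsub>O_ring x0\<^esub> \<psi> p)"

end

theory Submission
  imports Defs
    "HOL-Complex_Analysis.Cauchy_Integral_Formula"
    "HOL-Computational_Algebra.Fundamental_Theorem_Algebra"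
begin

text \<open>
  Multiplication by a function \<open>l\<close> on \<open>\<Gamma>\<close> with poles on \<open>f = 0\<close> preserves the Baker-Akhiezer module. For this
  one needs that such an \<open>l\<close>, which is only locally a quotient of bihomogeneous polynomials, is
  globally of the form \<open>g / f ^ N\<close> (\<open>regular_off_form\<close>); then \<open>l \<psi>\<close> has the form required of level
  \<open>k + N\<close> when \<open>\<psi>\<close> has level \<open>k\<close>, and the gluing conditions of \<open>l\<close> and \<open>\<psi>\<close> multiply
  (\<open>scale_in_M_module\<close>). Given a basis \<open>\<Psi>\<close>, expanding \<open>l \<Psi>\<^sub>i\<close> in it defines the matrix \<open>D l\<close>, and
  uniqueness of coordinates gives the homomorphism property, because functions of the spectral
  point commute with differential operators in \<open>x\<close>. The map \<open>D\<close> is injective because \<open>(l - m) \<Psi> = 0\<close>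
  with \<open>l \<noteq> m\<close> forces \<open>\<Psi> = 0\<close> (\<open>scale_eq_imp_zero\<close>), and zero functions form no basis
  (\<open>spectral_embedding\<close>).

  The proof of \<open>regular_off_form\<close> avoids factorisation of polynomials in several variables. On a
  line everything becomes univariate, where a fraction \<open>c / c'\<close> that is regular off \<open>f = 0\<close> becomes a
  polynomial after multiplication by \<open>f ^ D\<close>, with \<open>D\<close> bounding the degree of \<open>c'\<close>
  (\<open>regular_fraction_univariate\<close>). The degrees are bounded uniformly in the line, so Lagrange
  interpolation on a box recovers a polynomial in all variables
  (\<open>separately_polynomial_imp_polynomial\<close>), and lines carry the resulting identity from the box to
  all points.

  The first part of the theorem asserts that some embedding exists, without reference to a basis.
  It is obtained by restricting \<open>A_f\<close> to a polynomial chart, of dimension \<open>n\<close>, in the complement of the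
  hypersurface, and letting the restrictions act as scalar matrices of multiplication operators
  (\<open>affine_chart\<close>, \<open>A_ring_embeds_in_D_ring\<close>). This embedding is unrelated to the module; the second
  part provides, for every basis, the embedding that the Baker-Akhiezer functions determine.
\<close>

section \<open>Germs of analytic functions of several variables\<close>

lemma analytic_near_const: "analytic_near x0 (\<lambda>x. k)"
  unfolding analytic_near_def
proof (intro exI[of _ "\<lambda>\<alpha>. if \<alpha> = (\<lambda>_. 0) then k else 0"] exI[of _ 1] conjI ballI)
  fix x
  show "((\<lambda>\<alpha>. (if \<alpha> = (\<lambda>_. 0) then k else 0) * (\<Prod>i\<in>UNIV. (x $ i - x0 $ i) ^ \<alpha> i)) has_sum k) UNIV"
    by (rule has_sum_finite_neutralI[of "{\<lambda>_. 0}"]) auto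
qed simp

lemma analytic_near_shifted_coord: "analytic_near x0 (\<lambda>x. x $ k - x0 $ k)"
  unfolding analytic_near_def
proof (intro exI[of _ "\<lambda>\<alpha>. if \<alpha> = (\<lambda>i. if i = k then 1 else 0) then 1 else 0"] exI[of _ 1] conjI ballI)
  fix x
  show "((\<lambda>\<alpha>. (if \<alpha> = (\<lambda>i. if i = k then 1 else 0) then 1 else 0) *
      (\<Prod>i\<in>UNIV. (x $ i - x0 $ i) ^ \<alpha> i)) has_sum (x $ k - x0 $ k)) UNIV"
    by (rule has_sum_finite_neutralI[of "{\<lambda>i. if i = k then 1 else 0}"])
       (auto simp: if_distrib[of "\<lambda>m. _ ^ m"] cong: if_cong)
qed simp

lemma analytic_near_add:
  assumes "analytic_near x0 g" "analytic_near x0 h"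
  shows "analytic_near x0 (\<lambda>x. g x + h x)"
proof -
  obtain c r where c: "r > 0" "\<forall>x\<in>ball x0 r.
      ((\<lambda>\<alpha>. c \<alpha> * (\<Prod>i\<in>UNIV. (x $ i - x0 $ i) ^ \<alpha> i)) has_sum g x) UNIV"
    using assms(1) unfolding analytic_near_def by blast
  obtain d s where d: "s > 0" "\<forall>x\<in>ball x0 s.
      ((\<lambda>\<alpha>. d \<alpha> * (\<Prod>i\<in>UNIV. (x $ i - x0 $ i) ^ \<alpha> i)) has_sum h x) UNIV"
    using assms(2) unfolding analytic_near_def by blast
  show ?thesis unfolding analytic_near_def
  proof (intro exI[of _ "\<lambda>\<alpha>. c \<alpha> + d \<alpha>"] exI[of _ "min r s"] conjI ballI)
    fix x assume "x \<in> ball x0 (min r s)"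
    then show "((\<lambda>\<alpha>. (c \<alpha> + d \<alpha>) * (\<Prod>i\<in>UNIV. (x $ i - x0 $ i) ^ \<alpha> i)) has_sum g x + h x) UNIV"
      unfolding distrib_right using c d by (intro has_sum_add) auto
  qed (use c d in auto)
qed

lemma finite_exponents_le: "finite {\<alpha> :: 'n::finite \<Rightarrow> nat. \<forall>i. \<alpha> i \<le> \<gamma> i}"
proof -
  have "{\<alpha>. \<forall>i. \<alpha> i \<le> \<gamma> i} = PiE UNIV (\<lambda>i. {..\<gamma> i})"
    by (auto simp: PiE_def Pi_def)
  then show ?thesis by (simp add: finite_PiE)
qed

text \<open>
  A complex power series that converges at a point converges there absolutely, so the product of two
  series may be rearranged along the finite fibres of \<open>(\<alpha>, \<beta>) \<mapsto> \<alpha> + \<beta>\<close>.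
\<close>

lemma analytic_near_mult:
  fixes g h :: "complex ^ 'n::finite \<Rightarrow> complex"
  assumes "analytic_near x0 g" "analytic_near x0 h"
  shows "analytic_near x0 (\<lambda>x. g x * h x)"
proof -
  obtain c r where c: "r > 0" "\<forall>x\<in>ball x0 r.
      ((\<lambda>\<alpha>. c \<alpha> * (\<Prod>i\<in>UNIV. (x $ i - x0 $ i) ^ \<alpha> i)) has_sum g x) UNIV"
    using assms(1) unfolding analytic_near_def by blast
  obtain d s where d: "s > 0" "\<forall>x\<in>ball x0 s.
      ((\<lambda>\<alpha>. d \<alpha> * (\<Prod>i\<in>UNIV. (x $ i - x0 $ i) ^ \<alpha> i)) has_sum h x) UNIV"
    using assms(2) unfolding analytic_near_def by blast
  \<comment> \<open>The ways of writing the exponent \<open>\<gamma>\<close> as a sum: finitely many.\<close>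
  define F where "F \<gamma> = {(\<alpha>, \<beta>). (\<lambda>i. \<alpha> i + \<beta> i) = \<gamma>}" for \<gamma> :: "'n \<Rightarrow> nat"
  have finF: "finite (F \<gamma>)" for \<gamma>
  proof (rule finite_subset)
    show "F \<gamma> \<subseteq> {\<alpha>. \<forall>i. \<alpha> i \<le> \<gamma> i} \<times> {\<alpha>. \<forall>i. \<alpha> i \<le> \<gamma> i}"
      by (auto simp: F_def)
  qed (simp add: finite_exponents_le)
  define e where "e \<gamma> = (\<Sum>(\<alpha>, \<beta>)\<in>F \<gamma>. c \<alpha> * d \<beta>)" for \<gamma>
  show ?thesis unfolding analytic_near_def
  proof (intro exI[of _ e] exI[of _ "min r s"] conjI ballI)
    fix x assume x: "x \<in> ball x0 (min r s)"
    define m where "m \<alpha> = (\<Prod>i\<in>UNIV. (x $ i - x0 $ i) ^ \<alpha> i)" for \<alpha>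
    define u where "u \<alpha> = c \<alpha> * m \<alpha>" for \<alpha>
    define v where "v \<alpha> = d \<alpha> * m \<alpha>" for \<alpha>
    have u: "(u has_sum g x) UNIV" and v: "(v has_sum h x) UNIV"
      using c d x unfolding u_def v_def m_def by auto
    have au: "(\<lambda>\<alpha>. norm (u \<alpha>)) summable_on UNIV" and av: "(\<lambda>\<alpha>. norm (v \<alpha>)) summable_on UNIV"
      using u[THEN has_sum_imp_summable] v[THEN has_sum_imp_summable]
      by (simp_all only: summable_on_iff_abs_summable_on_complex)
    have "(\<lambda>p. norm (u (fst p) * v (snd p))) summable_on (Sigma UNIV (\<lambda>_. UNIV))"
    proof (rule Infinite_Sum.abs_summable_on_Sigma_iff[THEN iffD2], rule conjI)
      show "\<forall>\<alpha>\<in>UNIV. (\<lambda>\<beta>. norm (u (fst (\<alpha>, \<beta>)) * v (snd (\<alpha>, \<beta>)))) summable_on UNIV"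
        by (auto simp: norm_mult intro: summable_on_cmult_right av)
      have "(\<Sum>\<^sub>\<infinity>\<beta>. norm (u (fst (\<alpha>, \<beta>)) * v (snd (\<alpha>, \<beta>)))) = norm (u \<alpha>) * (\<Sum>\<^sub>\<infinity>\<beta>. norm (v \<beta>))" for \<alpha>
        using infsum_cmult_right[OF av] by (simp add: norm_mult)
      moreover have "(\<Sum>\<^sub>\<infinity>\<beta>. norm (v \<beta>)) \<ge> 0" by (simp add: infsum_nonneg)
      ultimately show "(\<lambda>\<alpha>. norm (\<Sum>\<^sub>\<infinity>\<beta>. norm (u (fst (\<alpha>, \<beta>)) * v (snd (\<alpha>, \<beta>))))) summable_on UNIV"
        using summable_on_cmult_left[OF au] by (simp add: norm_mult)
    qed
    then have summ: "(\<lambda>p. u (fst p) * v (snd p)) summable_on (UNIV \<times> UNIV)"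
      by (rule summable_on_iff_abs_summable_on_complex[THEN iffD2])
    have prod: "((\<lambda>p. u (fst p) * v (snd p)) has_sum g x * h x) (UNIV \<times> UNIV)"
    proof (rule has_sum_SigmaI[OF _ _ summ])
      show "((\<lambda>\<beta>. u (fst (\<alpha>, \<beta>)) * v (snd (\<alpha>, \<beta>))) has_sum u \<alpha> * h x) UNIV" for \<alpha>
        by (simp add: has_sum_cmult_right[OF v])
      show "((\<lambda>\<alpha>. u \<alpha> * h x) has_sum g x * h x) UNIV" by (rule has_sum_cmult_left[OF u])
    qed
    have bij: "bij_betw snd (Sigma UNIV F) (UNIV \<times> UNIV)"
      by (rule bij_betwI[where g = "\<lambda>(\<alpha>, \<beta>). ((\<lambda>i. \<alpha> i + \<beta> i), (\<alpha>, \<beta>))"]) (auto simp: F_def)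
    have "((\<lambda>q. u (fst (snd q)) * v (snd (snd q))) has_sum g x * h x) (Sigma UNIV F)"
      using has_sum_reindex_bij_betw[OF bij, of "\<lambda>p. u (fst p) * v (snd p)"] prod by simp
    then have "((\<lambda>\<gamma>. e \<gamma> * m \<gamma>) has_sum g x * h x) UNIV"
    proof (rule has_sum_SigmaD)
      fix \<gamma> :: "'n \<Rightarrow> nat"
      have "u \<alpha> * v \<beta> = c \<alpha> * d \<beta> * m \<gamma>" if "(\<alpha>, \<beta>) \<in> F \<gamma>" for \<alpha> \<beta>
      proof -
        have "\<gamma> = (\<lambda>i. \<alpha> i + \<beta> i)" using that by (simp add: F_def)
        then have "m \<alpha> * m \<beta> = m \<gamma>" by (simp add: m_def power_add prod.distrib)
        then show ?thesis by (simp add: u_def v_def algebra_simps)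
      qed
      then have "e \<gamma> * m \<gamma> = (\<Sum>p\<in>F \<gamma>. u (fst p) * v (snd p))"
        unfolding e_def sum_distrib_right by (intro sum.cong) auto
      then show "((\<lambda>p. u (fst (snd (\<gamma>, p))) * v (snd (snd (\<gamma>, p)))) has_sum e \<gamma> * m \<gamma>) (F \<gamma>)"
        using finF by simp
    qed
    then show "((\<lambda>\<gamma>. e \<gamma> * (\<Prod>i\<in>UNIV. (x $ i - x0 $ i) ^ \<gamma> i)) has_sum g x * h x) UNIV"
      by (simp add: m_def)
  qed (use c d in auto)
qed

lemma analytic_near_sum:
  "(\<And>i. i \<in> I \<Longrightarrow> analytic_near x0 (g i)) \<Longrightarrow> analytic_near x0 (\<lambda>x. \<Sum>i\<in>I. g i x)"
  by (induction I rule: infinite_finite_induct)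
     (auto intro: analytic_near_const analytic_near_add)

lemma analytic_near_prod:
  "(\<And>i. i \<in> I \<Longrightarrow> analytic_near x0 (g i)) \<Longrightarrow> analytic_near x0 (\<lambda>x. \<Prod>i\<in>I. g i x)"
  by (induction I rule: infinite_finite_induct)
     (auto intro: analytic_near_const analytic_near_mult)

lemma analytic_near_power: "analytic_near x0 g \<Longrightarrow> analytic_near x0 (\<lambda>x. g x ^ k)"
  by (induction k) (auto intro: analytic_near_const analytic_near_mult)

lemma analytic_near_coord: "analytic_near x0 (\<lambda>x. x $ k)"
  using analytic_near_add[OF analytic_near_shifted_coord[of x0 k] analytic_near_const[of x0 "x0 $ k"]]
  by simp

lemma analytic_near_exp_coord:
  fixes x0 :: "complex ^ 'n::finite"
  shows "analytic_near x0 (\<lambda>x. exp (s * x $ k))"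
proof -
  define \<delta> where "\<delta> m = (\<lambda>i. if i = k then m else 0)" for m :: nat
  have inj: "inj \<delta>" by (metis (mono_tags) \<delta>_def injI)
  define c where "c \<alpha> = (if \<alpha> \<in> range \<delta> then s ^ \<alpha> k / fact (\<alpha> k) else 0)" for \<alpha> :: "'n \<Rightarrow> nat"
  have "analytic_near x0 (\<lambda>x. exp (s * (x $ k - x0 $ k)))"
    unfolding analytic_near_def
  proof (intro exI[of _ c] exI[of _ 1] conjI ballI)
    fix x :: "complex ^ 'n"
    let ?t = "s * (x $ k - x0 $ k)"
    let ?u = "\<lambda>\<alpha>. c \<alpha> * (\<Prod>i\<in>UNIV. (x $ i - x0 $ i) ^ \<alpha> i)"
    have "((\<lambda>m. ?t ^ m /\<^sub>R fact m) has_sum exp ?t) UNIV"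
      using norm_summable_imp_has_sum[OF summable_norm_exp exp_converges] .
    moreover have "(?u \<circ> \<delta>) m = ?t ^ m /\<^sub>R fact m" for m
    proof -
      have "(\<Prod>i\<in>UNIV. (x $ i - x0 $ i) ^ \<delta> m i) = (x $ k - x0 $ k) ^ m"
        by (simp add: \<delta>_def if_distrib[of "\<lambda>m. _ ^ m"] cong: if_cong)
      moreover have "c (\<delta> m) = s ^ m / fact m" by (simp add: c_def) (simp add: \<delta>_def)
      ultimately show ?thesis
        by (simp add: power_mult_distrib scaleR_conv_of_real divide_inverse mult_ac)
    qed
    ultimately have "((?u \<circ> \<delta>) has_sum exp ?t) UNIV" by presburger
    then have "(?u has_sum exp ?t) (range \<delta>)" using has_sum_reindex[OF inj] by blast
    then show "(?u has_sum exp ?t) UNIV"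
      by (subst has_sum_cong_neutral[where g = ?u and T = "range \<delta>"]) (auto simp: c_def)
  qed simp
  then have "analytic_near x0 (\<lambda>x. exp (s * (x $ k - x0 $ k)) * exp (s * x0 $ k))"
    by (intro analytic_near_mult analytic_near_const)
  then show ?thesis by (simp add: exp_add[symmetric] algebra_simps)
qed

text \<open>
  Polydiscs are needed next to balls, since a power series is estimated one coordinate at a time.
\<close>

lemma small_coords_imp_norm_less:
  fixes r :: real assumes "r > 0"
  obtains R where "R > 0" "\<And>y :: complex ^ 'n::finite. (\<And>j. norm (y $ j) \<le> R) \<Longrightarrow> norm y < r"
proof
  define R where "R = r / (2 * real CARD('n))"
  show "R > 0" using assms by (simp add: R_def)
  fix y :: "complex ^ 'n" assume y: "\<And>j. norm (y $ j) \<le> R"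
  have "norm y \<le> (\<Sum>j\<in>UNIV. norm (y $ j))"
    unfolding norm_vec_def by (rule L2_set_le_sum) simp
  also have "\<dots> \<le> (\<Sum>j\<in>(UNIV :: 'n set). R)" by (intro sum_mono y)
  also have "\<dots> = r / 2" by (simp add: R_def)
  finally show "norm y < r" using assms by simp
qed

text \<open>
  On a polydisc inside the ball of convergence the series converges uniformly, by the M-test with
  the absolutely convergent series at the vertex of the polydisc. Weierstrass' theorem, applied to
  the net of finite partial sums in one complex direction, gives differentiation under the sum.
\<close>

lemma
  fixes g :: "complex ^ 'n::finite \<Rightarrow> complex"
  assumes "analytic_near x0 g"
  shows analytic_near_partial: "analytic_near x0 (partial i g)"
    and analytic_near_differentiable:
      "\<forall>\<^sub>F x in nhds x0. (\<lambda>w. g (x + axis i w)) field_differentiable at 0"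
proof -
  obtain c r where r: "r > 0" and g: "\<forall>x\<in>ball x0 r.
      ((\<lambda>\<alpha>. c \<alpha> * (\<Prod>i\<in>UNIV. (x $ i - x0 $ i) ^ \<alpha> i)) has_sum g x) UNIV"
    using assms(1) unfolding analytic_near_def by blast
  obtain R where R: "R > 0" "\<And>y :: complex ^ 'n. (\<And>j. norm (y $ j) \<le> R) \<Longrightarrow> norm y < r"
    using small_coords_imp_norm_less[OF r, where ?'n = 'n] by metis
  define M where "M \<alpha> = norm (c \<alpha>) * (\<Prod>j\<in>UNIV. R ^ \<alpha> j)" for \<alpha> :: "'n \<Rightarrow> nat"
  have M: "M summable_on UNIV"
  proof -
    define x where "x = x0 + (\<chi> j. of_real R)"
    have "x \<in> ball x0 r" using R(2)[of "x - x0"] R(1)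
      by (simp add: x_def dist_norm norm_minus_commute)
    then have "(\<lambda>\<alpha>. c \<alpha> * (\<Prod>j\<in>UNIV. (x $ j - x0 $ j) ^ \<alpha> j)) summable_on UNIV"
      using g has_sum_imp_summable by blast
    then have "(\<lambda>\<alpha>. norm (c \<alpha> * (\<Prod>j\<in>UNIV. (x $ j - x0 $ j) ^ \<alpha> j))) summable_on UNIV"
      by (rule summable_on_iff_abs_summable_on_complex[THEN iffD1])
    then show ?thesis using R(1)
      by (simp add: M_def[abs_def] x_def norm_mult prod_norm[symmetric] norm_power)
  qed
  \<comment> \<open>Coefficients of the termwise derivative, reindexed by \<open>\<beta>\<close> with \<open>\<alpha> = \<beta> + e\<^sub>i\<close>.\<close>
  define c' where "c' \<beta> = c (\<beta>(i := \<beta> i + 1)) * of_nat (\<beta> i + 1)" for \<beta>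
  have main: "((\<lambda>\<beta>. c' \<beta> * (\<Prod>j\<in>UNIV. (x $ j - x0 $ j) ^ \<beta> j)) has_sum partial i g x) UNIV \<and>
      (\<lambda>w. g (x + axis i w)) field_differentiable at 0"
    if x: "x \<in> ball x0 (R / 2)" for x
  proof -
    define y where "y = x - x0"
    have y: "norm (y $ j) \<le> R / 2" for j
      using x Finite_Cartesian_Product.norm_nth_le[of y j]
      by (simp add: y_def dist_norm norm_minus_commute)
    define K where "K \<alpha> = (\<Prod>j\<in>UNIV - {i}. (y $ j) ^ \<alpha> j)" for \<alpha>
    define trm where "trm \<alpha> w = c \<alpha> * (K \<alpha> * (y $ i + w) ^ \<alpha> i)" for \<alpha> w
    have trm_eq: "c \<alpha> * (\<Prod>j\<in>UNIV. ((x + axis i w) $ j - x0 $ j) ^ \<alpha> j) = trm \<alpha> w" for \<alpha> w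
    proof -
      have "(x + axis i w) $ i - x0 $ i = y $ i + w" by (simp add: y_def axis_def)
      moreover have "(\<Prod>j\<in>UNIV. ((x + axis i w) $ j - x0 $ j) ^ \<alpha> j) =
          ((x + axis i w) $ i - x0 $ i) ^ \<alpha> i * (\<Prod>j\<in>UNIV - {i}. ((x + axis i w) $ j - x0 $ j) ^ \<alpha> j)"
        by (rule prod.remove) auto
      moreover have "(\<Prod>j\<in>UNIV - {i}. ((x + axis i w) $ j - x0 $ j) ^ \<alpha> j) = K \<alpha>"
        unfolding K_def by (rule prod.cong) (auto simp: y_def axis_def)
      ultimately show ?thesis by (simp only: trm_def mult.commute)
    qed
    have near: "norm ((x + axis i w - x0) $ j) \<le> R" if "w \<in> cball 0 (R / 2)" for w j
      using that y[of j] norm_triangle_ineq[of "y $ j" w] R(1)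
      by (auto simp: y_def axis_def algebra_simps)
    have sum: "((\<lambda>\<alpha>. trm \<alpha> w) has_sum g (x + axis i w)) UNIV" if "w \<in> cball 0 (R / 2)" for w
    proof -
      have "x + axis i w \<in> ball x0 r"
        using R(2)[OF near[OF that]] by (simp add: dist_norm norm_minus_commute)
      then have "((\<lambda>\<alpha>. c \<alpha> * (\<Prod>j\<in>UNIV. ((x + axis i w) $ j - x0 $ j) ^ \<alpha> j))
          has_sum g (x + axis i w)) UNIV"
        using g by blast
      then show ?thesis by (simp only: trm_eq)
    qed
    have bound: "norm (trm \<alpha> w) \<le> M \<alpha>" if "w \<in> cball 0 (R / 2)" for w \<alpha>
    proof -
      have "norm (\<Prod>j\<in>UNIV. ((x + axis i w) $ j - x0 $ j) ^ \<alpha> j) \<le> (\<Prod>j\<in>UNIV. R ^ \<alpha> j)"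
        unfolding prod_norm[symmetric] using near[OF that]
        by (intro prod_mono) (auto simp: norm_power intro!: power_mono)
      then show ?thesis unfolding trm_eq[symmetric] M_def norm_mult by (intro mult_left_mono) auto
    qed
    have ulim: "uniform_limit (cball 0 (R / 2)) (\<lambda>X w. \<Sum>\<alpha>\<in>X. trm \<alpha> w) (\<lambda>w. g (x + axis i w))
        (finite_subsets_at_top UNIV)"
      by (rule Weierstrass_m_test_general'[OF bound sum M])
    have holo: "(\<lambda>w. \<Sum>\<alpha>\<in>X. trm \<alpha> w) holomorphic_on S" for X S
      unfolding trm_def by (intro holomorphic_intros)
    have "(\<lambda>w. g (x + axis i w)) holomorphic_on ball 0 (R / 2)"
      by (rule holomorphic_uniform_limit[OF _ ulim])
         (auto intro!: always_eventually holo holomorphic_on_imp_continuous_on)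
    then have diff: "(\<lambda>w. g (x + axis i w)) field_differentiable at 0"
      using R(1) by (auto intro: holomorphic_on_imp_differentiable_at)
    have "((\<lambda>X. deriv (\<lambda>w. \<Sum>\<alpha>\<in>X. trm \<alpha> w) 0) \<longlongrightarrow> deriv (\<lambda>w. g (x + axis i w)) 0)
        (finite_subsets_at_top UNIV)"
      using R(1) by (intro deriv_complex_uniform_limit[where A = "ball 0 (R / 2)"]
          uniform_limit_on_subset[OF ulim] always_eventually allI holo) auto
    moreover have "deriv (\<lambda>w. \<Sum>\<alpha>\<in>X. trm \<alpha> w) 0 =
        (\<Sum>\<alpha>\<in>X. c \<alpha> * (K \<alpha> * (of_nat (\<alpha> i) * (y $ i) ^ (\<alpha> i - 1))))" for X
      unfolding trm_def
      by (rule DERIV_imp_deriv) (auto intro!: derivative_eq_intros sum.cong)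
    ultimately have "((\<lambda>\<alpha>. c \<alpha> * (K \<alpha> * (of_nat (\<alpha> i) * (y $ i) ^ (\<alpha> i - 1)))) has_sum partial i g x) UNIV"
      by (simp add: has_sum_def partial_def)
    then have *: "((\<lambda>\<alpha>. c \<alpha> * (K \<alpha> * (of_nat (\<alpha> i) * (y $ i) ^ (\<alpha> i - 1)))) has_sum partial i g x) {\<alpha>. \<alpha> i > 0}"
      by (subst (asm) has_sum_cong_neutral[where T = "{\<alpha>. \<alpha> i > 0}"]) auto
    have bij: "bij_betw (\<lambda>\<beta>. \<beta>(i := \<beta> i + 1)) UNIV {\<alpha> :: 'n \<Rightarrow> nat. \<alpha> i > 0}"
      by (rule bij_betwI[where g = "\<lambda>\<alpha>. \<alpha>(i := \<alpha> i - 1)"]) auto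
    have "c (\<beta>(i := \<beta> i + 1)) * (K (\<beta>(i := \<beta> i + 1)) * (of_nat ((\<beta>(i := \<beta> i + 1)) i) *
        (y $ i) ^ ((\<beta>(i := \<beta> i + 1)) i - 1))) = c' \<beta> * (\<Prod>j\<in>UNIV. (x $ j - x0 $ j) ^ \<beta> j)" for \<beta>
    proof -
      have "K (\<beta>(i := \<beta> i + 1)) = K \<beta>" unfolding K_def by (rule prod.cong) auto
      moreover have "(\<Prod>j\<in>UNIV. (x $ j - x0 $ j) ^ \<beta> j) = y $ i ^ \<beta> i * K \<beta>"
        unfolding K_def y_def by (subst prod.remove[of _ i]) auto
      ultimately show ?thesis by (simp add: c'_def)
    qed
    then show ?thesis
      using * diff has_sum_reindex_bij_betw[OF bij, of "\<lambda>\<alpha>. c \<alpha> * (K \<alpha> * (of_nat (\<alpha> i) * (y $ i) ^ (\<alpha> i - 1)))"]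
      by presburger
  qed
  show "analytic_near x0 (partial i g)"
    unfolding analytic_near_def using main R(1) by (intro exI[of _ c'] exI[of _ "R / 2"]) auto
  show "\<forall>\<^sub>F x in nhds x0. (\<lambda>w. g (x + axis i w)) field_differentiable at 0"
    unfolding eventually_nhds_metric using main R(1)
    by (intro exI[of _ "R / 2"]) (auto simp: dist_commute)
qed

section \<open>Rings of germs, differential operators and matrices\<close>

text \<open>
  The operations of \<open>O_ring\<close> and the partial derivatives are defined through chosen representatives.
  Any two representatives agree near \<open>x0\<close>, so they can be computed on arbitrary ones.
\<close>

lemma germ_eq_iff: "germ x0 g = germ x0 h \<longleftrightarrow> (\<forall>\<^sub>F x in nhds x0. g x = h x)"
proof
  assume "germ x0 g = germ x0 h"
  moreover have "g \<in> germ x0 g" by (simp add: germ_def)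
  ultimately show "\<forall>\<^sub>F x in nhds x0. g x = h x" by (simp add: germ_def)
next
  assume *: "\<forall>\<^sub>F x in nhds x0. g x = h x"
  show "germ x0 g = germ x0 h"
    unfolding germ_def using * by (auto elim: eventually_elim2)
qed

lemma rep_germ: "\<forall>\<^sub>F x in nhds x0. rep (germ x0 g) x = g x"
proof -
  have "rep (germ x0 g) \<in> germ x0 g"
    unfolding rep_def by (rule someI[of _ g]) (simp add: germ_def)
  then show ?thesis by (simp add: germ_def)
qed

lemma O_mult_germ: "germ x0 g \<otimes>\<^bsub>O_ring x0\<^esub> germ x0 h = germ x0 (\<lambda>x. g x * h x)"
  unfolding O_ring_def using rep_germ[of x0 g] rep_germ[of x0 h]
  by (auto simp: germ_eq_iff elim: eventually_elim2)

lemma O_add_germ: "germ x0 g \<oplus>\<^bsub>O_ring x0\<^esub> germ x0 h = germ x0 (\<lambda>x. g x + h x)"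
  unfolding O_ring_def using rep_germ[of x0 g] rep_germ[of x0 h]
  by (auto simp: germ_eq_iff elim: eventually_elim2)

lemma O_one: "\<one>\<^bsub>O_ring x0\<^esub> = germ x0 (\<lambda>x. 1)"
  and O_zero: "\<zero>\<^bsub>O_ring x0\<^esub> = germ x0 (\<lambda>x. 0)"
  by (simp_all add: O_ring_def)

lemma germ_in_O: "analytic_near x0 g \<Longrightarrow> germ x0 g \<in> carrier (O_ring x0)"
  by (simp add: O_ring_def)

lemma in_O_E:
  assumes "G \<in> carrier (O_ring x0)"
  obtains g where "analytic_near x0 g" "G = germ x0 g"
  using assms by (auto simp: O_ring_def)

lemma cring_O_ring: "cring (O_ring x0)"
proof (intro cringI abelian_groupI comm_monoidI)
  fix G assume "G \<in> carrier (O_ring x0)"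
  then obtain g where g: "analytic_near x0 g" "G = germ x0 g" by (rule in_O_E)
  show "\<exists>H\<in>carrier (O_ring x0). H \<oplus>\<^bsub>O_ring x0\<^esub> G = \<zero>\<^bsub>O_ring x0\<^esub>"
  proof
    show "germ x0 (\<lambda>x. - 1 * g x) \<in> carrier (O_ring x0)"
      using g by (intro germ_in_O analytic_near_mult analytic_near_const)
  qed (simp add: g O_add_germ O_zero)
qed (auto elim!: in_O_E simp: O_mult_germ O_add_germ O_one O_zero algebra_simps
      intro!: germ_in_O analytic_near_add analytic_near_mult analytic_near_const)

lemma partial_cong:
  assumes "\<forall>\<^sub>F x in nhds x0. g x = h x"
  shows "\<forall>\<^sub>F x in nhds x0. partial i g x = partial i h x"
proof -
  have "\<forall>\<^sub>F y in nhds x0. \<forall>\<^sub>F x in nhds y. g x = h x"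
    using assms by (simp add: eventually_eventually)
  then show ?thesis
  proof eventually_elim
    case (elim y)
    have "((\<lambda>w. y + axis i w) \<longlongrightarrow> y) (nhds 0)"
    proof (rule vec_tendstoI)
      fix j
      have "((\<lambda>w. y $ j + w) \<longlongrightarrow> y $ j + 0) (nhds 0)"
        by (intro tendsto_intros filterlim_ident)
      then show "((\<lambda>w. (y + axis i w) $ j) \<longlongrightarrow> y $ j) (nhds 0)"
        by (cases "j = i") (simp_all add: axis_def)
    qed
    then have "\<forall>\<^sub>F w in nhds 0. g (y + axis i w) = h (y + axis i w)"
      by (rule eventually_compose_filterlim[OF elim])
    then show ?case unfolding partial_def by (intro deriv_cong_ev) auto
  qed
qed

lemma germ_partial_rep: "germ x0 (partial i (rep (germ x0 g))) = germ x0 (partial i g)"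
  using partial_cong[OF rep_germ] by (simp add: germ_eq_iff)

lemma germ_partial_add:
  assumes "analytic_near x0 g" "analytic_near x0 h"
  shows "germ x0 (partial i (\<lambda>x. g x + h x)) = germ x0 (\<lambda>x. partial i g x + partial i h x)"
  unfolding germ_eq_iff
  using analytic_near_differentiable[OF assms(1), of i] analytic_near_differentiable[OF assms(2), of i]
  by eventually_elim (simp add: partial_def)

lemma germ_partial_cmult:
  assumes "analytic_near x0 g"
  shows "germ x0 (partial i (\<lambda>x. k * g x)) = germ x0 (\<lambda>x. k * partial i g x)"
  unfolding germ_eq_iff using analytic_near_differentiable[OF assms(1), of i]
  by eventually_elim (simp add: partial_def)

text \<open>
  Differential operators are \<open>\<complex>\<close>-linear: additivity gives one distributive law, and commuting with
  constants lets them act past multiplication by functions of the spectral point.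
\<close>

lemma diffops_extensional: "S \<in> diffops x0 \<Longrightarrow> S \<in> extensional (carrier (O_ring x0))"
  by (cases S rule: diffops.cases) (auto simp: compose_def)

lemma diffops_linear:
  assumes "S \<in> diffops x0"
  shows "(\<forall>H\<in>carrier (O_ring x0). S H \<in> carrier (O_ring x0)) \<and>
    (\<forall>G\<in>carrier (O_ring x0). \<forall>H\<in>carrier (O_ring x0).
      S (G \<oplus>\<^bsub>O_ring x0\<^esub> H) = S G \<oplus>\<^bsub>O_ring x0\<^esub> S H) \<and>
    (\<forall>k. \<forall>H\<in>carrier (O_ring x0).
      S (germ x0 (\<lambda>_. k) \<otimes>\<^bsub>O_ring x0\<^esub> H) = germ x0 (\<lambda>_. k) \<otimes>\<^bsub>O_ring x0\<^esub> S H)"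
proof -
  interpret cring "O_ring x0" by (rule cring_O_ring)
  have const: "germ x0 (\<lambda>_. k) \<in> carrier (O_ring x0)" for k
    by (intro germ_in_O analytic_near_const)
  show ?thesis using assms
  proof (induction S rule: diffops.induct)
    case (multiplication G)
    then show ?case by (auto simp: r_distr const m_lcomm)
  next
    case (derivative i)
    let ?d = "\<lambda>H\<in>carrier (O_ring x0). germ x0 (partial i (rep H))"
    have d: "?d (germ x0 g) = germ x0 (partial i g)" if "analytic_near x0 g" for g
      using that by (simp add: germ_in_O germ_partial_rep)
    show ?case
    proof (intro conjI ballI allI; elim in_O_E; hypsubst)
      fix g h k assume g: "analytic_near x0 g" and h: "analytic_near x0 h"
      show "?d (germ x0 g) \<in> carrier (O_ring x0)"
        unfolding d[OF g] by (intro germ_in_O analytic_near_partial g)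
      show "?d (germ x0 g \<oplus>\<^bsub>O_ring x0\<^esub> germ x0 h) =
          ?d (germ x0 g) \<oplus>\<^bsub>O_ring x0\<^esub> ?d (germ x0 h)"
        unfolding O_add_germ d[OF g] d[OF h] d[OF analytic_near_add[OF g h]]
        by (rule germ_partial_add[OF g h])
      show "?d (germ x0 (\<lambda>_. k) \<otimes>\<^bsub>O_ring x0\<^esub> germ x0 g) =
          germ x0 (\<lambda>_. k) \<otimes>\<^bsub>O_ring x0\<^esub> ?d (germ x0 g)"
        unfolding O_mult_germ d[OF g] d[OF analytic_near_mult[OF analytic_near_const g]]
        by (rule germ_partial_cmult[OF g])
    qed
  next
    case (sum S T)
    then show ?case by (auto simp: const r_distr a_ac)
  next
    case (composition S T)
    then show ?case by (auto simp: compose_def const)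
  qed
qed

lemmas diffops_closed = diffops_linear[THEN conjunct1, rule_format]
  and diffops_additive = diffops_linear[THEN conjunct2, THEN conjunct1, rule_format]
  and diffops_const = diffops_linear[THEN conjunct2, THEN conjunct2, rule_format]

lemma D_ring_apply:
  assumes "H \<in> carrier (O_ring x0)"
  shows "(S \<otimes>\<^bsub>D_ring x0\<^esub> T) H = S (T H)"
    and "(S \<oplus>\<^bsub>D_ring x0\<^esub> T) H = S H \<oplus>\<^bsub>O_ring x0\<^esub> T H"
    and "\<one>\<^bsub>D_ring x0\<^esub> H = H"
    and "\<zero>\<^bsub>D_ring x0\<^esub> H = \<zero>\<^bsub>O_ring x0\<^esub>"
  using assms by (simp_all add: D_ring_def compose_def)

definition mult_op :: "complex ^ 'n \<Rightarrow> (complex ^ 'n \<Rightarrow> complex) \<Rightarrow> 'n::finite germ \<Rightarrow> 'n germ"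
  where "mult_op x0 g = (\<lambda>H\<in>carrier (O_ring x0). germ x0 g \<otimes>\<^bsub>O_ring x0\<^esub> H)"

lemma mult_op_in_D: "analytic_near x0 g \<Longrightarrow> mult_op x0 g \<in> carrier (D_ring x0)"
  by (simp add: D_ring_def mult_op_def diffops.multiplication germ_in_O)

lemma D_one_eq: "\<one>\<^bsub>D_ring x0\<^esub> = mult_op x0 (\<lambda>_. 1)"
  and D_zero_eq: "\<zero>\<^bsub>D_ring x0\<^esub> = mult_op x0 (\<lambda>_. 0)"
proof -
  interpret cring "O_ring x0" by (rule cring_O_ring)
  show "\<one>\<^bsub>D_ring x0\<^esub> = mult_op x0 (\<lambda>_. 1)" "\<zero>\<^bsub>D_ring x0\<^esub> = mult_op x0 (\<lambda>_. 0)"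
    by (simp_all add: D_ring_def mult_op_def O_one[symmetric] O_zero[symmetric] cong: restrict_cong)
qed

lemma D_ring_closed:
  shows "S \<in> carrier (D_ring x0) \<Longrightarrow> T \<in> carrier (D_ring x0) \<Longrightarrow>
      S \<otimes>\<^bsub>D_ring x0\<^esub> T \<in> carrier (D_ring x0)"
    and "S \<in> carrier (D_ring x0) \<Longrightarrow> T \<in> carrier (D_ring x0) \<Longrightarrow>
      S \<oplus>\<^bsub>D_ring x0\<^esub> T \<in> carrier (D_ring x0)"
    and "\<one>\<^bsub>D_ring x0\<^esub> \<in> carrier (D_ring x0)"
    and "\<zero>\<^bsub>D_ring x0\<^esub> \<in> carrier (D_ring x0)"
  using mult_op_in_D[OF analytic_near_const, of x0 1] mult_op_in_D[OF analytic_near_const, of x0 0]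
  by (simp_all add: D_one_eq D_zero_eq)
     (simp_all add: D_ring_def diffops.sum diffops.composition)

lemma D_apply_closed:
  "S \<in> carrier (D_ring x0) \<Longrightarrow> H \<in> carrier (O_ring x0) \<Longrightarrow> S H \<in> carrier (O_ring x0)"
  by (simp add: D_ring_def diffops_closed)

lemma D_apply_add:
  "S \<in> carrier (D_ring x0) \<Longrightarrow> G \<in> carrier (O_ring x0) \<Longrightarrow> H \<in> carrier (O_ring x0) \<Longrightarrow>
    S (G \<oplus>\<^bsub>O_ring x0\<^esub> H) = S G \<oplus>\<^bsub>O_ring x0\<^esub> S H"
  by (simp add: D_ring_def diffops_additive)

lemma D_apply_const_mult:
  "S \<in> carrier (D_ring x0) \<Longrightarrow> H \<in> carrier (O_ring x0) \<Longrightarrow>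
    S (germ x0 (\<lambda>_. k) \<otimes>\<^bsub>O_ring x0\<^esub> H) = germ x0 (\<lambda>_. k) \<otimes>\<^bsub>O_ring x0\<^esub> S H"
  by (simp add: D_ring_def diffops_const)

lemma D_eqI:
  assumes "S \<in> carrier (D_ring x0)" "T \<in> carrier (D_ring x0)"
    and "\<And>H. H \<in> carrier (O_ring x0) \<Longrightarrow> S H = T H"
  shows "S = T"
proof -
  have "S \<in> diffops x0" "T \<in> diffops x0" using assms by (simp_all add: D_ring_def)
  then show ?thesis
    by (intro extensionalityI[OF diffops_extensional diffops_extensional] assms(3))
qed

lemma ring_D_ring: "ring (D_ring x0)"
proof -
  interpret O: cring "O_ring x0" by (rule cring_O_ring)
  note D = D_ring_closed D_ring_apply D_apply_closed D_apply_add
  show ?thesis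
  proof (intro ringI abelian_groupI monoidI D_ring_closed)
    fix S assume S: "S \<in> carrier (D_ring x0)"
    have N: "mult_op x0 (\<lambda>_. - 1) \<in> carrier (D_ring x0)" by (intro mult_op_in_D analytic_near_const)
    show "\<exists>T\<in>carrier (D_ring x0). T \<oplus>\<^bsub>D_ring x0\<^esub> S = \<zero>\<^bsub>D_ring x0\<^esub>"
    proof
      show "(mult_op x0 (\<lambda>_. - 1) \<otimes>\<^bsub>D_ring x0\<^esub> S) \<oplus>\<^bsub>D_ring x0\<^esub> S = \<zero>\<^bsub>D_ring x0\<^esub>"
      proof (rule D_eqI)
        fix H assume H: "H \<in> carrier (O_ring x0)"
        then obtain h where "S H = germ x0 h" using D_apply_closed[OF S] by (metis in_O_E)
        then show "((mult_op x0 (\<lambda>_. - 1) \<otimes>\<^bsub>D_ring x0\<^esub> S) \<oplus>\<^bsub>D_ring x0\<^esub> S) H = \<zero>\<^bsub>D_ring x0\<^esub> H"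
          using H D_apply_closed[OF S H] by (simp add: D mult_op_def O_mult_germ O_add_germ O_zero)
      qed (intro D_ring_closed N S)+
    qed (intro D_ring_closed N S)
  qed (assumption | (rule D_eqI[of _ x0]; simp add: D O.a_ac))+
qed

lemma (in abelian_monoid) finsum_swap:
  assumes "finite A" "finite B" "\<And>a b. a \<in> A \<Longrightarrow> b \<in> B \<Longrightarrow> h a b \<in> carrier G"
  shows "(\<Oplus>a\<in>A. \<Oplus>b\<in>B. h a b) = (\<Oplus>b\<in>B. \<Oplus>a\<in>A. h a b)"
  using assms(1,3)
proof (induction A rule: finite_induct)
  case (insert x A)
  have *: "h x \<in> B \<rightarrow> carrier G" "(\<lambda>b. \<Oplus>a\<in>A. h a b) \<in> B \<rightarrow> carrier G"
    using insert.prems by (auto intro!: finsum_closed)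
  have "(\<Oplus>a\<in>insert x A. \<Oplus>b\<in>B. h a b) = (\<Oplus>b\<in>B. h x b) \<oplus> (\<Oplus>b\<in>B. \<Oplus>a\<in>A. h a b)"
    using insert by (subst finsum_insert) (auto intro!: finsum_closed)
  also have "\<dots> = (\<Oplus>b\<in>B. h x b \<oplus> (\<Oplus>a\<in>A. h a b))"
    using finsum_addf[OF *] by simp
  also have "\<dots> = (\<Oplus>b\<in>B. \<Oplus>a\<in>insert x A. h a b)"
    using insert by (intro finsum_cong') (auto intro!: finsum_closed)
  finally show ?case .
qed simp

lemma ring_Mat_ring:
  assumes "ring R"
  shows "ring (Mat_ring R :: ('n::finite \<Rightarrow> 'n \<Rightarrow> 'a) ring)"
proof -
  interpret ring R by (rule assms)
  have sum: "(\<Oplus>\<^bsub>R\<^esub>j\<in>UNIV. g j) \<in> carrier R" if "\<And>j. g j \<in> carrier R" for g :: "'n \<Rightarrow> 'a"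
    using that by auto
  have delta: "(\<Oplus>\<^bsub>R\<^esub>j\<in>UNIV. if i = j then g j else \<zero>\<^bsub>R\<^esub>) = g i"
    if "\<And>j. g j \<in> carrier R" for g :: "'n \<Rightarrow> 'a" and i
    using that by (intro finsum_singleton) auto
  show ?thesis
  proof (intro ringI abelian_groupI monoidI)
    fix X assume "X \<in> carrier (Mat_ring R :: ('n \<Rightarrow> 'n \<Rightarrow> 'a) ring)"
    then have X: "X i j \<in> carrier R" for i j by (simp add: Mat_ring_def)
    show "\<exists>Y\<in>carrier (Mat_ring R). Y \<oplus>\<^bsub>Mat_ring R\<^esub> X = \<zero>\<^bsub>Mat_ring R\<^esub>"
      by (rule bexI[of _ "\<lambda>i j. \<ominus>\<^bsub>R\<^esub> X i j"]) (auto simp: Mat_ring_def X l_neg)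
    have "(\<Oplus>\<^bsub>R\<^esub>j\<in>UNIV. (if i = j then \<one>\<^bsub>R\<^esub> else \<zero>\<^bsub>R\<^esub>) \<otimes>\<^bsub>R\<^esub> X j k) = X i k" for i k
      using delta[of "\<lambda>j. X j k" i] X by (simp add: if_distrib[of "\<lambda>a. a \<otimes>\<^bsub>R\<^esub> _"] cong: if_cong)
    then show "\<one>\<^bsub>Mat_ring R\<^esub> \<otimes>\<^bsub>Mat_ring R\<^esub> X = X" by (simp add: Mat_ring_def)
    have "(\<Oplus>\<^bsub>R\<^esub>j\<in>UNIV. X i j \<otimes>\<^bsub>R\<^esub> (if j = k then \<one>\<^bsub>R\<^esub> else \<zero>\<^bsub>R\<^esub>)) = X i k" for i k
      using delta[of "\<lambda>j. X i j" k] X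
      by (simp add: if_distrib[of "\<lambda>a. _ \<otimes>\<^bsub>R\<^esub> a"] eq_commute[of _ k] cong: if_cong)
    then show "X \<otimes>\<^bsub>Mat_ring R\<^esub> \<one>\<^bsub>Mat_ring R\<^esub> = X" by (simp add: Mat_ring_def)
  next
    fix X Y Z assume "X \<in> carrier (Mat_ring R :: ('n \<Rightarrow> 'n \<Rightarrow> 'a) ring)"
      "Y \<in> carrier (Mat_ring R :: ('n \<Rightarrow> 'n \<Rightarrow> 'a) ring)"
      "Z \<in> carrier (Mat_ring R :: ('n \<Rightarrow> 'n \<Rightarrow> 'a) ring)"
    then have XYZ: "X i j \<in> carrier R" "Y i j \<in> carrier R" "Z i j \<in> carrier R" for i j
      by (simp_all add: Mat_ring_def)
    have "(\<Oplus>\<^bsub>R\<^esub>j\<in>UNIV. (\<Oplus>\<^bsub>R\<^esub>k\<in>UNIV. X i k \<otimes>\<^bsub>R\<^esub> Y k j) \<otimes>\<^bsub>R\<^esub> Z j l) =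
        (\<Oplus>\<^bsub>R\<^esub>k\<in>UNIV. X i k \<otimes>\<^bsub>R\<^esub> (\<Oplus>\<^bsub>R\<^esub>j\<in>UNIV. Y k j \<otimes>\<^bsub>R\<^esub> Z j l))" for i l
    proof -
      have "(\<Oplus>\<^bsub>R\<^esub>j\<in>UNIV. (\<Oplus>\<^bsub>R\<^esub>k\<in>UNIV. X i k \<otimes>\<^bsub>R\<^esub> Y k j) \<otimes>\<^bsub>R\<^esub> Z j l) =
          (\<Oplus>\<^bsub>R\<^esub>j\<in>UNIV. \<Oplus>\<^bsub>R\<^esub>k\<in>UNIV. X i k \<otimes>\<^bsub>R\<^esub> Y k j \<otimes>\<^bsub>R\<^esub> Z j l)"
        by (intro finsum_cong') (auto intro!: finsum_ldistr finsum_closed simp: XYZ)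
      also have "\<dots> = (\<Oplus>\<^bsub>R\<^esub>k\<in>UNIV. \<Oplus>\<^bsub>R\<^esub>j\<in>UNIV. X i k \<otimes>\<^bsub>R\<^esub> Y k j \<otimes>\<^bsub>R\<^esub> Z j l)"
        by (rule finsum_swap) (auto simp: XYZ)
      also have "\<dots> = (\<Oplus>\<^bsub>R\<^esub>k\<in>UNIV. X i k \<otimes>\<^bsub>R\<^esub> (\<Oplus>\<^bsub>R\<^esub>j\<in>UNIV. Y k j \<otimes>\<^bsub>R\<^esub> Z j l))"
        by (intro finsum_cong') (auto intro!: finsum_closed simp: XYZ finsum_rdistr m_assoc)
      finally show ?thesis .
    qed
    then show "X \<otimes>\<^bsub>Mat_ring R\<^esub> Y \<otimes>\<^bsub>Mat_ring R\<^esub> Z = X \<otimes>\<^bsub>Mat_ring R\<^esub> (Y \<otimes>\<^bsub>Mat_ring R\<^esub> Z)"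
      by (simp add: Mat_ring_def)
    show "(X \<oplus>\<^bsub>Mat_ring R\<^esub> Y) \<otimes>\<^bsub>Mat_ring R\<^esub> Z =
        X \<otimes>\<^bsub>Mat_ring R\<^esub> Z \<oplus>\<^bsub>Mat_ring R\<^esub> Y \<otimes>\<^bsub>Mat_ring R\<^esub> Z"
      by (simp add: Mat_ring_def XYZ l_distr finsum_addf)
    show "Z \<otimes>\<^bsub>Mat_ring R\<^esub> (X \<oplus>\<^bsub>Mat_ring R\<^esub> Y) =
        Z \<otimes>\<^bsub>Mat_ring R\<^esub> X \<oplus>\<^bsub>Mat_ring R\<^esub> Z \<otimes>\<^bsub>Mat_ring R\<^esub> Y"
      by (simp add: Mat_ring_def XYZ r_distr finsum_addf)
  qed (auto simp: Mat_ring_def a_ac sum)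
qed

section \<open>Bihomogeneous polynomials\<close>

text \<open>
  A bihomogeneous polynomial is written as a single sum over exponent pairs \<open>(j, \<gamma>)\<close>, which makes the
  product a convolution. The exponent \<open>d - j\<close> of \<open>z2\<close> is a truncated difference: additivity of
  exponents holds only for pairs in \<open>bidx\<close>.
\<close>

lemma finite_exponents: "finite {\<alpha> :: 'n::finite \<Rightarrow> nat. (\<Sum>i\<in>UNIV. \<alpha> i) = e}"
proof (rule finite_subset)
  show "{\<alpha> :: 'n \<Rightarrow> nat. (\<Sum>i\<in>UNIV. \<alpha> i) = e} \<subseteq> PiE UNIV (\<lambda>_. {..e})"
    by (auto simp: PiE_def Pi_def intro: member_le_sum)
qed (simp add: finite_PiE)

definition bidx :: "nat \<Rightarrow> nat \<Rightarrow> (nat \<times> ('n::finite \<Rightarrow> nat)) set"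
  where "bidx d e = {..d} \<times> {\<alpha>. (\<Sum>i\<in>UNIV. \<alpha> i) = e}"

definition bmon :: "nat \<Rightarrow> nat \<times> ('n \<Rightarrow> nat) \<Rightarrow> 'n::finite point \<Rightarrow> complex"
  where "bmon d u = (\<lambda>(z1, z2, t). z1 ^ fst u * z2 ^ (d - fst u) * (\<Prod>i\<in>UNIV. t $ i ^ snd u i))"

definition bplus :: "nat \<times> ('n \<Rightarrow> nat) \<Rightarrow> nat \<times> ('n \<Rightarrow> nat) \<Rightarrow> nat \<times> ('n \<Rightarrow> nat)"
  where "bplus u v = (fst u + fst v, \<lambda>i. snd u i + snd v i)"

text \<open>Coefficients of the product of two bihomogeneous polynomials.\<close>

definition bconv ::
    "nat \<Rightarrow> nat \<Rightarrow> nat \<Rightarrow> nat \<Rightarrow> (nat \<Rightarrow> ('n::finite \<Rightarrow> nat) \<Rightarrow> complex) \<Rightarrow>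
     (nat \<Rightarrow> ('n \<Rightarrow> nat) \<Rightarrow> complex) \<Rightarrow> nat \<Rightarrow> ('n \<Rightarrow> nat) \<Rightarrow> complex"
  where "bconv d e d' e' c c' j \<gamma> =
    (\<Sum>w\<in>{w \<in> bidx d e \<times> bidx d' e'. bplus (fst w) (snd w) = (j, \<gamma>)}.
      c (fst (fst w)) (snd (fst w)) * c' (fst (snd w)) (snd (snd w)))"

lemma finite_bidx: "finite (bidx d e :: (nat \<times> ('n::finite \<Rightarrow> nat)) set)"
  by (simp add: bidx_def finite_exponents)

lemma bipoly_eq: "bipoly d e c p = (\<Sum>u\<in>bidx d e. c (fst u) (snd u) * bmon d u p)"
  by (cases p) (simp add: bipoly_def bidx_def bmon_def sum.cartesian_product case_prod_unfold mult.assoc)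

lemma bipoly_mult:
  "bipoly d e c p * bipoly d' e' c' p = bipoly (d + d') (e + e') (bconv d e d' e' c c') p"
proof -
  let ?W = "bidx d e \<times> bidx d' e'"
  let ?h = "\<lambda>w. c (fst (fst w)) (snd (fst w)) * c' (fst (snd w)) (snd (snd w))"
  let ?b = "\<lambda>w. bplus (fst w) (snd w)"
  have mon: "bmon d u p * bmon d' v p = bmon (d + d') (bplus u v) p"
    if "u \<in> bidx d e" "v \<in> bidx d' e'" for u v
  proof -
    have "d + d' - (fst u + fst v) = (d - fst u) + (d' - fst v)"
      using that by (auto simp: bidx_def)
    then show ?thesis
      by (cases p) (simp add: bmon_def bplus_def power_add prod.distrib)
  qed
  have sub: "?b ` ?W \<subseteq> bidx (d + d') (e + e')"
    by (auto simp: bidx_def bplus_def sum.distrib)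
  have "bipoly d e c p * bipoly d' e' c' p = (\<Sum>w\<in>?W. ?h w * bmon (d + d') (?b w) p)"
    unfolding bipoly_eq sum_product sum.cartesian_product
    by (intro sum.cong refl) (auto simp: mon[symmetric] mult_ac)
  also have "\<dots> = (\<Sum>y\<in>bidx (d + d') (e + e'). \<Sum>w\<in>{w\<in>?W. ?b w = y}. ?h w * bmon (d + d') (?b w) p)"
    by (rule sum.group[symmetric, OF _ _ sub]) (auto simp: finite_bidx)
  also have "\<dots> = (\<Sum>y\<in>bidx (d + d') (e + e'). (\<Sum>w\<in>{w\<in>?W. ?b w = y}. ?h w) * bmon (d + d') y p)"
    unfolding sum_distrib_right by (intro sum.cong refl) simp
  also have "\<dots> = bipoly (d + d') (e + e') (bconv d e d' e' c c') p"
    by (simp add: bipoly_eq bconv_def)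
  finally show ?thesis .
qed

lemma bipoly_add: "bipoly d e c p + bipoly d e c' p = bipoly d e (\<lambda>j \<gamma>. c j \<gamma> + c' j \<gamma>) p"
  by (simp add: bipoly_eq sum.distrib distrib_right)

lemma bipoly_cmult: "k * bipoly d e c p = bipoly d e (\<lambda>j \<gamma>. k * c j \<gamma>) p"
  by (simp add: bipoly_eq sum_distrib_left mult.assoc)

lemma bipoly_zero: "bipoly d e (\<lambda>_ _. 0) p = 0"
  by (simp add: bipoly_eq)

lemma bipoly_const: "bipoly 0 0 (\<lambda>_ _. k) (p :: 'n::finite point) = k"
proof -
  have b: "bidx 0 0 = {(0, \<lambda>_ :: 'n. 0)}" by (auto simp: bidx_def)
  show ?thesis by (simp add: bipoly_eq b bmon_def case_prod_unfold)
qed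

lemma bidx_0_1: "bidx 0 1 = range (\<lambda>k :: 'n::finite. (0, \<lambda>i. if i = k then 1 else 0))"
proof -
  define \<delta> where "\<delta> k = (\<lambda>i. if i = k then 1 else 0 :: nat)" for k :: 'n
  have "(\<Sum>i\<in>UNIV. \<alpha> i) = 1 \<longleftrightarrow> \<alpha> \<in> range \<delta>" for \<alpha> :: "'n \<Rightarrow> nat"
  proof
    assume "(\<Sum>i\<in>UNIV. \<alpha> i) = 1"
    then have "\<exists>k\<in>UNIV. \<alpha> k = 1 \<and> (\<forall>i\<in>UNIV. k \<noteq> i \<longrightarrow> \<alpha> i = 0)"
      by (rule sum_eq_1_iff[OF finite, THEN iffD1])
    then obtain k where k: "\<alpha> k = 1" and k': "\<forall>i\<in>UNIV. k \<noteq> i \<longrightarrow> \<alpha> i = 0" by (elim bexE conjE)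
    have "\<alpha> i = \<delta> k i" for i using k k'[rule_format, of i] by (cases "i = k") (simp_all add: \<delta>_def)
    then have "\<alpha> = \<delta> k" by (rule ext)
    then show "\<alpha> \<in> range \<delta>" by simp
  next
    assume "\<alpha> \<in> range \<delta>"
    then show "(\<Sum>i\<in>UNIV. \<alpha> i) = 1" by (elim rangeE) (simp add: \<delta>_def)
  qed
  then have "{\<alpha> :: 'n \<Rightarrow> nat. (\<Sum>i\<in>UNIV. \<alpha> i) = 1} = range \<delta>" by (simp only: Collect_mem_eq)
  then have "bidx 0 1 = {0} \<times> range \<delta>" by (simp only: bidx_def atMost_0)
  also have "\<dots> = range (\<lambda>k. (0, \<delta> k))" by blast
  finally show ?thesis by (simp only: \<delta>_def)
qed

lemma linear_eq_bipoly:
  "\<exists>c. \<forall>z1 z2 t. (\<Sum>i\<in>UNIV. \<alpha> $ i * t $ i) = bipoly 0 1 c (z1, z2, t)" for \<alpha> :: "complex ^ 'n::finite"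
proof (intro exI allI)
  define \<delta> where "\<delta> k = (\<lambda>i. if i = k then 1 else 0 :: nat)" for k :: 'n
  have inj: "inj (\<lambda>k. (0 :: nat, \<delta> k))"
  proof (rule injI)
    fix j k assume "(0 :: nat, \<delta> j) = (0, \<delta> k)"
    then have "\<delta> j j = \<delta> k j" by simp
    then show "j = k" by (simp add: \<delta>_def split: if_splits)
  qed
  fix z1 z2 and t :: "complex ^ 'n"
  have mon: "bmon 0 (0, \<delta> k) (z1, z2, t) = t $ k" for k
    by (simp add: bmon_def \<delta>_def if_distrib[of "\<lambda>m. _ ^ m"] cong: if_cong)
  have coeff: "(\<Sum>i\<in>UNIV. of_nat (\<delta> k i) * \<alpha> $ i) = \<alpha> $ k" for k
    by (simp add: \<delta>_def if_distrib[of of_nat] if_distrib[of "\<lambda>m. m * _"] cong: if_cong)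
  have "bipoly 0 1 (\<lambda>_ \<gamma>. \<Sum>i\<in>UNIV. of_nat (\<gamma> i) * \<alpha> $ i) (z1, z2, t) =
      (\<Sum>k\<in>UNIV. (\<Sum>i\<in>UNIV. of_nat (\<delta> k i) * \<alpha> $ i) * bmon 0 (0, \<delta> k) (z1, z2, t))"
    unfolding bipoly_eq bidx_0_1 \<delta>_def[symmetric] sum.reindex[OF inj] by (simp only: o_def fst_conv snd_conv)
  also have "\<dots> = (\<Sum>i\<in>UNIV. \<alpha> $ i * t $ i)" by (simp only: mon coeff)
  finally show "(\<Sum>i\<in>UNIV. \<alpha> $ i * t $ i) =
      bipoly 0 1 (\<lambda>_ \<gamma>. \<Sum>i\<in>UNIV. of_nat (\<gamma> i) * \<alpha> $ i) (z1, z2, t)" ..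
qed

lemma z_eq_bipoly: "\<exists>c. \<forall>z1 z2 t. z1 = bipoly 1 0 c (z1, z2, t :: complex ^ 'n::finite)"
  and z_eq_bipoly': "\<exists>c. \<forall>z1 z2 t. z2 = bipoly 1 0 c (z1, z2, t :: complex ^ 'n::finite)"
proof -
  have b: "bidx (Suc 0) 0 = {(0, \<lambda>_ :: 'n. 0), (1, \<lambda>_. 0)}" by (auto simp: bidx_def)
  show "\<exists>c. \<forall>z1 z2 t. z1 = bipoly 1 0 c (z1, z2, t :: complex ^ 'n)"
    by (rule exI[of _ "\<lambda>j _. of_nat j"]) (auto simp: bipoly_eq b bmon_def)
  show "\<exists>c. \<forall>z1 z2 t. z2 = bipoly 1 0 c (z1, z2, t :: complex ^ 'n)"
    by (rule exI[of _ "\<lambda>j _. 1 - of_nat j"]) (auto simp: bipoly_eq b bmon_def)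
qed

lemma form_eq: "form \<alpha> \<beta> (z1, z2, t) =
    z1 * (\<Sum>i\<in>UNIV. \<alpha> $ i * t $ i) + z2 * (\<Sum>i\<in>UNIV. \<beta> $ i * t $ i)"
  by (simp add: form_def sum_distrib_left sum.distrib mult_ac)

lemma form_eq_bipoly: "\<exists>c. \<forall>p. form \<alpha> \<beta> p = bipoly 1 1 c p"
proof -
  obtain cz where cz: "\<And>z1 z2 t. z1 = bipoly 1 0 cz (z1, z2, t :: complex ^ 'a)"
    using z_eq_bipoly by blast
  obtain cz' where cz': "\<And>z1 z2 t. z2 = bipoly 1 0 cz' (z1, z2, t :: complex ^ 'a)"
    using z_eq_bipoly' by blast
  obtain ca where ca: "\<And>z1 z2 t. (\<Sum>i\<in>UNIV. \<alpha> $ i * t $ i) = bipoly 0 1 ca (z1, z2, t)"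
    using linear_eq_bipoly[of \<alpha>] by blast
  obtain cb where cb: "\<And>z1 z2 t. (\<Sum>i\<in>UNIV. \<beta> $ i * t $ i) = bipoly 0 1 cb (z1, z2, t)"
    using linear_eq_bipoly[of \<beta>] by blast
  have "form \<alpha> \<beta> p =
      bipoly 1 1 (\<lambda>j \<gamma>. bconv 1 0 0 1 cz ca j \<gamma> + bconv 1 0 0 1 cz' cb j \<gamma>) p" for p
  proof -
    obtain z1 z2 t where p: "p = (z1, z2, t)" by (cases p)
    have "form \<alpha> \<beta> p = bipoly 1 0 cz p * bipoly 0 1 ca p + bipoly 1 0 cz' p * bipoly 0 1 cb p"
      by (simp only: p form_eq cz[symmetric] ca[symmetric] cz'[symmetric] cb[symmetric])
    then show ?thesis by (simp add: bipoly_mult bipoly_add)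
  qed
  then show ?thesis by blast
qed

lemma form_power_eq_bipoly: "\<exists>c. \<forall>p. form \<alpha> \<beta> p ^ N = bipoly N N c p"
proof (induction N)
  case 0
  show ?case by (rule exI[of _ "\<lambda>_ _. 1"]) (simp add: bipoly_const)
next
  case (Suc N)
  from Suc obtain c where c: "\<forall>p. form \<alpha> \<beta> p ^ N = bipoly N N c p" ..
  from form_eq_bipoly obtain c1 where c1: "\<forall>p. form \<alpha> \<beta> p = bipoly 1 1 c1 p" ..
  have "form \<alpha> \<beta> p ^ Suc N = bipoly (Suc N) (Suc N) (bconv 1 1 N N c1 c) p" for p
    using arg_cong2[OF c1[rule_format, of p] c[rule_format, of p], of "(*)"]
      bipoly_mult[of 1 1 c1 p N N c] by (simp only: power_Suc plus_1_eq_Suc)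
  then show ?case by blast
qed

lemma form_nonzero_imp:
  assumes "form \<alpha> \<beta> (z1, z2, t) \<noteq> 0" shows "(z1, z2) \<noteq> (0, 0)" "t \<noteq> 0"
  using assms by (auto simp: form_eq)

lemma off_form: "off (form \<alpha> \<beta>) = {p. form \<alpha> \<beta> p \<noteq> 0}"
  unfolding off_def using form_nonzero_imp by (auto split: prod.splits) blast+

definition zscale :: "complex \<Rightarrow> complex \<Rightarrow> 'n::finite point \<Rightarrow> 'n point"
  where "zscale \<kappa> \<mu> = (\<lambda>(z1, z2, t). (\<kappa> * z1, \<kappa> * z2, \<mu> *s t))"

lemma bipoly_zscale: "bipoly d e c (zscale \<kappa> \<mu> p) = \<kappa> ^ d * \<mu> ^ e * bipoly d e c p"
proof -
  have "bmon d u (zscale \<kappa> \<mu> p) = \<kappa> ^ d * \<mu> ^ e * bmon d u p" if "u \<in> bidx d e" for u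
  proof -
    have "d = fst u + (d - fst u)" and e: "e = (\<Sum>i\<in>UNIV. snd u i)"
      using that by (auto simp: bidx_def)
    then have "\<kappa> ^ d = \<kappa> ^ fst u * \<kappa> ^ (d - fst u)" by (metis power_add)
    moreover have "\<mu> ^ e = (\<Prod>i\<in>UNIV. \<mu> ^ snd u i)" unfolding e by (rule power_sum)
    ultimately show ?thesis
      by (cases p) (simp add: bmon_def zscale_def power_mult_distrib prod.distrib mult_ac)
  qed
  then show ?thesis by (simp add: bipoly_eq sum_distrib_left mult_ac)
qed

lemma form_zscale: "form \<alpha> \<beta> (zscale \<kappa> \<mu> p) = \<kappa> * \<mu> * form \<alpha> \<beta> p"
proof -
  from form_eq_bipoly obtain c where c: "\<forall>p. form \<alpha> \<beta> p = bipoly 1 1 c p" ..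
  show ?thesis unfolding c[rule_format] bipoly_zscale by simp
qed

text \<open>
  Restriction to a line turns bihomogeneous polynomials into polynomials of one variable, of degree
  bounded by the bidegree. Identities and non-vanishing are then transported along lines, which
  replaces the theory of polynomials in several variables.
\<close>

lemma bipoly_curve:
  fixes T :: "'n::finite \<Rightarrow> complex poly"
  shows "\<exists>R. (\<forall>s. bipoly d e c (poly Z1 s, poly Z2 s, \<chi> i. poly (T i) s) = poly R s) \<and>
    (degree Z1 \<le> 1 \<and> degree Z2 \<le> 1 \<and> (\<forall>i. degree (T i) \<le> 1) \<longrightarrow> degree R \<le> d + e)"
proof -
  define m where "m u = Z1 ^ fst u * Z2 ^ (d - fst u) * (\<Prod>i\<in>UNIV. T i ^ snd u i)"
    for u :: "nat \<times> ('n \<Rightarrow> nat)"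
  define R where "R = (\<Sum>u\<in>bidx d e. smult (c (fst u) (snd u)) (m u))"
  have R: "bipoly d e c (poly Z1 s, poly Z2 s, \<chi> i. poly (T i) s) = poly R s" for s
    by (simp add: bipoly_eq bmon_def R_def m_def poly_sum poly_prod)
  have "degree R \<le> d + e" if deg: "degree Z1 \<le> 1" "degree Z2 \<le> 1" "\<And>i. degree (T i) \<le> 1"
  proof -
    have pow: "degree (p ^ k) \<le> k" if "degree p \<le> 1" for p :: "complex poly" and k
      using degree_power_le[of p k] mult_le_mono1[OF that, of k] by linarith
    have "degree (m u) \<le> d + e" if "u \<in> bidx d e" for u
    proof -
      have "degree (\<Prod>i\<in>UNIV. T i ^ snd u i) \<le> (\<Sum>i\<in>UNIV. degree (T i ^ snd u i))"
        using degree_prod_sum_le[of UNIV "\<lambda>i. T i ^ snd u i"] by (simp add: o_def)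
      also have "\<dots> \<le> (\<Sum>i\<in>UNIV. snd u i)" by (intro sum_mono pow deg)
      finally have "degree (\<Prod>i\<in>UNIV. T i ^ snd u i) \<le> e" using that by (auto simp: bidx_def)
      moreover have "degree (Z1 ^ fst u * Z2 ^ (d - fst u)) \<le> fst u + (d - fst u)"
        by (intro degree_mult_le[THEN order_trans] add_mono pow deg)
      moreover have "fst u \<le> d" using that by (auto simp: bidx_def)
      ultimately show ?thesis
        unfolding m_def by (intro degree_mult_le[THEN order_trans]) auto
    qed
    then show ?thesis
      unfolding R_def by (intro degree_sum_le finite_bidx degree_smult_le[THEN order_trans]) auto
  qed
  with R show ?thesis by blast
qed

definition pline :: "'n::finite point \<Rightarrow> 'n point \<Rightarrow> complex \<Rightarrow> 'n point"
  where "pline p q s = (fst p + s * fst q, fst (snd p) + s * fst (snd q), snd (snd p) + s *s snd (snd q))"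

lemma pline_to: "pline p (q - p) 0 = p" "pline p (q - p) 1 = q"
  by (simp_all add: pline_def)

lemma bipoly_line:
  "\<exists>R. (\<forall>s. bipoly d e c (pline p q s) = poly R s) \<and> degree R \<le> d + e"
proof -
  let ?Z1 = "[:fst p, fst q:]" and ?Z2 = "[:fst (snd p), fst (snd q):]"
    and ?T = "\<lambda>i. [:snd (snd p) $ i, snd (snd q) $ i:]"
  from bipoly_curve[of d e c ?Z1 ?Z2 ?T] obtain R
    where R: "\<forall>s. bipoly d e c (poly ?Z1 s, poly ?Z2 s, \<chi> i. poly (?T i) s) = poly R s"
      and "degree ?Z1 \<le> 1 \<and> degree ?Z2 \<le> 1 \<and> (\<forall>i. degree (?T i) \<le> 1) \<longrightarrow> degree R \<le> d + e"
    by (elim exE conjE)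
  then have "degree R \<le> d + e" by simp
  moreover have "(poly ?Z1 s, poly ?Z2 s, \<chi> i. poly (?T i) s) = pline p q s" for s
    by (simp add: pline_def vec_eq_iff)
  ultimately show ?thesis using R by (intro exI[of _ R]) simp
qed

lemma form_line: "\<exists>R. (\<forall>s. form \<alpha> \<beta> (pline p q s) = poly R s) \<and> degree R \<le> 2"
proof -
  from form_eq_bipoly obtain c where c: "\<forall>p. form \<alpha> \<beta> p = bipoly 1 1 c p" ..
  show ?thesis using bipoly_line[of 1 1 c p q] by (simp only: c one_add_one)
qed

lemma poly_eq_on_infinite:
  fixes P Q :: "complex poly"
  assumes "infinite {s. poly P s = poly Q s}" shows "P = Q"
proof -
  have "P - Q = 0" using poly_roots_finite[of "P - Q"] assms by auto
  then show ?thesis by simp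
qed

lemma infinite_minus_roots:
  fixes P :: "complex poly"
  assumes "infinite S" "poly P a \<noteq> 0" shows "infinite {s\<in>S. poly P s \<noteq> 0}"
proof -
  have "P \<noteq> 0" using assms(2) by auto
  from Diff_infinite_finite[OF poly_roots_finite[OF this] assms(1)]
  have "infinite (S - {s. poly P s = 0})" .
  then show ?thesis by (simp add: set_diff_eq)
qed

section \<open>Regular functions on the complement of the hypersurface\<close>

text \<open>
  In one variable: a fraction \<open>C / C'\<close> that is regular where \<open>F\<close> does not vanish has a denominator
  dividing a power of \<open>F\<close>. Each root of \<open>C'\<close> is either a root of \<open>F\<close>, and is paid for by one factor
  \<open>F\<close>, or cancels against a root of \<open>C\<close>.
\<close>

lemma regular_fraction_univariate:
  fixes F C C' :: "complex poly"
  assumes "C' \<noteq> 0" "degree C' \<le> D"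
    and "\<And>s. poly F s \<noteq> 0 \<Longrightarrow> \<exists>E E'. poly E' s \<noteq> 0 \<and> C * E' = E * C'"
  shows "\<exists>Q. F ^ D * C = Q * C'"
  using assms
proof (induction D arbitrary: C C')
  case 0
  then obtain k where "C' = [:k:]" "k \<noteq> 0" by (metis degree_0_id degree_eq_zeroE le_zero_eq pCons_0_0)
  then show ?case by (intro exI[of _ "smult (1 / k) C"]) simp
next
  case (Suc D)
  show ?case
  proof (cases "degree C' = 0")
    case True
    then obtain k where "C' = [:k:]" "k \<noteq> 0" using Suc.prems(1) by (metis degree_eq_zeroE pCons_0_0)
    then show ?thesis by (intro exI[of _ "smult (1 / k) (F ^ Suc D * C)"]) simp
  next
    case False
    then obtain a where "poly C' a = 0"
      using fundamental_theorem_of_algebra[of C'] by (metis constant_degree)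
    then obtain C1 where C1: "C' = [:-a, 1:] * C1" by (metis dvdE poly_eq_0_iff_dvd)
    have "C1 \<noteq> 0" using C1 Suc.prems(1) by auto
    then have "degree C' = Suc (degree C1)"
      unfolding C1 by (subst degree_mult_eq) auto
    then have deg: "degree C1 \<le> D" using Suc.prems(2) by simp
    show ?thesis
    proof (cases "poly F a = 0")
      case True
      then obtain F1 where F1: "F = [:-a, 1:] * F1" by (metis dvdE poly_eq_0_iff_dvd)
      have "\<exists>E E'. poly E' s \<noteq> 0 \<and> C * E' = E * C1" if s: "poly F s \<noteq> 0" for s
      proof -
        obtain E E' where E': "poly E' s \<noteq> 0" and "C * E' = E * C'" using Suc.prems(3)[OF s] by blast
        then have "C * E' = (E * [:-a, 1:]) * C1" by (simp only: C1 mult.assoc)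
        then show ?thesis using E' by blast
      qed
      from Suc.IH[OF \<open>C1 \<noteq> 0\<close> deg this] obtain Q where "F ^ D * C = Q * C1" by blast
      then have "F ^ Suc D * C = F * (Q * C1)" by (simp add: mult.assoc)
      also have "\<dots> = F1 * Q * C'" using F1 C1 by (metis mult.assoc mult.commute)
      finally show ?thesis by blast
    next
      case False
      then obtain E E' where E: "poly E' a \<noteq> 0" "C * E' = E * C'" using Suc.prems(3) by blast
      then have "poly C a * poly E' a = 0" using \<open>poly C' a = 0\<close> by (metis mult_zero_right poly_mult)
      then have "poly C a = 0" using E by simp
      then obtain C2 where C2: "C = [:-a, 1:] * C2" by (metis dvdE poly_eq_0_iff_dvd)
      have "\<exists>E E'. poly E' s \<noteq> 0 \<and> C2 * E' = E * C1" if s: "poly F s \<noteq> 0" for s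
      proof -
        obtain E E' where "poly E' s \<noteq> 0" "C * E' = E * C'" using Suc.prems(3)[OF s] by blast
        then have "[:-a, 1:] * (C2 * E') = [:-a, 1:] * (E * C1)" using C1 C2 by (simp only: mult_ac)
        moreover have "[:-a, 1:] \<noteq> (0 :: complex poly)" by simp
        ultimately have "C2 * E' = E * C1" using mult_left_cancel by blast
        then show ?thesis using \<open>poly E' s \<noteq> 0\<close> by blast
      qed
      from Suc.IH[OF \<open>C1 \<noteq> 0\<close> deg this] obtain Q where Q: "F ^ D * C2 = Q * C1" by blast
      have "F ^ Suc D * C = F * [:-a, 1:] * (F ^ D * C2)" by (simp only: C2 power_Suc mult_ac)
      also have "\<dots> = F * Q * C'" unfolding Q C1 by (simp only: mult_ac)
      finally have "F ^ Suc D * C = F * Q * C'" .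
      then show ?thesis by blast
    qed
  qed
qed

definition lagrange :: "complex set \<Rightarrow> complex \<Rightarrow> complex poly"
  where "lagrange T a = (\<Prod>b\<in>T - {a}. smult (1 / (a - b)) [:-b, 1:])"

lemma lagrange_interpolation:
  assumes "finite T" "degree P < card T"
  shows "poly P s = (\<Sum>a\<in>T. poly P a * poly (lagrange T a) s)"
proof -
  have kron: "poly (lagrange T a) x = (if x = a then 1 else 0)" if "a \<in> T" "x \<in> T" for a x
  proof (cases "x = a")
    case True
    have "poly (smult (1 / (a - b)) [:-b, 1:]) a = 1" if "b \<noteq> a" for b
      using that by (simp add: diff_divide_distrib[symmetric])
    then show ?thesis unfolding True lagrange_def poly_prod by (auto intro!: prod.neutral simp del: poly_smult)
  next
    case False
    then show ?thesis using that assms(1) by (auto simp: lagrange_def poly_prod intro!: bexI[of _ x])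
  qed
  have "degree (lagrange T a) \<le> card T - 1" if "a \<in> T" for a
  proof -
    have "degree (lagrange T a) \<le> (\<Sum>b\<in>T - {a}. degree (smult (1 / (a - b)) [:-b, 1:]))"
      unfolding lagrange_def using assms(1)
      by (intro degree_prod_sum_le[THEN order_trans]) (simp_all only: o_def finite_Diff order.refl)
    also have "\<dots> \<le> (\<Sum>b\<in>T - {a}. 1)"
      by (intro sum_mono degree_smult_le[THEN order_trans]) simp
    finally show ?thesis using that assms(1) by simp
  qed
  then have "degree (\<Sum>a\<in>T. smult (poly P a) (lagrange T a)) \<le> card T - 1"
    by (intro degree_sum_le assms(1) degree_smult_le[THEN order_trans])
  then have "P = (\<Sum>a\<in>T. smult (poly P a) (lagrange T a))"
    using assms by (intro poly_eqI_degree[of T]) (auto simp: poly_sum kron if_distrib cong: if_cong)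
  then have "poly P s = poly (\<Sum>a\<in>T. smult (poly P a) (lagrange T a)) s" by simp
  then show ?thesis by (simp add: poly_sum)
qed

text \<open>
  A function on a box that is polynomial of bounded degree in each variable separately is a
  polynomial. Interpolation eliminates the variables one at a time. The class \<open>\<P>\<close> of polynomials
  enters only through its closure properties.
\<close>

lemma separately_polynomial_imp_polynomial:
  fixes F :: "('v::finite \<Rightarrow> complex) \<Rightarrow> complex" and \<P> :: "(('v \<Rightarrow> complex) \<Rightarrow> complex) set"
  assumes const: "\<And>k. (\<lambda>x. k) \<in> \<P>" and coord: "\<And>v. (\<lambda>x. x v) \<in> \<P>"
    and add: "\<And>G H. G \<in> \<P> \<Longrightarrow> H \<in> \<P> \<Longrightarrow> (\<lambda>x. G x + H x) \<in> \<P>"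
    and mult: "\<And>G H. G \<in> \<P> \<Longrightarrow> H \<in> \<P> \<Longrightarrow> (\<lambda>x. G x * H x) \<in> \<P>"
    and inf: "\<And>v. infinite (S v)"
    and sep: "\<And>x v. (\<And>u. x u \<in> S u) \<Longrightarrow>
      \<exists>P. degree P \<le> N \<and> (\<forall>s\<in>S v. F (x(v := s)) = poly P s)"
  shows "\<exists>Q\<in>\<P>. \<forall>x. (\<forall>v. x v \<in> S v) \<longrightarrow> F x = Q x"
proof -
  have "\<exists>Q\<in>\<P>. \<forall>x. (\<forall>v. x v \<in> S v) \<longrightarrow> F x = Q x"
    if "finite W"
      and "\<And>x v. (\<And>u. x u \<in> S u) \<Longrightarrow> \<exists>P. degree P \<le> N \<and> (\<forall>s\<in>S v. F (x(v := s)) = poly P s)"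
      and "\<And>x y. (\<And>u. x u \<in> S u) \<Longrightarrow> (\<And>u. y u \<in> S u) \<Longrightarrow> (\<And>u. u \<in> W \<Longrightarrow> x u = y u) \<Longrightarrow> F x = F y"
    for W F
    using that
  proof (induction W arbitrary: F rule: finite_induct)
    case empty
    have "\<exists>s. s \<in> S v" for v using inf[of v] by (metis finite.emptyI equals0I)
    then obtain x0 where "\<forall>v. x0 v \<in> S v" by metis
    then show ?case using empty.prems(2) by (intro bexI[OF _ const[of "F x0"]]) blast
  next
    case (insert w W)
    obtain T where T: "finite T" "card T = Suc N" "T \<subseteq> S w"
      using infinite_arbitrarily_large[OF inf] by blast
    have poly_w: "(\<lambda>x. poly P (x w)) \<in> \<P>" for P
    proof (induction P)
      case (pCons a P)
      show ?case using add[OF const[of a] mult[OF coord[of w] pCons.IH]] by simp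
    qed (use const[of 0] in simp)
    have sum_P: "(\<lambda>x. \<Sum>a\<in>A. G a x) \<in> \<P>" if "finite A" "\<And>a. a \<in> A \<Longrightarrow> G a \<in> \<P>"
      for A :: "complex set" and G
      using that by (induction A rule: finite_induct) (auto intro: const add)
    have "\<exists>Q\<in>\<P>. \<forall>x. (\<forall>v. x v \<in> S v) \<longrightarrow> F (x(w := a)) = Q x" if a: "a \<in> T" for a
    proof (rule insert.IH)
      fix x v assume x: "\<And>u. x u \<in> S u"
      have xa: "(x(w := a)) u \<in> S u" for u using x a T(3) by auto
      show "\<exists>P. degree P \<le> N \<and> (\<forall>s\<in>S v. F (x(v := s, w := a)) = poly P s)"
      proof (cases "v = w")
        case True
        then show ?thesis by (intro exI[of _ "[:F (x(w := a)):]"]) simp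
      next
        case False
        then show ?thesis using insert.prems(1)[of "x(w := a)" v] xa unfolding fun_upd_twist[OF False] by blast
      qed
    next
      fix x y assume "\<And>u. x u \<in> S u" "\<And>u. y u \<in> S u" "\<And>u. u \<in> W \<Longrightarrow> x u = y u"
      then show "F (x(w := a)) = F (y(w := a))" using a T(3) by (intro insert.prems(2)) auto
    qed
    then obtain Q where Q: "\<And>a. a \<in> T \<Longrightarrow> Q a \<in> \<P>"
      and FQ: "\<And>a x. a \<in> T \<Longrightarrow> (\<And>v. x v \<in> S v) \<Longrightarrow> F (x(w := a)) = Q a x" by metis
    show ?case
    proof (rule bexI[of _ "\<lambda>x. \<Sum>a\<in>T. Q a x * poly (lagrange T a) (x w)"], intro allI impI)
      fix x assume x: "\<forall>v. x v \<in> S v"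
      then obtain P where P: "degree P \<le> N" "\<forall>s\<in>S w. F (x(w := s)) = poly P s"
        using insert.prems(1) by blast
      have "F x = poly P (x w)" using P(2) x by (metis fun_upd_triv)
      also have "\<dots> = (\<Sum>a\<in>T. poly P a * poly (lagrange T a) (x w))"
        using T P by (intro lagrange_interpolation) auto
      also have "\<dots> = (\<Sum>a\<in>T. Q a x * poly (lagrange T a) (x w))"
        using P(2) T(3) FQ x by (intro sum.cong refl) (metis subsetD)
      finally show "F x = (\<Sum>a\<in>T. Q a x * poly (lagrange T a) (x w))" .
    qed (intro sum_P T(1) mult Q poly_w)
  qed
  from this[of UNIV F] show ?thesis using sep by (metis UNIV_I ext finite)
qed

text \<open>
  The coordinates \<open>t\<close>, \<open>z1\<close>, \<open>z2\<close> indexed by one finite type, so that interpolation can treat all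
  of them alike.
\<close>

definition mkpoint :: "('n::finite + bool \<Rightarrow> complex) \<Rightarrow> 'n point"
  where "mkpoint x = (x (Inr False), x (Inr True), \<chi> i. x (Inl i))"

definition pcoord :: "'n::finite point \<Rightarrow> 'n + bool \<Rightarrow> complex"
  where "pcoord p v = (case v of Inl i \<Rightarrow> snd (snd p) $ i | Inr b \<Rightarrow> if b then fst (snd p) else fst p)"

lemma mkpoint_pcoord: "mkpoint (pcoord p) = p"
  by (simp add: mkpoint_def pcoord_def)

lemma open_contains_box:
  assumes "open U" "p \<in> U"
  shows "\<exists>S. (\<forall>v. open (S v) \<and> pcoord p v \<in> S v) \<and> (\<forall>x. (\<forall>v. x v \<in> S v) \<longrightarrow> mkpoint x \<in> U)"
proof -
  obtain z1 z2 t where p: "p = (z1, z2, t)" by (cases p)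
  from assms[unfolded p] obtain A B where A: "open A" "open B" "z1 \<in> A" "(z2, t) \<in> B" "A \<times> B \<subseteq> U"
    by (rule open_prod_elim) blast
  from A(2,4) obtain C D where C: "open C" "open D" "z2 \<in> C" "t \<in> D" "C \<times> D \<subseteq> B"
    by (rule open_prod_elim) blast
  from C(2,4) obtain T where T: "\<forall>i. open (T i) \<and> t $ i \<in> T i" "\<forall>y. (\<forall>i. y $ i \<in> T i) \<longrightarrow> y \<in> D"
    unfolding open_vec_def by blast
  define S where "S v = (case v of Inl i \<Rightarrow> T i | Inr b \<Rightarrow> if b then C else A)" for v
  have "open (S v)" "pcoord p v \<in> S v" for v
    using A C T by (auto simp: S_def pcoord_def p split: sum.split)
  moreover have "mkpoint x \<in> U" if x: "\<And>v. x v \<in> S v" for x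
  proof -
    have "x (Inr False) \<in> A" "x (Inr True) \<in> C" "\<And>i. x (Inl i) \<in> T i"
      using x[of "Inr False"] x[of "Inr True"] x[of "Inl _"] by (simp_all add: S_def)
    moreover from this have "(\<chi> i. x (Inl i)) \<in> D" using T(2) by simp
    ultimately have "(x (Inr False), x (Inr True), \<chi> i. x (Inl i)) \<in> A \<times> C \<times> D" by blast
    then show ?thesis using A(5) C(5) by (auto simp: mkpoint_def)
  qed
  ultimately show ?thesis by blast
qed

lemma infinite_open_preimages:
  fixes \<phi> :: "'v::finite \<Rightarrow> complex \<Rightarrow> complex"
  assumes "\<And>v. open (S v)" "\<And>v. continuous_on UNIV (\<phi> v)" "\<And>v. \<phi> v a \<in> S v"
  shows "infinite {s. \<forall>v. \<phi> v s \<in> S v}"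
proof -
  have "{s. \<forall>v. \<phi> v s \<in> S v} = (\<Inter>v. \<phi> v -` S v)" by auto
  moreover have "open (\<Inter>v. \<phi> v -` S v)"
    using assms by (intro open_INT ballI open_vimage) auto
  ultimately show ?thesis using finite_imp_not_open[of "{s. \<forall>v. \<phi> v s \<in> S v}"] assms(3) by auto
qed

lemma continuous_bipoly: "continuous_on UNIV (bipoly d e c)"
  unfolding bipoly_eq[abs_def] bmon_def case_prod_unfold by (intro continuous_intros)

lemma mkpoint_update_line: "mkpoint (x(v := s)) =
    pline (mkpoint (x(v := 0))) (mkpoint ((\<lambda>_. 0)(v := 1))) s"
  by (cases v) (auto simp: mkpoint_def pline_def vec_eq_iff)

text \<open>
  Finite sums of bihomogeneous polynomials, of any bidegrees: these are all polynomials in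
  \<open>z1, z2, t\<close>.
\<close>

definition mixed :: "('n::finite point \<Rightarrow> complex) \<Rightarrow> bool"
  where "mixed F \<longleftrightarrow> (\<exists>L. \<forall>p. F p = (\<Sum>(d, e, c)\<leftarrow>L. bipoly d e c p))"

lemma mixed_bipoly: "mixed (bipoly d e c)"
  unfolding mixed_def by (intro exI[of _ "[(d, e, c)]"]) simp

lemma mixed_const: "mixed (\<lambda>p. k)"
  using mixed_bipoly[of 0 0 "\<lambda>_ _. k"] by (simp add: bipoly_const[abs_def])

lemma mixed_add: assumes "mixed F" "mixed G" shows "mixed (\<lambda>p. F p + G p)"
proof -
  obtain L where L: "\<forall>p. F p = (\<Sum>(d, e, c)\<leftarrow>L. bipoly d e c p)"
    using assms(1) unfolding mixed_def by blast
  obtain L' where L': "\<forall>p. G p = (\<Sum>(d, e, c)\<leftarrow>L'. bipoly d e c p)"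
    using assms(2) unfolding mixed_def by blast
  show ?thesis unfolding mixed_def by (intro exI[of _ "L @ L'"]) (simp add: L L')
qed

lemma mixed_mult: assumes "mixed F" "mixed G" shows "mixed (\<lambda>p. F p * G p)"
proof -
  obtain L where L: "\<forall>p. F p = (\<Sum>(d, e, c)\<leftarrow>L. bipoly d e c p)"
    using assms(1) unfolding mixed_def by blast
  have "mixed (\<lambda>p. (\<Sum>(d, e, c)\<leftarrow>L. bipoly d e c p) * G p)"
  proof (induction L)
    case (Cons a L)
    obtain d e c where a: "a = (d, e, c)" by (cases a)
    obtain L' where L': "\<forall>p. G p = (\<Sum>(d, e, c)\<leftarrow>L'. bipoly d e c p)"
      using assms(2) unfolding mixed_def by blast
    have "bipoly d e c p * G p =
        (\<Sum>(d', e', c')\<leftarrow>map (\<lambda>(d', e', c'). (d + d', e + e', bconv d e d' e' c c')) L'. bipoly d' e' c' p)"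
      for p
      by (simp add: L' sum_list_const_mult[symmetric] o_def case_prod_unfold bipoly_mult)
    then have "mixed (\<lambda>p. bipoly d e c p * G p)" unfolding mixed_def by blast
    from mixed_add[OF this Cons.IH] show ?case by (simp add: a distrib_right)
  qed (simp add: mixed_const)
  then show ?thesis by (simp add: L)
qed

lemma mixed_coord: "mixed (\<lambda>p. pcoord p v)"
proof (cases v)
  case (Inl i)
  obtain c where c: "\<forall>z1 z2 t. (\<Sum>k\<in>UNIV. axis i 1 $ k * t $ k) = bipoly 0 1 c (z1, z2, t)"
    using linear_eq_bipoly[of "axis i 1"] by blast
  have "(\<Sum>k\<in>UNIV. axis i 1 $ k * t $ k) = t $ i" for t :: "complex ^ 'a"
    by (simp add: axis_def if_distrib[of "\<lambda>m. m * _"] cong: if_cong)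
  then have "(\<lambda>p. pcoord p v) = bipoly 0 1 c" using c by (auto simp: pcoord_def Inl)
  then show ?thesis by (simp add: mixed_bipoly)
next
  case (Inr b)
  obtain c where "\<forall>z1 z2 t. z1 = bipoly 1 0 c (z1, z2, t :: complex ^ 'a)" using z_eq_bipoly by blast
  moreover obtain c' where "\<forall>z1 z2 t. z2 = bipoly 1 0 c' (z1, z2, t :: complex ^ 'a)"
    using z_eq_bipoly' by blast
  ultimately have "(\<lambda>p. pcoord p v) = bipoly 1 0 (if b then c' else c)"
    by (auto simp: pcoord_def Inr fun_eq_iff)
  then show ?thesis by (simp add: mixed_bipoly)
qed

text \<open>
  A polynomial that behaves like a bihomogeneous one at infinitely many rescalings of \<open>p\<close> agrees
  there with its bihomogeneous component. The weights \<open>(1, K)\<close> with \<open>K\<close> large separate bidegrees,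
  so that one rescaling parameter suffices.
\<close>

lemma mixed_bihomogeneous_component:
  assumes "mixed Q"
  shows "\<exists>g K. \<forall>p. infinite {s. Q (zscale s (s ^ K) p) = s ^ (D + K * D) * Q p} \<longrightarrow>
    Q p = bipoly D D g p"
proof -
  obtain L where L: "\<forall>p. Q p = (\<Sum>(d, e, c)\<leftarrow>L. bipoly d e c p)"
    using assms unfolding mixed_def by blast
  \<comment> \<open>\<open>K\<close> exceeds all \<open>z\<close>-degrees, so \<open>d + K * e\<close> determines \<open>d\<close> and \<open>e\<close>.\<close>
  define K where "K = Suc (Max (insert D (fst ` set L)))"
  have K: "D < K" "\<And>u. u \<in> set L \<Longrightarrow> fst u < K"
    by (auto simp: K_def less_Suc_eq_le intro: Max_ge)
  define g where "g j \<gamma> = (\<Sum>(d, e, c)\<leftarrow>filter (\<lambda>(d, e, c). d = D \<and> e = D) L. c j \<gamma>)" for j \<gamma>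
  have g: "bipoly D D (\<lambda>j \<gamma>. \<Sum>(d, e, c)\<leftarrow>M. c j \<gamma>) p = (\<Sum>(d, e, c)\<leftarrow>M. bipoly D D c p)"
    for M :: "(nat \<times> nat \<times> _) list" and p
    by (induction M) (auto simp: bipoly_zero bipoly_add[symmetric])
  have "Q p = bipoly D D g p"
    if inf: "infinite {s. Q (zscale s (s ^ K) p) = s ^ (D + K * D) * Q p}" for p
  proof -
    define R where "R = (\<Sum>(d, e, c)\<leftarrow>L. monom (bipoly d e c p) (d + K * e))"
    have "Q (zscale s (s ^ K) p) = poly R s" for s
      unfolding L[rule_format] R_def
      by (induction L) (auto simp: bipoly_zscale poly_monom power_add power_mult)
    then have "R = monom (Q p) (D + K * D)"
      using inf by (intro poly_eq_on_infinite) (simp add: poly_monom mult.commute)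
    then have "Q p = coeff R (D + K * D)" by simp
    also have "\<dots> = (\<Sum>(d, e, c)\<leftarrow>L. if d + K * e = D + K * D then bipoly d e c p else 0)"
      unfolding R_def by (induction L) auto
    also have "\<dots> = (\<Sum>(d, e, c)\<leftarrow>filter (\<lambda>(d, e, c). d = D \<and> e = D) L. bipoly D D c p)"
    proof -
      have "(d + K * e = D + K * D) = (d = D \<and> e = D)" if "d < K" for d e
      proof
        assume *: "d + K * e = D + K * D"
        have "(d + K * e) div K = e" "(D + K * D) div K = D" using that K(1) by simp_all
        then have "e = D" using * by metis
        then show "d = D \<and> e = D" using * by simp
      qed simp
      then show ?thesis using K(2)
      proof (induction L)
        case (Cons u L)
        obtain d e c where u: "u = (d, e, c)" by (cases u)
        have "d < K" using Cons.prems(2)[of u] by (simp add: u)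
        then have "(d + K * e = D + K * D) = (d = D \<and> e = D)" by (rule Cons.prems(1))
        moreover have "(\<Sum>(d, e, c)\<leftarrow>L. if d + K * e = D + K * D then bipoly d e c p else 0) =
            (\<Sum>(d, e, c)\<leftarrow>filter (\<lambda>(d, e, c). d = D \<and> e = D) L. bipoly D D c p)"
          using Cons.prems by (intro Cons.IH) auto
        ultimately show ?case by (simp add: u)
      qed simp
    qed
    also have "\<dots> = bipoly D D g p" unfolding g_def[abs_def] by (rule g[symmetric])
    finally show ?thesis .
  qed
  then show ?thesis by (intro exI allI impI)
qed

text \<open>
  The functions regular off the hypersurface \<open>f = 0\<close> are the quotients \<open>g / f ^ N\<close>. With a local
  representation \<open>c / c'\<close>, the product of \<open>c / c'\<close> and a high power of \<open>f\<close> is polynomial of bounded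
  degree on each line not contained in \<open>c' = 0\<close> or \<open>f = 0\<close>, by the one-variable case, hence polynomial on a small box by interpolation,
  and its component \<open>g\<close> of the right bidegree represents \<open>l\<close> on the box. The identity spreads along
  lines from the box to all points.
\<close>

lemma regular_off_form:
  assumes reg: "regular_off (form \<alpha> \<beta>) l" and p0: "form \<alpha> \<beta> p0 \<noteq> 0"
  obtains N g where "\<And>p. form \<alpha> \<beta> p \<noteq> 0 \<Longrightarrow> l p = bipoly N N g p / form \<alpha> \<beta> p ^ N"
proof -
  define f where "f = form \<alpha> \<beta>"
  note f_line = form_line[of \<alpha> \<beta>, folded f_def]
  have rep: "\<exists>d e c c'. bipoly d e c' p \<noteq> 0 \<and>
      (\<forall>q. f q \<noteq> 0 \<longrightarrow> bipoly d e c' q \<noteq> 0 \<longrightarrow> l q = bipoly d e c q / bipoly d e c' q)"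
    if "f p \<noteq> 0" for p
    using reg that unfolding regular_off_def off_form f_def by blast
  obtain d e c c' where c': "bipoly d e c' p0 \<noteq> 0"
    and l: "\<And>q. f q \<noteq> 0 \<Longrightarrow> bipoly d e c' q \<noteq> 0 \<Longrightarrow> l q = bipoly d e c q / bipoly d e c' q"
    using rep[of p0] p0 unfolding f_def by blast
  define D where "D = d + e"
  define G where "G p = f p ^ D * (bipoly d e c p / bipoly d e c' p)" for p
  have "open {p. f p * bipoly d e c' p \<noteq> 0}"
  proof -
    obtain cf where "\<forall>p. f p = bipoly 1 1 cf p" using form_eq_bipoly[of \<alpha> \<beta>] unfolding f_def ..
    then have "f = bipoly 1 1 cf" by blast
    then have "continuous_on UNIV (\<lambda>p. f p * bipoly d e c' p)"
      by (intro continuous_intros) (auto simp: continuous_bipoly)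
    then have "open ((\<lambda>p. f p * bipoly d e c' p) -` (- {0}))"
      by (intro open_vimage) auto
    then show ?thesis by (simp add: vimage_def)
  qed
  from open_contains_box[OF this, of p0] c' p0 obtain S
    where S: "\<And>v. open (S v)" "\<And>v. pcoord p0 v \<in> S v"
      and box: "\<And>x. (\<And>v. x v \<in> S v) \<Longrightarrow> f (mkpoint x) \<noteq> 0 \<and> bipoly d e c' (mkpoint x) \<noteq> 0"
    unfolding f_def by auto
  \<comment> \<open>On a line \<open>c\<close> and \<open>c'\<close> have degree at most \<open>D\<close> and \<open>f\<close> has degree at most 2, whence the bound
      \<open>2 * D + D\<close> for the polynomial that \<open>G\<close> restricts to.\<close>
  have Q_line: "\<exists>P. degree P \<le> 3 * D \<and> (\<forall>s\<in>S v. G (mkpoint (x(v := s))) = poly P s)"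
    if x: "\<And>u. x u \<in> S u" for x v
  proof -
    define L where "L s = mkpoint (x(v := s))" for s
    define y where "y = mkpoint (x(v := 0))"
    define y' where "y' = mkpoint ((\<lambda>_. 0)(v := 1))"
    have L: "L s = pline y y' s" for s
      unfolding L_def y_def y'_def by (rule mkpoint_update_line)
    obtain F where F: "\<forall>s. f (pline y y' s) = poly F s" "degree F \<le> 2" using f_line by blast
    obtain C where C: "\<forall>s. bipoly d e c (pline y y' s) = poly C s" "degree C \<le> D"
      using bipoly_line[of d e c y y'] unfolding D_def by blast
    obtain C' where C': "\<forall>s. bipoly d e c' (pline y y' s) = poly C' s" "degree C' \<le> D"
      using bipoly_line[of d e c' y y'] unfolding D_def by blast
    have nz: "poly F s \<noteq> 0 \<and> poly C' s \<noteq> 0" if "s \<in> S v" for s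
      using box[of "x(v := s)"] x that F(1) C'(1) unfolding L_def[symmetric] L by auto
    have "C' \<noteq> 0" using nz[OF x] by auto
    moreover have "\<exists>E E'. poly E' s \<noteq> 0 \<and> C * E' = E * C'" if s: "poly F s \<noteq> 0" for s
    proof -
      have "f (pline y y' s) \<noteq> 0" using s F(1) by simp
      from rep[OF this] obtain d1 e1 c1 c1' where c1': "bipoly d1 e1 c1' (pline y y' s) \<noteq> 0"
        and l1: "\<And>q. f q \<noteq> 0 \<Longrightarrow> bipoly d1 e1 c1' q \<noteq> 0 \<Longrightarrow> l q = bipoly d1 e1 c1 q / bipoly d1 e1 c1' q"
        by blast
      obtain E where E: "\<forall>s. bipoly d1 e1 c1 (pline y y' s) = poly E s"
        using bipoly_line[of d1 e1 c1 y y'] by blast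
      obtain E' where E': "\<forall>s. bipoly d1 e1 c1' (pline y y' s) = poly E' s"
        using bipoly_line[of d1 e1 c1' y y'] by blast
      have E's: "poly E' s \<noteq> 0" using c1' E' by simp
      have "F \<noteq> 0" "E' \<noteq> 0" using s E's by auto
      then have "F * C' * E' \<noteq> 0" using \<open>C' \<noteq> 0\<close> by simp
      from Diff_infinite_finite[OF poly_roots_finite[OF this] infinite_UNIV_char_0]
      have "infinite (UNIV - {s. poly (F * C' * E') s = 0})" .
      then have "infinite {s. poly (C * E') s = poly (E * C') s}"
      proof (rule infinite_super[rotated])
        show "UNIV - {s. poly (F * C' * E') s = 0} \<subseteq> {s. poly (C * E') s = poly (E * C') s}"
        proof
          fix s assume "s \<in> UNIV - {s. poly (F * C' * E') s = 0}"
          then have "poly F s \<noteq> 0" "poly C' s \<noteq> 0" "poly E' s \<noteq> 0" by auto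
          then have "poly C s / poly C' s = poly E s / poly E' s"
            using l[of "pline y y' s"] l1[of "pline y y' s"] F(1) C(1) C'(1) E E' by simp
          then show "s \<in> {s. poly (C * E') s = poly (E * C') s}"
            using \<open>poly C' s \<noteq> 0\<close> \<open>poly E' s \<noteq> 0\<close> by (simp add: frac_eq_eq)
        qed
      qed
      then have "C * E' = E * C'" by (rule poly_eq_on_infinite)
      then show ?thesis using E's by blast
    qed
    ultimately obtain Q where Q: "F ^ D * C = Q * C'"
      using regular_fraction_univariate[OF _ C'(2)] by blast
    have "degree Q \<le> 3 * D"
    proof (cases "Q = 0")
      case False
      then have "degree Q \<le> degree (Q * C')" using \<open>C' \<noteq> 0\<close> by (simp add: degree_mult_eq)
      also have "\<dots> \<le> degree (F ^ D) + degree C" unfolding Q[symmetric] by (rule degree_mult_le)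
      also have "\<dots> \<le> degree F * D + D" using degree_power_le C(2) by (intro add_mono)
      also have "\<dots> \<le> 2 * D + D" using F(2) by simp
      finally show ?thesis by simp
    qed simp
    moreover have "G (L s) = poly Q s" if "s \<in> S v" for s
    proof -
      have "poly (F ^ D * C) s = poly (Q * C') s" by (simp only: Q)
      then show ?thesis
        using nz[OF that] F(1) C(1) C'(1) by (simp add: G_def L field_simps)
    qed
    ultimately show ?thesis unfolding L_def by blast
  qed
  have inf_S: "infinite (S v)" for v
    using finite_imp_not_open[of "S v"] S by auto
  have "\<exists>Q\<in>{F. \<exists>Q. mixed Q \<and> F = (\<lambda>x. Q (mkpoint x))}. \<forall>x. (\<forall>v. x v \<in> S v) \<longrightarrow> G (mkpoint x) = Q x"
  proof (rule separately_polynomial_imp_polynomial[OF _ _ _ _ inf_S Q_line])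
    show "(\<lambda>x. x v) \<in> {F. \<exists>Q. mixed Q \<and> F = (\<lambda>x. Q (mkpoint x))}" for v :: "'a + bool"
      using mixed_coord[of v] by (auto intro!: exI[of _ "\<lambda>p. pcoord p v"]
          simp: mkpoint_def pcoord_def fun_eq_iff split: sum.split)
  qed (auto intro: mixed_const mixed_add mixed_mult)
  then obtain Q where Q: "mixed Q" "\<And>x. (\<And>v. x v \<in> S v) \<Longrightarrow> G (mkpoint x) = Q (mkpoint x)" by blast
  have GQ: "G p = Q p" "f p \<noteq> 0" "bipoly d e c' p \<noteq> 0" if "\<And>v. pcoord p v \<in> S v" for p
    using Q(2)[of "pcoord p"] box[of "pcoord p"] that by (simp_all add: mkpoint_pcoord)
  from mixed_bihomogeneous_component[OF Q(1), of D] obtain g K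
    where g: "\<forall>p. infinite {s. Q (zscale s (s ^ K) p) = s ^ (D + K * D) * Q p} \<longrightarrow>
      Q p = bipoly D D g p"
    by (elim exE)
  \<comment> \<open>\<open>G\<close> is bihomogeneous of bidegree \<open>(D, D)\<close>, and rescalings by \<open>s\<close> near 1 stay in the box.\<close>
  have Qg: "Q p = bipoly D D g p" if p: "\<And>v. pcoord p v \<in> S v" for p
  proof (rule g[rule_format])
    have "infinite {s. \<forall>v. pcoord (zscale s (s ^ K) p) v \<in> S v}"
    proof (rule infinite_open_preimages[OF S(1)])
      show "continuous_on UNIV (\<lambda>s. pcoord (zscale s (s ^ K) p) v)" for v
      proof (cases v)
        case (Inr b)
        then show ?thesis
          by (cases b; cases p) (auto simp: pcoord_def zscale_def intro!: continuous_intros)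
      qed (cases p; auto simp: pcoord_def zscale_def intro!: continuous_intros)
      show "pcoord (zscale 1 (1 ^ K) p) v \<in> S v" for v
        using p[of v] by (cases p) (simp add: zscale_def)
    qed
    then show "infinite {s. Q (zscale s (s ^ K) p) = s ^ (D + K * D) * Q p}"
    proof (rule infinite_super[rotated], safe)
      fix s assume s: "\<forall>v. pcoord (zscale s (s ^ K) p) v \<in> S v"
      have "f (zscale s (s ^ K) p) \<noteq> 0" using GQ(2) s by blast
      then have "s \<noteq> 0" by (auto simp: f_def form_zscale)
      then have "G (zscale s (s ^ K) p) = s ^ (D + K * D) * G p"
        by (simp add: G_def f_def form_zscale bipoly_zscale power_mult_distrib power_add power_mult)
      then show "Q (zscale s (s ^ K) p) = s ^ (D + K * D) * Q p"
        using GQ(1) s p by metis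
    qed
  qed
  have "l q = bipoly D D g q / f q ^ D" if q: "f q \<noteq> 0" for q
  proof -
    obtain d1 e1 c1 c1' where c1': "bipoly d1 e1 c1' q \<noteq> 0"
      and l1: "\<And>q. f q \<noteq> 0 \<Longrightarrow> bipoly d1 e1 c1' q \<noteq> 0 \<Longrightarrow> l q = bipoly d1 e1 c1 q / bipoly d1 e1 c1' q"
      using rep[OF q] by blast
    define L where "L = pline q (p0 - q)"
    have L0: "L 0 = q" and L1: "L 1 = p0" unfolding L_def by (rule pline_to)+
    obtain E where E: "\<forall>s. bipoly d1 e1 c1 (L s) = poly E s"
      using bipoly_line unfolding L_def by blast
    obtain E' where E': "\<forall>s. bipoly d1 e1 c1' (L s) = poly E' s"
      using bipoly_line unfolding L_def by blast
    obtain F where F: "\<forall>s. f (L s) = poly F s" using f_line unfolding L_def by blast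
    obtain H where H: "\<forall>s. bipoly D D g (L s) = poly H s"
      using bipoly_line unfolding L_def by blast
    have "infinite {s. \<forall>v. pcoord (L s) v \<in> S v}"
    proof (rule infinite_open_preimages[OF S(1)])
      show "continuous_on UNIV (\<lambda>s. pcoord (L s) v)" for v
      proof (cases v)
        case (Inr b)
        then show ?thesis
          by (cases b) (auto simp: pcoord_def pline_def L_def intro!: continuous_intros)
      qed (auto simp: pcoord_def pline_def L_def intro!: continuous_intros)
      show "pcoord (L 1) v \<in> S v" for v using S(2) by (simp add: L1)
    qed
    from infinite_minus_roots[OF this, of E' 0]
    have "infinite {s. poly (F ^ D * E) s = poly (H * E') s}"
    proof (rule infinite_super[rotated])
      show "poly E' 0 \<noteq> 0" using c1' E' L0 by metis
      show "{s \<in> {s. \<forall>v. pcoord (L s) v \<in> S v}. poly E' s \<noteq> 0} \<subseteq>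
          {s. poly (F ^ D * E) s = poly (H * E') s}"
      proof safe
        fix s assume s: "\<forall>v. pcoord (L s) v \<in> S v" and nz: "poly E' s \<noteq> 0"
        have "f (L s) \<noteq> 0" using GQ(2) s by blast
        then have "l (L s) = bipoly d1 e1 c1 (L s) / bipoly d1 e1 c1' (L s)"
          using l1 nz E' by simp
        moreover have "G (L s) = f (L s) ^ D * l (L s)"
          using l[of "L s"] GQ(2,3)[of "L s"] s by (simp add: G_def)
        moreover have "G (L s) = bipoly D D g (L s)" using GQ(1) Qg s by metis
        ultimately have "poly F s ^ D * (poly E s / poly E' s) = poly H s"
          using E E' F H by simp
        then show "poly (F ^ D * E) s = poly (H * E') s" using nz by (simp add: field_simps)
      qed
    qed
    then have "F ^ D * E = H * E'" by (rule poly_eq_on_infinite)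
    then have "poly (F ^ D * E) 0 = poly (H * E') 0" by simp
    then have "f q ^ D * bipoly d1 e1 c1 q = bipoly D D g q * bipoly d1 e1 c1' q"
      using E E' F H L0 by (metis poly_mult poly_power)
    then show ?thesis unfolding l1[OF q c1'] using c1' q by (simp add: frac_eq_eq mult.commute)
  qed
  then show ?thesis using that unfolding f_def by blast
qed

section \<open>The ring of functions with poles on the hypersurface\<close>

lemma regular_off_const: "regular_off f (\<lambda>p\<in>off f. k)"
  unfolding regular_off_def
proof
  fix p
  show "\<exists>d e c c'. bipoly d e c' p \<noteq> 0 \<and> (\<forall>q\<in>off f. bipoly d e c' q \<noteq> 0 \<longrightarrow>
      (\<lambda>p\<in>off f. k) q = bipoly d e c q / bipoly d e c' q)"
    by (rule exI[of _ 0], rule exI[of _ 0], rule exI[of _ "\<lambda>_ _. k"], rule exI[of _ "\<lambda>_ _. 1"])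
      (simp add: bipoly_const)
qed

lemma regular_off_mult_add:
  assumes "regular_off f l" "regular_off f m"
  shows "regular_off f (\<lambda>p\<in>off f. l p * m p)" "regular_off f (\<lambda>p\<in>off f. l p + m p)"
proof -
  have "(\<exists>d e c c'. bipoly d e c' p \<noteq> 0 \<and> (\<forall>q\<in>off f. bipoly d e c' q \<noteq> 0 \<longrightarrow>
        l q * m q = bipoly d e c q / bipoly d e c' q)) \<and>
      (\<exists>d e c c'. bipoly d e c' p \<noteq> 0 \<and> (\<forall>q\<in>off f. bipoly d e c' q \<noteq> 0 \<longrightarrow>
        l q + m q = bipoly d e c q / bipoly d e c' q))"
    if p: "p \<in> off f" for p
  proof -
    obtain d e c c' where l: "bipoly d e c' p \<noteq> 0"
        "\<forall>q\<in>off f. bipoly d e c' q \<noteq> 0 \<longrightarrow> l q = bipoly d e c q / bipoly d e c' q"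
      using bspec[OF assms(1)[unfolded regular_off_def] p] by (elim exE conjE)
    obtain d1 e1 c1 c1' where m: "bipoly d1 e1 c1' p \<noteq> 0"
        "\<forall>q\<in>off f. bipoly d1 e1 c1' q \<noteq> 0 \<longrightarrow> m q = bipoly d1 e1 c1 q / bipoly d1 e1 c1' q"
      using bspec[OF assms(2)[unfolded regular_off_def] p] by (elim exE conjE)
    let ?den = "bconv d e d1 e1 c' c1'"
    have den: "bipoly (d + d1) (e + e1) ?den q = bipoly d e c' q * bipoly d1 e1 c1' q" for q
      by (rule bipoly_mult[symmetric])
    show ?thesis
    proof (intro conjI exI ballI impI)
      show "bipoly (d + d1) (e + e1) ?den p \<noteq> 0" "bipoly (d + d1) (e + e1) ?den p \<noteq> 0"
        using l m by (simp_all add: den)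
      fix q assume q: "q \<in> off f" "bipoly (d + d1) (e + e1) ?den q \<noteq> 0"
      then have nz: "bipoly d e c' q \<noteq> 0" "bipoly d1 e1 c1' q \<noteq> 0" by (simp_all add: den)
      then show "l q * m q = bipoly (d + d1) (e + e1) (bconv d e d1 e1 c c1) q / bipoly (d + d1) (e + e1) ?den q"
        using l(2) m(2) q(1) by (simp add: den bipoly_mult[symmetric])
      show "l q + m q = bipoly (d + d1) (e + e1)
          (\<lambda>j \<gamma>. bconv d e d1 e1 c c1' j \<gamma> + bconv d e d1 e1 c' c1 j \<gamma>) q / bipoly (d + d1) (e + e1) ?den q"
        using l(2) m(2) q(1) nz
        by (simp add: den bipoly_mult[symmetric] bipoly_add[symmetric] add_frac_eq mult.commute)
    qed
  qed
  then show "regular_off f (\<lambda>p\<in>off f. l p * m p)" "regular_off f (\<lambda>p\<in>off f. l p + m p)"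
    unfolding regular_off_def by simp_all
qed

lemma ring_A_ring:
  assumes glue: "\<And>t. (a1, b1, t) \<in> off f \<Longrightarrow> (a2, b2, Pm *v t) \<in> off f"
  shows "ring (A_ring a1 b1 a2 b2 Pm f)"
proof -
  let ?A = "A_ring a1 b1 a2 b2 Pm f"
  have const: "(\<lambda>p\<in>off f. k) \<in> carrier ?A" for k
    using glue by (auto simp: A_ring_def regular_off_const)
  have closed: "l \<otimes>\<^bsub>?A\<^esub> m \<in> carrier ?A \<and> l \<oplus>\<^bsub>?A\<^esub> m \<in> carrier ?A"
    if "l \<in> carrier ?A" "m \<in> carrier ?A" for l m
    using that glue regular_off_mult_add[of f l m] by (auto simp: A_ring_def)
  have ext: "l = (\<lambda>p\<in>off f. l p)" if "l \<in> carrier ?A" for l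
    using that by (simp add: A_ring_def extensional_restrict)
  show ?thesis
  proof (intro ringI abelian_groupI monoidI)
    fix l m assume lm: "l \<in> carrier ?A" "m \<in> carrier ?A"
    show "l \<oplus>\<^bsub>?A\<^esub> m \<in> carrier ?A" "l \<otimes>\<^bsub>?A\<^esub> m \<in> carrier ?A" using closed[OF lm] by auto
    show "l \<oplus>\<^bsub>?A\<^esub> m = m \<oplus>\<^bsub>?A\<^esub> l" by (simp add: A_ring_def add.commute)
  next
    show "\<zero>\<^bsub>?A\<^esub> \<in> carrier ?A" "\<one>\<^bsub>?A\<^esub> \<in> carrier ?A"
      using const[of 0] const[of 1] by (simp_all add: A_ring_def)
  next
    fix l assume l: "l \<in> carrier ?A"
    show "\<zero>\<^bsub>?A\<^esub> \<oplus>\<^bsub>?A\<^esub> l = l" "\<one>\<^bsub>?A\<^esub> \<otimes>\<^bsub>?A\<^esub> l = l" "l \<otimes>\<^bsub>?A\<^esub> \<one>\<^bsub>?A\<^esub> = l"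
      by (subst (2) ext[OF l], simp add: A_ring_def cong: restrict_cong)+
    show "\<exists>m\<in>carrier ?A. m \<oplus>\<^bsub>?A\<^esub> l = \<zero>\<^bsub>?A\<^esub>"
    proof
      show "(\<lambda>p\<in>off f. - 1) \<otimes>\<^bsub>?A\<^esub> l \<in> carrier ?A" using closed[OF const l] by blast
    qed (simp add: A_ring_def cong: restrict_cong)
  qed (simp_all add: A_ring_def algebra_simps cong: restrict_cong)
qed

lemma A_ring_eqI:
  assumes "l \<in> carrier (A_ring a1 b1 a2 b2 Pm f)" "m \<in> carrier (A_ring a1 b1 a2 b2 Pm f)"
    and "\<And>p. p \<in> off f \<Longrightarrow> l p = m p"
  shows "l = m"
  using assms by (intro extensionalityI[of _ "off f"]) (auto simp: A_ring_def)

section \<open>Restriction to an affine chart\<close>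

lemma analytic_near_bipoly:
  assumes "\<And>j \<gamma>. analytic_near x0 (h j \<gamma>)" "analytic_near x0 z1" "analytic_near x0 z2"
    and "\<And>i. analytic_near x0 (\<lambda>x. t x $ i)"
  shows "analytic_near x0 (\<lambda>x. bipoly d e (\<lambda>j \<gamma>. h j \<gamma> x) (z1 x, z2 x, t x))"
  unfolding bipoly_eq bmon_def prod.case
  by (intro analytic_near_sum analytic_near_mult analytic_near_prod analytic_near_power assms)

text \<open>
  Write \<open>f\<close> as \<open>u * a t + s * b t\<close> in a basis \<open>y, w\<close> of the \<open>z\<close>-plane with \<open>a ts = 1\<close> for some \<open>ts\<close>. A vector
  \<open>x\<close> splits into the number \<open>s = a x\<close> and the point \<open>t = ts + x - s * ts\<close> of the hyperplane \<open>a t = 1\<close>,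
  and \<open>f = 1\<close> determines \<open>u = 1 - s * b t\<close>. This maps affine \<open>n\<close>-space by polynomials onto the level set
  \<open>f = 1, a t = 1\<close>, which meets the class of every point with \<open>f\<close> and \<open>a\<close> nonzero. As \<open>f = 1\<close> on the
  chart, a quotient \<open>g / f ^ N\<close> restricts to a polynomial.
\<close>

lemma affine_chart:
  fixes p0 :: "'n::finite point"
  assumes p0: "form \<alpha> \<beta> p0 \<noteq> 0"
  shows "\<exists>(\<phi> :: complex ^ 'n \<Rightarrow> 'n point) a. (\<forall>x. form \<alpha> \<beta> (\<phi> x) = 1) \<and>
    (\<forall>d e c x0. analytic_near x0 (\<lambda>x. bipoly d e c (\<phi> x))) \<and>
    (\<forall>d e c x y. \<exists>R. \<forall>s. bipoly d e c (\<phi> (x + s *s y)) = poly R s) \<and>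
    bipoly 0 1 a p0 \<noteq> 0 \<and>
    (\<forall>p. form \<alpha> \<beta> p \<noteq> 0 \<and> bipoly 0 1 a p \<noteq> 0 \<longrightarrow> (\<exists>\<kappa> \<mu> x. p = zscale \<kappa> \<mu> (\<phi> x)))"
proof -
  obtain y1 y2 t0 where p0_eq: "p0 = (y1, y2, t0)" by (cases p0)
  have "(y1, y2) \<noteq> (0, 0)" using form_nonzero_imp(1) p0 unfolding p0_eq by blast
  then obtain w1 w2 where det: "y1 * w2 - y2 * w1 = 1"
  proof (cases "y1 = 0")
    case True
    then show ?thesis using that[of 0 "- 1 / y2"] that[of "- 1 / y2" 0] \<open>(y1, y2) \<noteq> (0, 0)\<close> by simp
  next
    case False
    then show ?thesis using that[of "1 / y1" 0] that[of 0 "1 / y1"] by simp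
  qed
  define av where "av = (\<chi> i. y1 * \<alpha> $ i + y2 * \<beta> $ i)"
  define bv where "bv = (\<chi> i. w1 * \<alpha> $ i + w2 * \<beta> $ i)"
  define lin where "lin v t = (\<Sum>i\<in>UNIV. v $ i * t $ i)" for v t :: "complex ^ 'n"
  have lin_add: "lin v (t + t') = lin v t + lin v t'"
    and lin_diff: "lin v (t - t') = lin v t - lin v t'"
    and lin_scale: "lin v (k *s t) = k * lin v t" for v t t' k
    by (simp_all add: lin_def sum.distrib sum_subtractf sum_distrib_left algebra_simps)
  have form_lin: "form \<alpha> \<beta> (u * y1 + s * w1, u * y2 + s * w2, t) = u * lin av t + s * lin bv t"
    for u s t
    by (simp add: form_eq lin_def av_def bv_def sum.distrib sum_distrib_left algebra_simps)
  have lin_p0: "lin av t0 = form \<alpha> \<beta> p0" using form_lin[of 1 0 t0] by (simp add: p0_eq)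
  define ts where "ts = (1 / lin av t0) *s t0"
  have ts: "lin av ts = 1" using p0 by (simp add: ts_def lin_scale lin_p0)
  define T where "T x = ts + x - lin av x *s ts" for x
  define U where "U x = 1 - lin bv (T x) * lin av x" for x
  define \<phi> where "\<phi> x = (U x * y1 + lin av x * w1, U x * y2 + lin av x * w2, T x)" for x
  obtain a where a: "\<forall>z1 z2 t. lin av t = bipoly 0 1 a (z1, z2, t)"
    using linear_eq_bipoly[of av] unfolding lin_def by (elim exE)
  have "lin av (T x) = 1" for x by (simp add: T_def lin_add lin_diff lin_scale ts)
  then have "form \<alpha> \<beta> (\<phi> x) = 1" for x by (simp add: \<phi>_def form_lin U_def)
  moreover have "analytic_near x0 (\<lambda>x. bipoly d e c (\<phi> x))" for d e c x0
  proof -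
    have lin: "analytic_near x0 (\<lambda>x. lin v (g x))" if "\<And>i. analytic_near x0 (\<lambda>x. g x $ i)" for v g
      unfolding lin_def
      by (intro analytic_near_sum analytic_near_mult analytic_near_const that)
    have s: "analytic_near x0 (\<lambda>x. lin v x)" for v by (intro lin analytic_near_coord)
    have "analytic_near x0 (\<lambda>x. (ts $ i + x $ i) + (- ts $ i) * lin av x)" for i
      by (intro analytic_near_add analytic_near_mult analytic_near_const analytic_near_coord s)
    then have t: "analytic_near x0 (\<lambda>x. T x $ i)" for i by (simp add: T_def mult.commute)
    have "analytic_near x0 (\<lambda>x. 1 + (- 1) * (lin bv (T x) * lin av x))"
      by (intro analytic_near_add analytic_near_mult analytic_near_const lin s t)
    then have u: "analytic_near x0 U" by (simp add: U_def[abs_def])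
    show ?thesis unfolding \<phi>_def
      by (intro analytic_near_bipoly analytic_near_add analytic_near_mult analytic_near_const s t u)
  qed
  moreover have "\<exists>R. \<forall>s. bipoly d e c (\<phi> (x + s *s y)) = poly R s" for d e c x y
  proof -
    define Sp where "Sp = [:lin av x, lin av y:]"
    define Tp where "Tp i = [:ts $ i + x $ i, y $ i:] - smult (ts $ i) Sp" for i
    define Up where "Up = 1 - (\<Sum>i\<in>UNIV. smult (bv $ i) (Tp i)) * Sp"
    have S: "lin av (x + s *s y) = poly Sp s" for s by (simp add: Sp_def lin_add lin_scale)
    have Tc: "T (x + s *s y) $ i = poly (Tp i) s" for s i
      by (simp add: T_def Tp_def S mult.commute)
    have "U (x + s *s y) = poly Up s" for s
      unfolding U_def Up_def S lin_def[of bv] Tc by (simp add: poly_sum)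
    then have "\<phi> (x + s *s y) = (poly (smult y1 Up + smult w1 Sp) s, poly (smult y2 Up + smult w2 Sp) s,
        \<chi> i. poly (Tp i) s)" for s
      by (simp add: \<phi>_def S Tc[symmetric] vec_eq_iff mult.commute)
    then show ?thesis using bipoly_curve[of d e c _ _ Tp] by metis
  qed
  moreover have "bipoly 0 1 a p0 \<noteq> 0" using a p0 lin_p0 unfolding p0_eq by metis
  moreover have "\<exists>\<kappa> \<mu> x. p = zscale \<kappa> \<mu> (\<phi> x)" if fp: "form \<alpha> \<beta> p \<noteq> 0" and ap: "bipoly 0 1 a p \<noteq> 0" for p
  proof -
    obtain z1 z2 t where p: "p = (z1, z2, t)" by (cases p)
    have at: "lin av t \<noteq> 0" using ap a unfolding p by metis
    \<comment> \<open>The coordinates of \<open>(z1, z2)\<close> in the basis \<open>y, w\<close>, whose determinant is 1.\<close>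
    define l1 where "l1 = z1 * w2 - z2 * w1"
    define l2 where "l2 = y1 * z2 - y2 * z1"
    have "l1 * y1 + l2 * w1 = z1 * (y1 * w2 - y2 * w1)" "l1 * y2 + l2 * w2 = z2 * (y1 * w2 - y2 * w1)"
      by (simp_all add: l1_def l2_def algebra_simps)
    then have z: "z1 = l1 * y1 + l2 * w1" "z2 = l1 * y2 + l2 * w2" by (simp_all add: det)
    define t1 where "t1 = (1 / lin av t) *s t"
    have t1: "lin av t1 = 1" "lin av t *s t1 = t" using at by (simp_all add: t1_def lin_scale)
    define \<nu> where "\<nu> = l1 + l2 * lin bv t1"
    have "form \<alpha> \<beta> p = lin av t * \<nu>"
      unfolding p z form_lin using at by (simp add: \<nu>_def t1_def lin_scale distrib_left)
    then have \<nu>: "\<nu> \<noteq> 0" using fp by auto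
    define s where "s = l2 / \<nu>"
    define x where "x = t1 - ts + s *s ts"
    have ax: "lin av x = s" by (simp add: x_def lin_add lin_diff lin_scale t1 ts)
    have Tx: "T x = t1" by (simp add: T_def ax) (simp add: x_def)
    have Ux: "U x = l1 / \<nu>" using \<nu> by (simp add: U_def ax Tx s_def \<nu>_def field_simps)
    have "p = zscale \<nu> (lin av t) (\<phi> x)"
      using \<nu> by (simp add: zscale_def \<phi>_def ax Tx Ux p t1 z s_def distrib_left)
    then show ?thesis by blast
  qed
  ultimately show ?thesis by blast
qed

lemma scalar_matrix_embedding:
  assumes h: "ring_embedding h A R"
  shows "ring_embedding (\<lambda>a i j. if i = j then h a else \<zero>\<^bsub>R\<^esub>) A (Mat_ring R :: ('n::finite \<Rightarrow> 'n \<Rightarrow> 'a) ring)"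
proof -
  interpret h: ring_hom_ring A R h using h by (simp add: ring_embedding_def)
  have "ring_hom_ring A (Mat_ring R :: ('n \<Rightarrow> 'n \<Rightarrow> 'a) ring) (\<lambda>a i j. if i = j then h a else \<zero>\<^bsub>R\<^esub>)"
  proof (rule ring_hom_ringI)
    show "ring A" "ring (Mat_ring R :: ('n \<Rightarrow> 'n \<Rightarrow> 'a) ring)"
      by (rule h.R.ring_axioms) (intro ring_Mat_ring h.S.ring_axioms)
    fix a b assume ab: "a \<in> carrier A" "b \<in> carrier A"
    have "(\<Oplus>\<^bsub>R\<^esub>j\<in>UNIV. (if i = j then h a else \<zero>\<^bsub>R\<^esub>) \<otimes>\<^bsub>R\<^esub> (if j = k then h b else \<zero>\<^bsub>R\<^esub>)) =
        (if i = k then h (a \<otimes>\<^bsub>A\<^esub> b) else \<zero>\<^bsub>R\<^esub>)" for i k :: 'n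
    proof -
      have "(\<Oplus>\<^bsub>R\<^esub>j\<in>UNIV. (if i = j then h a else \<zero>\<^bsub>R\<^esub>) \<otimes>\<^bsub>R\<^esub> (if j = k then h b else \<zero>\<^bsub>R\<^esub>)) =
          (\<Oplus>\<^bsub>R\<^esub>j\<in>UNIV. if i = j then h a \<otimes>\<^bsub>R\<^esub> (if j = k then h b else \<zero>\<^bsub>R\<^esub>) else \<zero>\<^bsub>R\<^esub>)"
        using ab by (intro h.S.finsum_cong') auto
      also have "\<dots> = h a \<otimes>\<^bsub>R\<^esub> (if i = k then h b else \<zero>\<^bsub>R\<^esub>)"
        using ab by (intro h.S.finsum_singleton) auto
      finally show ?thesis using ab by simp
    qed
    then show "(\<lambda>i j. if i = j then h (a \<otimes>\<^bsub>A\<^esub> b) else \<zero>\<^bsub>R\<^esub>) =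
        (\<lambda>i j. if i = j then h a else \<zero>\<^bsub>R\<^esub>) \<otimes>\<^bsub>Mat_ring R :: ('n \<Rightarrow> 'n \<Rightarrow> 'a) ring\<^esub>
        (\<lambda>i j. if i = j then h b else \<zero>\<^bsub>R\<^esub>)"
      by (simp add: Mat_ring_def)
    show "(\<lambda>i j. if i = j then h (a \<oplus>\<^bsub>A\<^esub> b) else \<zero>\<^bsub>R\<^esub>) =
        (\<lambda>i j. if i = j then h a else \<zero>\<^bsub>R\<^esub>) \<oplus>\<^bsub>Mat_ring R :: ('n \<Rightarrow> 'n \<Rightarrow> 'a) ring\<^esub>
        (\<lambda>i j. if i = j then h b else \<zero>\<^bsub>R\<^esub>)"
      using ab by (simp add: Mat_ring_def fun_eq_iff)
  qed (simp_all add: Mat_ring_def fun_eq_iff)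
  moreover have "inj_on (\<lambda>a (i :: 'n) j. if i = j then h a else \<zero>\<^bsub>R\<^esub>) (carrier A)"
  proof (rule inj_onI)
    fix a b assume ab: "a \<in> carrier A" "b \<in> carrier A"
      and eq: "(\<lambda>(i :: 'n) j. if i = j then h a else \<zero>\<^bsub>R\<^esub>) = (\<lambda>i j. if i = j then h b else \<zero>\<^bsub>R\<^esub>)"
    have "h a = h b" using fun_cong[OF fun_cong[OF eq, of undefined], of undefined] by simp
    then show "a = b" using h ab by (auto simp: ring_embedding_def inj_on_def)
  qed
  ultimately show ?thesis by (simp add: ring_embedding_def)
qed

lemma mult_op_mult: "analytic_near x0 g \<Longrightarrow> analytic_near x0 h \<Longrightarrow>
    mult_op x0 g \<otimes>\<^bsub>D_ring x0\<^esub> mult_op x0 h = mult_op x0 (\<lambda>x. g x * h x)"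
  and mult_op_add: "analytic_near x0 g \<Longrightarrow> analytic_near x0 h \<Longrightarrow>
    mult_op x0 g \<oplus>\<^bsub>D_ring x0\<^esub> mult_op x0 h = mult_op x0 (\<lambda>x. g x + h x)"
proof -
  assume gh: "analytic_near x0 g" "analytic_near x0 h"
  interpret O: cring "O_ring x0" by (rule cring_O_ring)
  note D = mult_op_in_D[OF gh(1)] mult_op_in_D[OF gh(2)]
  show "mult_op x0 g \<otimes>\<^bsub>D_ring x0\<^esub> mult_op x0 h = mult_op x0 (\<lambda>x. g x * h x)"
  proof (rule D_eqI[of _ x0])
    fix H assume H: "H \<in> carrier (O_ring x0)"
    then show "(mult_op x0 g \<otimes>\<^bsub>D_ring x0\<^esub> mult_op x0 h) H = mult_op x0 (\<lambda>x. g x * h x) H"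
      using gh by (simp add: D_ring_apply mult_op_def germ_in_O O_mult_germ[symmetric] O.m_assoc)
  qed (intro D_ring_closed D mult_op_in_D analytic_near_mult gh)+
  show "mult_op x0 g \<oplus>\<^bsub>D_ring x0\<^esub> mult_op x0 h = mult_op x0 (\<lambda>x. g x + h x)"
  proof (rule D_eqI[of _ x0])
    fix H assume H: "H \<in> carrier (O_ring x0)"
    then show "(mult_op x0 g \<oplus>\<^bsub>D_ring x0\<^esub> mult_op x0 h) H = mult_op x0 (\<lambda>x. g x + h x) H"
      using gh by (simp add: D_ring_apply mult_op_def germ_in_O O_add_germ[symmetric] O.l_distr)
  qed (intro D_ring_closed D mult_op_in_D analytic_near_add gh)+
qed

lemma mult_op_eq_imp:
  assumes "mult_op x0 g = mult_op x0 h" "analytic_near x0 g" "analytic_near x0 h"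
  shows "germ x0 g = germ x0 h"
proof -
  interpret O: cring "O_ring x0" by (rule cring_O_ring)
  have "mult_op x0 g \<one>\<^bsub>O_ring x0\<^esub> = mult_op x0 h \<one>\<^bsub>O_ring x0\<^esub>" by (simp only: assms(1))
  then show ?thesis using assms by (simp add: mult_op_def germ_in_O)
qed

lemma A_ring_quotient:
  assumes "l \<in> carrier (A_ring a1 b1 a2 b2 Pm (form \<alpha> \<beta>))" "form \<alpha> \<beta> p0 \<noteq> 0"
  shows "\<exists>N g. \<forall>p. form \<alpha> \<beta> p \<noteq> 0 \<longrightarrow> l p = bipoly N N g p / form \<alpha> \<beta> p ^ N"
proof -
  have "regular_off (form \<alpha> \<beta>) l" using assms(1) by (simp add: A_ring_def)
  from regular_off_form[OF this assms(2)] show ?thesis by metis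
qed

text \<open>Equality of two quotients, cleared of denominators, is the vanishing of one bihomogeneous polynomial.\<close>

lemma quotient_difference:
  "\<exists>c. \<forall>p. form \<alpha> \<beta> p \<noteq> 0 \<longrightarrow>
    (bipoly N N g p / form \<alpha> \<beta> p ^ N = bipoly M M h p / form \<alpha> \<beta> p ^ M \<longleftrightarrow> bipoly (N + M) (N + M) c p = 0)"
proof -
  from form_power_eq_bipoly[of \<alpha> \<beta> M] obtain cM
    where cM: "\<forall>p. form \<alpha> \<beta> p ^ M = bipoly M M cM p" by (elim exE)
  from form_power_eq_bipoly[of \<alpha> \<beta> N] obtain cN
    where cN: "\<forall>p. form \<alpha> \<beta> p ^ N = bipoly N N cN p" by (elim exE)
  let ?c = "\<lambda>j \<gamma>. bconv N N M M g cM j \<gamma> + - 1 * bconv N N M M cN h j \<gamma>"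
  have "bipoly (N + M) (N + M) ?c p = bipoly N N g p * form \<alpha> \<beta> p ^ M - form \<alpha> \<beta> p ^ N * bipoly M M h p" for p
    unfolding cM[rule_format] cN[rule_format] bipoly_mult bipoly_add[symmetric] bipoly_cmult[symmetric]
    by simp
  then show ?thesis by (intro exI[of _ ?c]) (auto simp: frac_eq_eq mult.commute)
qed

text \<open>
  Restriction to the chart is a ring homomorphism from \<open>A_f\<close> to analytic functions, hence to
  multiplication operators. It is injective: a bihomogeneous polynomial that vanishes on the chart
  near \<open>x0\<close> vanishes on the whole chart, then on its rescalings, which are dense.
\<close>

lemma A_ring_embeds_in_D_ring:
  fixes x0 :: "complex ^ 'n::finite"
  assumes glue: "\<And>t. (a1, b1, t) \<in> off (form \<alpha> \<beta>) \<Longrightarrow> (a2, b2, Pm *v t) \<in> off (form \<alpha> \<beta>)"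
    and p0: "form \<alpha> \<beta> (p0 :: 'n point) \<noteq> 0"
  shows "\<exists>h. ring_embedding h (A_ring a1 b1 a2 b2 Pm (form \<alpha> \<beta>)) (D_ring x0)"
proof -
  let ?A = "A_ring a1 b1 a2 b2 Pm (form \<alpha> \<beta>)"
  from affine_chart[OF p0] obtain \<phi> :: "complex ^ 'n \<Rightarrow> 'n point" and a where f\<phi>: "\<forall>x. form \<alpha> \<beta> (\<phi> x) = 1"
    and an: "\<forall>d e c x0. analytic_near x0 (\<lambda>x. bipoly d e c (\<phi> x))"
    and curve: "\<forall>d e c x y. \<exists>R. \<forall>s. bipoly d e c (\<phi> (x + s *s y)) = poly R s"
    and ap0: "bipoly 0 1 a p0 \<noteq> 0"
    and surj: "\<forall>p. form \<alpha> \<beta> p \<noteq> 0 \<and> bipoly 0 1 a p \<noteq> 0 \<longrightarrow> (\<exists>\<kappa> \<mu> x. p = zscale \<kappa> \<mu> (\<phi> x))"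
    by (elim exE conjE)
  have off\<phi>: "\<phi> x \<in> off (form \<alpha> \<beta>)" for x by (simp add: off_form f\<phi>)
  have an_l: "analytic_near x0 (\<lambda>x. l (\<phi> x))" if "l \<in> carrier ?A" for l
  proof -
    from A_ring_quotient[OF that p0] obtain N g
      where lg: "\<forall>p. form \<alpha> \<beta> p \<noteq> 0 \<longrightarrow> l p = bipoly N N g p / form \<alpha> \<beta> p ^ N" by (elim exE)
    have "l (\<phi> x) = bipoly N N g (\<phi> x)" for x
      using lg[rule_format, of "\<phi> x"] f\<phi>[rule_format, of x] by simp
    then have "(\<lambda>x. l (\<phi> x)) = (\<lambda>x. bipoly N N g (\<phi> x))" by (rule ext)
    then show ?thesis using an by simp
  qed
  have inj: "l = m" if l: "l \<in> carrier ?A" and m: "m \<in> carrier ?A"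
    and ev: "\<forall>\<^sub>F x in nhds x0. l (\<phi> x) = m (\<phi> x)" for l m
  proof -
    from A_ring_quotient[OF l p0] obtain N g
      where lg: "\<forall>p. form \<alpha> \<beta> p \<noteq> 0 \<longrightarrow> l p = bipoly N N g p / form \<alpha> \<beta> p ^ N" by (elim exE)
    from A_ring_quotient[OF m p0] obtain M h
      where mh: "\<forall>p. form \<alpha> \<beta> p \<noteq> 0 \<longrightarrow> m p = bipoly M M h p / form \<alpha> \<beta> p ^ M" by (elim exE)
    from quotient_difference[of \<alpha> \<beta> N g M h] obtain c where c: "\<forall>p. form \<alpha> \<beta> p \<noteq> 0 \<longrightarrow>
        (bipoly N N g p / form \<alpha> \<beta> p ^ N = bipoly M M h p / form \<alpha> \<beta> p ^ M \<longleftrightarrow>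
          bipoly (N + M) (N + M) c p = 0)" by (elim exE)
    have eq_iff: "l p = m p \<longleftrightarrow> bipoly (N + M) (N + M) c p = 0" if "form \<alpha> \<beta> p \<noteq> 0" for p
      using lg[rule_format, OF that] mh[rule_format, OF that] c[rule_format, OF that] by simp
    have on_chart: "bipoly (N + M) (N + M) c (\<phi> x) = 0" for x
    proof -
      from curve obtain R where
        R: "\<forall>s. bipoly (N + M) (N + M) c (\<phi> (x0 + s *s (x - x0))) = poly R s" by blast
      have "((\<lambda>s. x0 + s *s (x - x0)) \<longlongrightarrow> x0 + 0 *s (x - x0)) (nhds 0)"
      proof (rule vec_tendstoI)
        fix i
        have "((\<lambda>s. x0 $ i + s * (x - x0) $ i) \<longlongrightarrow> x0 $ i + 0 * (x - x0) $ i) (nhds 0)"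
          by (intro tendsto_intros filterlim_ident)
        then show "((\<lambda>s. (x0 + s *s (x - x0)) $ i) \<longlongrightarrow> (x0 + 0 *s (x - x0)) $ i) (nhds 0)"
          by (simp only: vector_add_component vector_smult_component)
      qed
      then have "filterlim (\<lambda>s. x0 + s *s (x - x0)) (nhds x0) (nhds 0)" by simp
      from eventually_compose_filterlim[OF ev this]
      have "\<forall>\<^sub>F s in nhds 0. poly R s = poly 0 s"
        by (rule eventually_mono) (simp add: R[rule_format, symmetric] eq_iff f\<phi>)
      then obtain V where "open V" "0 \<in> V" "\<forall>s\<in>V. poly R s = poly 0 s"
        unfolding eventually_nhds by blast
      then have "infinite {s. poly R s = poly 0 s}"
        using finite_imp_not_open[of V] by (metis (mono_tags) empty_iff finite_subset mem_Collect_eq subsetI)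
      then have "R = 0" by (rule poly_eq_on_infinite)
      then show ?thesis using R[rule_format, of 1] by simp
    qed
    show ?thesis
    proof (rule A_ring_eqI[OF l m])
      fix p assume "p \<in> off (form \<alpha> \<beta>)"
      then have fp: "form \<alpha> \<beta> p \<noteq> 0" by (simp add: off_form)
      define L where "L = pline p (p0 - p)"
      have L0: "L 0 = p" and L1: "L 1 = p0" unfolding L_def by (rule pline_to)+
      obtain R where R: "\<forall>s. bipoly (N + M) (N + M) c (L s) = poly R s"
        using bipoly_line unfolding L_def by blast
      obtain B where B: "\<forall>s. bipoly 0 1 a (L s) = poly B s"
        using bipoly_line unfolding L_def by blast
      obtain F where F: "\<forall>s. form \<alpha> \<beta> (L s) = poly F s" using form_line unfolding L_def by blast
      have "poly (B * F) 1 \<noteq> 0" using B[rule_format, of 1] F[rule_format, of 1] ap0 p0 by (simp add: L1)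
      from infinite_minus_roots[OF infinite_UNIV_char_0 this]
      have "infinite {s. poly R s = poly 0 s}"
      proof (rule infinite_super[rotated], safe)
        fix s assume "poly (B * F) s \<noteq> 0"
        then have "form \<alpha> \<beta> (L s) \<noteq> 0" "bipoly 0 1 a (L s) \<noteq> 0" using B F by auto
        then obtain \<kappa> \<mu> x where "L s = zscale \<kappa> \<mu> (\<phi> x)" using surj by blast
        then show "poly R s = poly 0 s"
          unfolding R[rule_format, symmetric] by (simp add: bipoly_zscale on_chart)
      qed
      then have "R = 0" by (rule poly_eq_on_infinite)
      then show "l p = m p" using R[rule_format, of 0] eq_iff[OF fp] by (simp add: L0)
    qed
  qed
  have "ring_hom_ring ?A (D_ring x0) (\<lambda>l. mult_op x0 (\<lambda>x. l (\<phi> x)))"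
  proof (rule ring_hom_ringI)
    show "ring ?A" by (rule ring_A_ring[OF glue])
    show "ring (D_ring x0)" by (rule ring_D_ring)
    fix l m assume lm: "l \<in> carrier ?A" "m \<in> carrier ?A"
    show "mult_op x0 (\<lambda>x. l (\<phi> x)) \<in> carrier (D_ring x0)" by (intro mult_op_in_D an_l lm)
    show "mult_op x0 (\<lambda>x. (l \<otimes>\<^bsub>?A\<^esub> m) (\<phi> x)) =
        mult_op x0 (\<lambda>x. l (\<phi> x)) \<otimes>\<^bsub>D_ring x0\<^esub> mult_op x0 (\<lambda>x. m (\<phi> x))"
      by (simp add: mult_op_mult an_l lm) (simp add: A_ring_def off\<phi>)
    show "mult_op x0 (\<lambda>x. (l \<oplus>\<^bsub>?A\<^esub> m) (\<phi> x)) =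
        mult_op x0 (\<lambda>x. l (\<phi> x)) \<oplus>\<^bsub>D_ring x0\<^esub> mult_op x0 (\<lambda>x. m (\<phi> x))"
      by (simp add: mult_op_add an_l lm) (simp add: A_ring_def off\<phi>)
  next
    show "mult_op x0 (\<lambda>x. \<one>\<^bsub>?A\<^esub> (\<phi> x)) = \<one>\<^bsub>D_ring x0\<^esub>"
      by (simp add: D_one_eq A_ring_def off\<phi>)
  qed
  moreover have "inj_on (\<lambda>l. mult_op x0 (\<lambda>x. l (\<phi> x))) (carrier ?A)"
  proof (rule inj_onI)
    fix l m assume l: "l \<in> carrier ?A" and m: "m \<in> carrier ?A"
      and "mult_op x0 (\<lambda>x. l (\<phi> x)) = mult_op x0 (\<lambda>x. m (\<phi> x))"
    then have "germ x0 (\<lambda>x. l (\<phi> x)) = germ x0 (\<lambda>x. m (\<phi> x))"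
      by (intro mult_op_eq_imp an_l)
    then show "l = m" by (intro inj l m) (simp add: germ_eq_iff)
  qed
  ultimately show ?thesis unfolding ring_embedding_def by blast
qed

section \<open>Baker-Akhiezer functions\<close>

lemma analytic_near_BA:
  assumes "\<And>j \<gamma>. analytic_near x0 (h j \<gamma>)"
  shows "analytic_near x0 (\<lambda>x. BA f fs k h x p)"
proof -
  obtain z1 z2 t where p: "p = (z1, z2, t)" by (cases p)
  have "analytic_near x0 (\<lambda>x. bipoly k k (\<lambda>j \<gamma>. h j \<gamma> x) (z1, z2, t) * (1 / f p ^ k) *
      (\<Prod>j\<in>UNIV. exp (fs j p / f p * x $ j)))"
    by (intro analytic_near_mult analytic_near_bipoly analytic_near_prod analytic_near_exp_coord
        analytic_near_const assms)
  then show ?thesis by (simp add: BA_def exp_sum p)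
qed

lemma BA_eq_0_iff: "f p \<noteq> 0 \<Longrightarrow> BA f fs k h x p = 0 \<longleftrightarrow> bipoly k k (\<lambda>j \<gamma>. h j \<gamma> x) p = 0"
  by (simp add: BA_def)

lemma M_module_D:
  assumes "\<psi> \<in> M_module a1 b1 a2 b2 Pm f fs \<Lambda> x0"
  shows "\<exists>k h. k \<ge> 1 \<and> \<psi> = (\<lambda>p\<in>off f. germ x0 (\<lambda>x. BA f fs k h x p)) \<and>
    (\<forall>j \<gamma>. analytic_near x0 (h j \<gamma>)) \<and>
    (\<forall>\<^sub>F x in nhds x0. \<forall>t. (a1, b1, t) \<in> off f \<longrightarrow>
        BA f fs k h x (a1, b1, t) - \<Lambda> * BA f fs k h x (a2, b2, Pm *v t) = 0)"
  using assms unfolding M_module_def M_level_def by auto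

lemma M_module_in_O:
  "\<psi> \<in> M_module a1 b1 a2 b2 Pm f fs \<Lambda> x0 \<Longrightarrow> p \<in> off f \<Longrightarrow> \<psi> p \<in> carrier (O_ring x0)"
  by (drule M_module_D, elim exE conjE) (simp add: germ_in_O analytic_near_BA)

text \<open>
  As \<open>l = g / f ^ N\<close>, the product of \<open>l\<close> and a Baker-Akhiezer function of level \<open>k\<close> is one of level
  \<open>k + N\<close>; both factors respect the gluing.
\<close>

lemma scale_in_M_module:
  assumes glue: "\<And>t. (a1, b1, t) \<in> off (form \<alpha> \<beta>) \<Longrightarrow> (a2, b2, Pm *v t) \<in> off (form \<alpha> \<beta>)"
    and p0: "form \<alpha> \<beta> p0 \<noteq> 0"
    and l: "l \<in> carrier (A_ring a1 b1 a2 b2 Pm (form \<alpha> \<beta>))"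
    and \<psi>: "\<psi> \<in> M_module a1 b1 a2 b2 Pm (form \<alpha> \<beta>) fs \<Lambda> x0"
  shows "scale x0 (off (form \<alpha> \<beta>)) l \<psi> \<in> M_module a1 b1 a2 b2 Pm (form \<alpha> \<beta>) fs \<Lambda> x0"
proof -
  define f where "f = form \<alpha> \<beta>"
  from A_ring_quotient[OF l p0] obtain N g
    where lg: "\<forall>p. f p \<noteq> 0 \<longrightarrow> l p = bipoly N N g p / f p ^ N" unfolding f_def by (elim exE)
  from M_module_D[OF \<psi>] obtain k h
    where k: "k \<ge> 1" and \<psi>_eq: "\<psi> = (\<lambda>p\<in>off f. germ x0 (\<lambda>x. BA f fs k h x p))"
      and h: "\<forall>j \<gamma>. analytic_near x0 (h j \<gamma>)"
      and hg: "\<forall>\<^sub>F x in nhds x0. \<forall>t. (a1, b1, t) \<in> off f \<longrightarrow>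
        BA f fs k h x (a1, b1, t) - \<Lambda> * BA f fs k h x (a2, b2, Pm *v t) = 0"
    unfolding f_def by (elim exE conjE)
  define h' where "h' j \<gamma> x = bconv N N k k g (\<lambda>j \<gamma>. h j \<gamma> x) j \<gamma>" for j \<gamma> x
  have h': "analytic_near x0 (h' j \<gamma>)" for j \<gamma>
    unfolding h'_def[abs_def] bconv_def
    by (intro analytic_near_sum analytic_near_mult analytic_near_const h[rule_format])
  have BA': "BA f fs (N + k) h' x p = l p * BA f fs k h x p" if "p \<in> off f" for p x
  proof -
    have "f p \<noteq> 0" using that by (simp add: f_def off_form)
    then show ?thesis
      using lg[rule_format, of p] bipoly_mult[of N N g p k k "\<lambda>j \<gamma>. h j \<gamma> x"]
      by (simp add: BA_def h'_def power_add)
  qed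
  have "\<forall>\<^sub>F x in nhds x0. \<forall>t. (a1, b1, t) \<in> off f \<longrightarrow>
      BA f fs (N + k) h' x (a1, b1, t) - \<Lambda> * BA f fs (N + k) h' x (a2, b2, Pm *v t) = 0"
    using hg
  proof (rule eventually_mono, intro allI impI)
    fix x t assume hx: "\<forall>t. (a1, b1, t) \<in> off f \<longrightarrow>
        BA f fs k h x (a1, b1, t) - \<Lambda> * BA f fs k h x (a2, b2, Pm *v t) = 0"
      and t: "(a1, b1, t) \<in> off f"
    have "l (a1, b1, t) = l (a2, b2, Pm *v t)"
      using l t unfolding f_def by (simp add: A_ring_def)
    moreover have "(a2, b2, Pm *v t) \<in> off f" using glue t unfolding f_def by blast
    moreover have "BA f fs k h x (a1, b1, t) = \<Lambda> * BA f fs k h x (a2, b2, Pm *v t)"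
      using hx t by simp
    ultimately show "BA f fs (N + k) h' x (a1, b1, t) - \<Lambda> * BA f fs (N + k) h' x (a2, b2, Pm *v t) = 0"
      using t by (simp add: BA')
  qed
  moreover have "scale x0 (off f) l \<psi> = (\<lambda>p\<in>off f. germ x0 (\<lambda>x. BA f fs (N + k) h' x p))"
    by (simp add: scale_def \<psi>_eq O_mult_germ BA' cong: restrict_cong)
  ultimately show ?thesis
    using h' k unfolding f_def[symmetric] M_module_def M_level_def
    by (intro UN_I[of "N + k"]) auto
qed

text \<open>
  If \<open>l\<close> and \<open>m\<close> differ at \<open>p1\<close>, they differ at almost all points of the line through \<open>p1\<close> and an
  arbitrary \<open>p\<close>. There \<open>\<psi>\<close> must vanish; along the line its numerator is a polynomial whose degree
  does not depend on \<open>x\<close>, so finitely many such points force it to vanish at \<open>p\<close> too.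
\<close>

lemma scale_eq_imp_zero:
  assumes l: "l \<in> carrier (A_ring a1 b1 a2 b2 Pm (form \<alpha> \<beta>))"
    and m: "m \<in> carrier (A_ring a1 b1 a2 b2 Pm (form \<alpha> \<beta>))"
    and \<psi>: "\<psi> \<in> M_module a1 b1 a2 b2 Pm (form \<alpha> \<beta>) fs \<Lambda> x0"
    and eq: "scale x0 (off (form \<alpha> \<beta>)) l \<psi> = scale x0 (off (form \<alpha> \<beta>)) m \<psi>"
    and p1: "p1 \<in> off (form \<alpha> \<beta>)" "l p1 \<noteq> m p1" and p: "p \<in> off (form \<alpha> \<beta>)"
  shows "\<psi> p = \<zero>\<^bsub>O_ring x0\<^esub>"
proof -
  define f where "f = form \<alpha> \<beta>"
  have fp: "f p \<noteq> 0" and fp1: "form \<alpha> \<beta> p1 \<noteq> 0" using p p1 by (simp_all add: f_def off_form)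
  from M_module_D[OF \<psi>] obtain k h
    where \<psi>_eq: "\<psi> = (\<lambda>p\<in>off f. germ x0 (\<lambda>x. BA f fs k h x p))"
    unfolding f_def by blast
  from A_ring_quotient[OF l fp1] obtain N g
    where lg: "\<forall>p. f p \<noteq> 0 \<longrightarrow> l p = bipoly N N g p / f p ^ N" unfolding f_def by (elim exE)
  from A_ring_quotient[OF m fp1] obtain M g'
    where mg: "\<forall>p. f p \<noteq> 0 \<longrightarrow> m p = bipoly M M g' p / f p ^ M" unfolding f_def by (elim exE)
  from quotient_difference[of \<alpha> \<beta> N g M g'] obtain c where c: "\<forall>p. f p \<noteq> 0 \<longrightarrow>
      (bipoly N N g p / f p ^ N = bipoly M M g' p / f p ^ M \<longleftrightarrow> bipoly (N + M) (N + M) c p = 0)"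
    unfolding f_def by (elim exE)
  define L where "L = pline p (p1 - p)"
  have L0: "L 0 = p" and L1: "L 1 = p1" unfolding L_def by (rule pline_to)+
  obtain C where C: "\<forall>s. bipoly (N + M) (N + M) c (L s) = poly C s"
    using bipoly_line unfolding L_def by blast
  obtain F where F: "\<forall>s. f (L s) = poly F s" using form_line unfolding L_def f_def by blast
  have "poly (F * C) 1 \<noteq> 0"
    using F[rule_format, of 1] C[rule_format, of 1] fp1 p1(2)
      c[rule_format, of p1] lg[rule_format, of p1] mg[rule_format, of p1]
    by (simp add: L1 f_def)
  from infinite_arbitrarily_large[OF infinite_minus_roots[OF infinite_UNIV_char_0 this], of "Suc (2 * k)"]
  obtain T where T: "finite T" "card T = Suc (2 * k)" "T \<subseteq> {s\<in>UNIV. poly (F * C) s \<noteq> 0}"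
    by (elim exE conjE)
  \<comment> \<open>\<open>2 * k + 1\<close> zeros suffice: the numerator has bidegree \<open>(k, k)\<close>.\<close>
  have "\<forall>\<^sub>F x in nhds x0. \<forall>s\<in>T. bipoly k k (\<lambda>j \<gamma>. h j \<gamma> x) (L s) = 0"
  proof (intro eventually_ball_finite T(1) ballI)
    fix s assume "s \<in> T"
    then have FC: "poly F s \<noteq> 0" "poly C s \<noteq> 0" using T(3) by auto
    then have fL: "f (L s) \<noteq> 0" using F by simp
    then have ne: "l (L s) \<noteq> m (L s)"
      using FC C c[rule_format, of "L s"] lg[rule_format, of "L s"] mg[rule_format, of "L s"] by simp
    have off: "L s \<in> off f" using fL by (simp add: f_def off_form)
    have "germ x0 (\<lambda>x. l (L s) * BA f fs k h x (L s)) = germ x0 (\<lambda>x. m (L s) * BA f fs k h x (L s))"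
      using fun_cong[OF eq, of "L s"] off unfolding f_def[symmetric]
      by (simp add: scale_def \<psi>_eq O_mult_germ)
    then show "\<forall>\<^sub>F x in nhds x0. bipoly k k (\<lambda>j \<gamma>. h j \<gamma> x) (L s) = 0"
      unfolding germ_eq_iff
      by (rule eventually_mono) (use ne BA_eq_0_iff[of f "L s", OF fL] in auto)
  qed
  then have "\<forall>\<^sub>F x in nhds x0. BA f fs k h x p = 0"
  proof eventually_elim
    case (elim x)
    obtain P where P: "\<forall>s. bipoly k k (\<lambda>j \<gamma>. h j \<gamma> x) (L s) = poly P s" "degree P \<le> k + k"
      using bipoly_line unfolding L_def by blast
    have "degree P < card T" using P(2) T(2) by simp
    from lagrange_interpolation[OF T(1) this, of 0] have "poly P 0 = 0"
      using elim P(1) by simp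
    then show ?case using P(1) L0 BA_eq_0_iff[of f p, OF fp] by metis
  qed
  then show ?thesis using p unfolding f_def[symmetric] by (simp add: \<psi>_eq O_zero germ_eq_iff)
qed

section \<open>Matrices of differential operators acting on a basis\<close>

lemma D_finsum_apply:
  assumes "\<And>j. j \<in> J \<Longrightarrow> S j \<in> carrier (D_ring x0)" "finite J" "H \<in> carrier (O_ring x0)"
  shows "(\<Oplus>\<^bsub>D_ring x0\<^esub>j\<in>J. S j) H = (\<Oplus>\<^bsub>O_ring x0\<^esub>j\<in>J. S j H)"
proof -
  interpret O: cring "O_ring x0" by (rule cring_O_ring)
  interpret D: ring "D_ring x0" by (rule ring_D_ring)
  show ?thesis using assms(2,1)
  proof (induction J rule: finite_induct)
    case empty
    then show ?case using assms(3) by (simp add: D_ring_apply)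
  next
    case (insert j J)
    have "(\<Oplus>\<^bsub>D_ring x0\<^esub>j\<in>insert j J. S j) = S j \<oplus>\<^bsub>D_ring x0\<^esub> (\<Oplus>\<^bsub>D_ring x0\<^esub>j\<in>J. S j)"
      using insert by (intro D.finsum_insert) auto
    moreover have "(\<Oplus>\<^bsub>O_ring x0\<^esub>j\<in>insert j J. S j H) = S j H \<oplus>\<^bsub>O_ring x0\<^esub> (\<Oplus>\<^bsub>O_ring x0\<^esub>j\<in>J. S j H)"
      using insert assms(3) by (intro O.finsum_insert) (auto intro: D_apply_closed)
    ultimately show ?case using insert assms(3) by (simp add: D_ring_apply)
  qed
qed

lemma D_apply_finsum:
  assumes "S \<in> carrier (D_ring x0)" "\<And>j. j \<in> J \<Longrightarrow> H j \<in> carrier (O_ring x0)" "finite J"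
  shows "S (\<Oplus>\<^bsub>O_ring x0\<^esub>j\<in>J. H j) = (\<Oplus>\<^bsub>O_ring x0\<^esub>j\<in>J. S (H j))"
proof -
  interpret O: cring "O_ring x0" by (rule cring_O_ring)
  show ?thesis using assms(3,2)
  proof (induction J rule: finite_induct)
    case empty
    have "S (germ x0 (\<lambda>_. 0) \<otimes>\<^bsub>O_ring x0\<^esub> \<zero>\<^bsub>O_ring x0\<^esub>) = germ x0 (\<lambda>_. 0) \<otimes>\<^bsub>O_ring x0\<^esub> S \<zero>\<^bsub>O_ring x0\<^esub>"
      by (rule D_apply_const_mult[OF assms(1)]) simp
    then show ?case using D_apply_closed[OF assms(1), of "\<zero>\<^bsub>O_ring x0\<^esub>"] by (simp add: O_zero[symmetric])
  next
    case (insert j J)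
    have "(\<Oplus>\<^bsub>O_ring x0\<^esub>j\<in>insert j J. H j) = H j \<oplus>\<^bsub>O_ring x0\<^esub> (\<Oplus>\<^bsub>O_ring x0\<^esub>j\<in>J. H j)"
      using insert by (intro O.finsum_insert) auto
    moreover have "(\<Oplus>\<^bsub>O_ring x0\<^esub>j\<in>insert j J. S (H j)) = S (H j) \<oplus>\<^bsub>O_ring x0\<^esub> (\<Oplus>\<^bsub>O_ring x0\<^esub>j\<in>J. S (H j))"
      using insert assms(1) by (intro O.finsum_insert) (auto intro: D_apply_closed)
    moreover have "(\<Oplus>\<^bsub>O_ring x0\<^esub>j\<in>J. H j) \<in> carrier (O_ring x0)"
      using insert by (intro O.finsum_closed) auto
    ultimately show ?case using insert by (simp add: D_apply_add[OF assms(1)])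
  qed
qed

text \<open>
  Multiplication by the function \<open>m\<close> of the spectral point commutes with the differential operators
  in \<open>x\<close>. So if \<open>E\<close> and \<open>F\<close> represent multiplication by \<open>l\<close> and \<open>m\<close> on the vector \<open>\<Psi>\<close>, then
  \<open>E F \<Psi> = E (m \<Psi>) = m E \<Psi> = m l \<Psi>\<close>.
\<close>

lemma
  fixes \<Psi> :: "'n::finite \<Rightarrow> 'n point \<Rightarrow> 'n germ"
  assumes \<Psi>: "\<And>i p. p \<in> U \<Longrightarrow> \<Psi> i p \<in> carrier (O_ring x0)"
    and E: "E \<in> carrier (Mat_ring (D_ring x0) :: ('n \<Rightarrow> 'n \<Rightarrow> _) ring)"
    and F: "F \<in> carrier (Mat_ring (D_ring x0) :: ('n \<Rightarrow> 'n \<Rightarrow> _) ring)"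
    and El: "\<And>i. lincomb x0 U (E i) \<Psi> = scale x0 U l (\<Psi> i)"
    and Fm: "\<And>i. lincomb x0 U (F i) \<Psi> = scale x0 U m (\<Psi> i)"
  shows lincomb_mult: "lincomb x0 U ((E \<otimes>\<^bsub>Mat_ring (D_ring x0)\<^esub> F) i) \<Psi> =
      scale x0 U (\<lambda>p\<in>U. l p * m p) (\<Psi> i)"
    and lincomb_add: "lincomb x0 U ((E \<oplus>\<^bsub>Mat_ring (D_ring x0)\<^esub> F) i) \<Psi> =
      scale x0 U (\<lambda>p\<in>U. l p + m p) (\<Psi> i)"
proof -
  interpret O: cring "O_ring x0" by (rule cring_O_ring)
  interpret D: ring "D_ring x0" by (rule ring_D_ring)
  have ED: "E i j \<in> carrier (D_ring x0)" and FD: "F i j \<in> carrier (D_ring x0)" for i j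
    using E F by (simp_all add: Mat_ring_def)
  have const: "germ x0 (\<lambda>_. k) \<in> carrier (O_ring x0)" for k
    by (intro germ_in_O analytic_near_const)
  have Elp: "(\<Oplus>\<^bsub>O_ring x0\<^esub>j\<in>UNIV. E i j (\<Psi> j p)) = germ x0 (\<lambda>_. l p) \<otimes>\<^bsub>O_ring x0\<^esub> \<Psi> i p"
    and Fmp: "(\<Oplus>\<^bsub>O_ring x0\<^esub>j\<in>UNIV. F i j (\<Psi> j p)) = germ x0 (\<lambda>_. m p) \<otimes>\<^bsub>O_ring x0\<^esub> \<Psi> i p"
    if "p \<in> U" for p i
    using fun_cong[OF El[of i], of p] fun_cong[OF Fm[of i], of p] that
    by (simp_all add: lincomb_def scale_def)
  have EF: "(E \<otimes>\<^bsub>Mat_ring (D_ring x0)\<^esub> F) i k H = (\<Oplus>\<^bsub>O_ring x0\<^esub>j\<in>UNIV. E i j (F j k H))"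
    if H: "H \<in> carrier (O_ring x0)" for i k H
  proof -
    have "(E \<otimes>\<^bsub>Mat_ring (D_ring x0)\<^esub> F) i k = (\<Oplus>\<^bsub>D_ring x0\<^esub>j\<in>UNIV. E i j \<otimes>\<^bsub>D_ring x0\<^esub> F j k)"
      by (simp add: Mat_ring_def)
    then show ?thesis
      by (simp only: D_finsum_apply[OF D_ring_closed(1)[OF ED FD] finite H] D_ring_apply(1)[OF H])
  qed
  show "lincomb x0 U ((E \<otimes>\<^bsub>Mat_ring (D_ring x0)\<^esub> F) i) \<Psi> = scale x0 U (\<lambda>p\<in>U. l p * m p) (\<Psi> i)"
    unfolding lincomb_def scale_def
  proof (rule restrict_ext)
    fix p assume p: "p \<in> U"
    note \<Psi>p = \<Psi>[OF p]
    note cl = \<Psi>p const D_apply_closed[OF ED \<Psi>p] D_apply_closed[OF FD \<Psi>p]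
      D_apply_closed[OF ED D_apply_closed[OF FD \<Psi>p]]
    have "(\<Oplus>\<^bsub>O_ring x0\<^esub>k\<in>UNIV. (E \<otimes>\<^bsub>Mat_ring (D_ring x0)\<^esub> F) i k (\<Psi> k p)) =
        (\<Oplus>\<^bsub>O_ring x0\<^esub>k\<in>UNIV. \<Oplus>\<^bsub>O_ring x0\<^esub>j\<in>UNIV. E i j (F j k (\<Psi> k p)))"
      by (simp only: EF[OF \<Psi>p])
    also have "\<dots> = (\<Oplus>\<^bsub>O_ring x0\<^esub>j\<in>UNIV. \<Oplus>\<^bsub>O_ring x0\<^esub>k\<in>UNIV. E i j (F j k (\<Psi> k p)))"
      by (rule O.finsum_swap) (simp_all add: cl Pi_def)
    also have "\<dots> = (\<Oplus>\<^bsub>O_ring x0\<^esub>j\<in>UNIV. germ x0 (\<lambda>_. m p) \<otimes>\<^bsub>O_ring x0\<^esub> E i j (\<Psi> j p))"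
    proof (intro O.finsum_cong' refl)
      fix j
      have "(\<Oplus>\<^bsub>O_ring x0\<^esub>k\<in>UNIV. E i j (F j k (\<Psi> k p))) = E i j (\<Oplus>\<^bsub>O_ring x0\<^esub>k\<in>UNIV. F j k (\<Psi> k p))"
        by (intro D_apply_finsum[symmetric] ED) (simp_all add: cl Pi_def)
      then show "(\<Oplus>\<^bsub>O_ring x0\<^esub>k\<in>UNIV. E i j (F j k (\<Psi> k p))) =
          germ x0 (\<lambda>_. m p) \<otimes>\<^bsub>O_ring x0\<^esub> E i j (\<Psi> j p)"
        by (simp add: Fmp[OF p] D_apply_const_mult[OF ED \<Psi>p])
    qed (simp_all add: cl Pi_def)
    also have "\<dots> = germ x0 (\<lambda>_. m p) \<otimes>\<^bsub>O_ring x0\<^esub> (\<Oplus>\<^bsub>O_ring x0\<^esub>j\<in>UNIV. E i j (\<Psi> j p))"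
      by (intro O.finsum_rdistr[symmetric]) (simp_all add: cl Pi_def)
    also have "\<dots> = germ x0 (\<lambda>_. m p) \<otimes>\<^bsub>O_ring x0\<^esub> germ x0 (\<lambda>_. l p) \<otimes>\<^bsub>O_ring x0\<^esub> \<Psi> i p"
      unfolding Elp[OF p] by (rule O.m_assoc[symmetric]) (rule const \<Psi>p)+
    also have "germ x0 (\<lambda>_. m p) \<otimes>\<^bsub>O_ring x0\<^esub> germ x0 (\<lambda>_. l p) = germ x0 (\<lambda>_. (\<lambda>p\<in>U. l p * m p) p)"
      using p by (simp add: O_mult_germ mult.commute)
    finally show "(\<Oplus>\<^bsub>O_ring x0\<^esub>k\<in>UNIV. (E \<otimes>\<^bsub>Mat_ring (D_ring x0)\<^esub> F) i k (\<Psi> k p)) =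
        germ x0 (\<lambda>_. (\<lambda>p\<in>U. l p * m p) p) \<otimes>\<^bsub>O_ring x0\<^esub> \<Psi> i p" .
  qed
  show "lincomb x0 U ((E \<oplus>\<^bsub>Mat_ring (D_ring x0)\<^esub> F) i) \<Psi> = scale x0 U (\<lambda>p\<in>U. l p + m p) (\<Psi> i)"
    unfolding lincomb_def scale_def
  proof (rule restrict_ext)
    fix p assume p: "p \<in> U"
    note \<Psi>p = \<Psi>[OF p]
    note cl = \<Psi>p const D_apply_closed[OF ED \<Psi>p] D_apply_closed[OF FD \<Psi>p]
      D_apply_closed[OF ED D_apply_closed[OF FD \<Psi>p]]
    have "(\<Oplus>\<^bsub>O_ring x0\<^esub>j\<in>UNIV. (E \<oplus>\<^bsub>Mat_ring (D_ring x0)\<^esub> F) i j (\<Psi> j p)) =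
        (\<Oplus>\<^bsub>O_ring x0\<^esub>j\<in>UNIV. E i j (\<Psi> j p) \<oplus>\<^bsub>O_ring x0\<^esub> F i j (\<Psi> j p))"
      by (simp add: Mat_ring_def D_ring_apply \<Psi>p)
    also have "\<dots> = (\<Oplus>\<^bsub>O_ring x0\<^esub>j\<in>UNIV. E i j (\<Psi> j p)) \<oplus>\<^bsub>O_ring x0\<^esub> (\<Oplus>\<^bsub>O_ring x0\<^esub>j\<in>UNIV. F i j (\<Psi> j p))"
      by (intro O.finsum_addf) (simp_all add: cl Pi_def)
    also have "\<dots> = (germ x0 (\<lambda>_. l p) \<oplus>\<^bsub>O_ring x0\<^esub> germ x0 (\<lambda>_. m p)) \<otimes>\<^bsub>O_ring x0\<^esub> \<Psi> i p"
      unfolding Elp[OF p] Fmp[OF p] by (rule O.l_distr[symmetric]) (rule const \<Psi>p)+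
    also have "germ x0 (\<lambda>_. l p) \<oplus>\<^bsub>O_ring x0\<^esub> germ x0 (\<lambda>_. m p) = germ x0 (\<lambda>_. (\<lambda>p\<in>U. l p + m p) p)"
      using p by (simp add: O_add_germ)
    finally show "(\<Oplus>\<^bsub>O_ring x0\<^esub>j\<in>UNIV. (E \<oplus>\<^bsub>Mat_ring (D_ring x0)\<^esub> F) i j (\<Psi> j p)) =
        germ x0 (\<lambda>_. (\<lambda>p\<in>U. l p + m p) p) \<otimes>\<^bsub>O_ring x0\<^esub> \<Psi> i p" .
  qed
qed

lemma lincomb_one:
  fixes \<Psi> :: "'n::finite \<Rightarrow> 'n point \<Rightarrow> 'n germ"
  assumes \<Psi>: "\<And>i p. p \<in> U \<Longrightarrow> \<Psi> i p \<in> carrier (O_ring x0)"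
  shows "lincomb x0 U (\<one>\<^bsub>Mat_ring (D_ring x0)\<^esub> i) \<Psi> = scale x0 U (\<lambda>p\<in>U. 1) (\<Psi> i)"
  unfolding lincomb_def scale_def
proof (rule restrict_ext)
  interpret O: cring "O_ring x0" by (rule cring_O_ring)
  fix p assume p: "p \<in> U"
  have "(\<Oplus>\<^bsub>O_ring x0\<^esub>j\<in>UNIV. \<one>\<^bsub>Mat_ring (D_ring x0)\<^esub> i j (\<Psi> j p)) =
      (\<Oplus>\<^bsub>O_ring x0\<^esub>j\<in>UNIV. if i = j then \<Psi> j p else \<zero>\<^bsub>O_ring x0\<^esub>)"
    using \<Psi>[OF p] by (intro O.finsum_cong') (auto simp: Mat_ring_def D_ring_apply)
  also have "\<dots> = \<Psi> i p" using \<Psi>[OF p] by (intro O.finsum_singleton) auto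
  finally show "(\<Oplus>\<^bsub>O_ring x0\<^esub>j\<in>UNIV. \<one>\<^bsub>Mat_ring (D_ring x0)\<^esub> i j (\<Psi> j p)) =
      germ x0 (\<lambda>_. (\<lambda>p\<in>U. 1) p) \<otimes>\<^bsub>O_ring x0\<^esub> \<Psi> i p"
    using p \<Psi>[OF p] by (simp add: O_one[symmetric])
qed

text \<open>
  \<open>A_f\<close> acts on the module, so each \<open>l \<Psi>\<^sub>i\<close> has unique coordinates in the basis, and these are the rows
  of \<open>D l\<close>. Uniqueness makes \<open>D\<close> a ring homomorphism. If \<open>D l = D m\<close> with \<open>l \<noteq> m\<close>, then all \<open>\<Psi>\<^sub>i\<close>
  vanish identically, and the zero function would have the coordinates \<open>(0, \<dots>, 0)\<close> and \<open>(1, \<dots>, 1)\<close>.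
\<close>

lemma spectral_embedding:
  fixes \<Psi> :: "'n::finite \<Rightarrow> 'n point \<Rightarrow> 'n germ"
  assumes glue: "\<And>t. (a1, b1, t) \<in> off (form \<alpha> \<beta>) \<Longrightarrow> (a2, b2, Pm *v t) \<in> off (form \<alpha> \<beta>)"
    and p0: "form \<alpha> \<beta> p0 \<noteq> 0"
    and basis: "D_basis x0 (off (form \<alpha> \<beta>)) (M_module a1 b1 a2 b2 Pm (form \<alpha> \<beta>) fs \<Lambda> x0) \<Psi>"
  shows "\<exists>D. ring_embedding D (A_ring a1 b1 a2 b2 Pm (form \<alpha> \<beta>))
        (Mat_ring (D_ring x0) :: ('n \<Rightarrow> 'n \<Rightarrow> _) ring) \<and>
      (\<forall>l\<in>carrier (A_ring a1 b1 a2 b2 Pm (form \<alpha> \<beta>)).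
        \<forall>E\<in>carrier (Mat_ring (D_ring x0) :: ('n \<Rightarrow> 'n \<Rightarrow> _) ring).
          (\<forall>i. lincomb x0 (off (form \<alpha> \<beta>)) (E i) \<Psi> = scale x0 (off (form \<alpha> \<beta>)) l (\<Psi> i)) \<longleftrightarrow> E = D l)"
proof -
  define f where "f = form \<alpha> \<beta>"
  let ?U = "off f"
  let ?A = "A_ring a1 b1 a2 b2 Pm f"
  let ?M = "M_module a1 b1 a2 b2 Pm f fs \<Lambda> x0"
  let ?S = "Mat_ring (D_ring x0) :: ('n \<Rightarrow> 'n \<Rightarrow> _) ring"
  interpret O: cring "O_ring x0" by (rule cring_O_ring)
  interpret A: ring ?A unfolding f_def by (rule ring_A_ring[OF glue])
  interpret S: ring ?S by (intro ring_Mat_ring ring_D_ring)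
  have \<Psi>M: "\<Psi> i \<in> ?M" for i using basis by (simp add: D_basis_def f_def)
  have \<Psi>O: "\<Psi> i p \<in> carrier (O_ring x0)" if "p \<in> ?U" for i p
    using M_module_in_O[OF \<Psi>M that] .
  have unique: "\<exists>!L. (\<forall>i. L i \<in> carrier (D_ring x0)) \<and> \<phi> = lincomb x0 ?U L \<Psi>" if "\<phi> \<in> ?M" for \<phi>
    using basis that by (simp add: D_basis_def f_def)
  \<comment> \<open>\<open>E \<Psi> = l \<Psi>\<close>, read row by row.\<close>
  define rel where "rel E l \<longleftrightarrow> E \<in> carrier ?S \<and>
    (\<forall>i. lincomb x0 ?U (E i) \<Psi> = scale x0 ?U l (\<Psi> i))" for E l
  have rel_unique: "\<exists>!E. rel E l" if l: "l \<in> carrier ?A" for l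
  proof -
    define P where "P i L \<longleftrightarrow> (\<forall>j. L j \<in> carrier (D_ring x0)) \<and>
      scale x0 ?U l (\<Psi> i) = lincomb x0 ?U L \<Psi>" for i L
    have P: "\<exists>!L. P i L" for i
      using glue p0 l \<Psi>M[of i] unfolding P_def f_def
      by (intro unique[unfolded f_def] scale_in_M_module[where ?p0.0 = p0])
    have rel_iff: "rel E l \<longleftrightarrow> (\<forall>i. P i (E i))" for E
      unfolding rel_def Mat_ring_def P_def by (auto simp: eq_commute)
    define E where "E i = (THE L. P i L)" for i
    have E: "P i (E i)" for i unfolding E_def by (rule theI'[OF P])
    show ?thesis
    proof (rule ex1I[of _ E])
      show "rel E l" unfolding rel_iff using E by (rule allI)
      fix E' assume "rel E' l"
      then have "P i (E' i)" for i unfolding rel_iff by (rule spec)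
      then show "E' = E" unfolding E_def by (intro ext the1_equality[OF P, symmetric])
    qed
  qed
  define D where "D l = (THE E. rel E l)" for l
  have rel_D: "rel (D l) l" if "l \<in> carrier ?A" for l
    unfolding D_def by (rule theI'[OF rel_unique[OF that]])
  have D_eq: "D l = E" if "l \<in> carrier ?A" "rel E l" for l E
    using rel_unique[OF that(1)] rel_D[OF that(1)] that(2) by (elim ex1E) blast
  have "ring_hom_ring ?A ?S D"
  proof (rule ring_hom_ringI)
    show "ring ?A" "ring ?S" by (rule A.ring_axioms, rule S.ring_axioms)
    fix l m assume l: "l \<in> carrier ?A" and m: "m \<in> carrier ?A"
    have Dl: "D l \<in> carrier ?S" "\<And>i. lincomb x0 ?U (D l i) \<Psi> = scale x0 ?U l (\<Psi> i)"
      and Dm: "D m \<in> carrier ?S" "\<And>i. lincomb x0 ?U (D m i) \<Psi> = scale x0 ?U m (\<Psi> i)"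
      using rel_D[OF l] rel_D[OF m] by (simp_all add: rel_def)
    show "D l \<in> carrier ?S" by (rule Dl(1))
    have "rel (D l \<otimes>\<^bsub>?S\<^esub> D m) (l \<otimes>\<^bsub>?A\<^esub> m)"
      using Dl(1) Dm(1) lincomb_mult[OF \<Psi>O Dl(1) Dm(1) Dl(2) Dm(2)]
      by (simp add: rel_def) (simp add: A_ring_def)
    then show "D (l \<otimes>\<^bsub>?A\<^esub> m) = D l \<otimes>\<^bsub>?S\<^esub> D m" using l m by (intro D_eq) auto
    have "rel (D l \<oplus>\<^bsub>?S\<^esub> D m) (l \<oplus>\<^bsub>?A\<^esub> m)"
      using Dl(1) Dm(1) lincomb_add[OF \<Psi>O Dl(1) Dm(1) Dl(2) Dm(2)]
      by (simp add: rel_def) (simp add: A_ring_def)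
    then show "D (l \<oplus>\<^bsub>?A\<^esub> m) = D l \<oplus>\<^bsub>?S\<^esub> D m" using l m by (intro D_eq) auto
  next
    have "rel \<one>\<^bsub>?S\<^esub> \<one>\<^bsub>?A\<^esub>"
      using lincomb_one[OF \<Psi>O] by (simp add: rel_def) (simp add: A_ring_def)
    then show "D \<one>\<^bsub>?A\<^esub> = \<one>\<^bsub>?S\<^esub>" by (intro D_eq) auto
  qed
  moreover have "inj_on D (carrier ?A)"
  proof (rule inj_onI, rule ccontr)
    fix l m assume l: "l \<in> carrier ?A" and m: "m \<in> carrier ?A" and "D l = D m" and "l \<noteq> m"
    then have eq: "scale x0 ?U l (\<Psi> i) = scale x0 ?U m (\<Psi> i)" for i
      using rel_D[OF l] rel_D[OF m] by (simp add: rel_def)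
    obtain p1 where p1: "p1 \<in> ?U" "l p1 \<noteq> m p1" using A_ring_eqI[OF l m] \<open>l \<noteq> m\<close> by blast
    have zero: "\<Psi> i p = \<zero>\<^bsub>O_ring x0\<^esub>" if "p \<in> ?U" for i p
      using scale_eq_imp_zero[OF l[unfolded f_def] m[unfolded f_def] \<Psi>M[unfolded f_def]
          eq[unfolded f_def] p1[unfolded f_def] that[unfolded f_def]] .
    have S0: "S \<zero>\<^bsub>O_ring x0\<^esub> = \<zero>\<^bsub>O_ring x0\<^esub>" if "S \<in> carrier (D_ring x0)" for S
      using D_apply_finsum[OF that, of "{}" "\<lambda>_. \<zero>\<^bsub>O_ring x0\<^esub>"] by simp
    have lin0: "lincomb x0 ?U L \<Psi> = (\<lambda>p\<in>?U. \<zero>\<^bsub>O_ring x0\<^esub>)"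
      if "\<And>j. L j \<in> carrier (D_ring x0)" for L
      unfolding lincomb_def using that by (intro restrict_ext) (simp add: zero S0)
    fix i :: 'n
    have "(\<lambda>_ :: 'n. \<zero>\<^bsub>D_ring x0\<^esub>) = (\<lambda>_. \<one>\<^bsub>D_ring x0\<^esub>)"
    proof -
      from unique[OF \<Psi>M[of i]] obtain L
        where L: "(\<forall>j. L j \<in> carrier (D_ring x0)) \<and> \<Psi> i = lincomb x0 ?U L \<Psi>"
          and uniq: "\<forall>L'. (\<forall>j. L' j \<in> carrier (D_ring x0)) \<and> \<Psi> i = lincomb x0 ?U L' \<Psi> \<longrightarrow> L' = L"
        by (elim ex1E)
      have \<Psi>0: "\<Psi> i = (\<lambda>p\<in>?U. \<zero>\<^bsub>O_ring x0\<^esub>)" using L lin0[of L] by simp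
      have "(\<lambda>_. \<zero>\<^bsub>D_ring x0\<^esub>) = L"
        by (rule uniq[rule_format]) (simp add: \<Psi>0 lin0 D_ring_closed)
      moreover have "(\<lambda>_. \<one>\<^bsub>D_ring x0\<^esub>) = L"
        by (rule uniq[rule_format]) (simp add: \<Psi>0 lin0 D_ring_closed)
      ultimately show ?thesis by (simp only:)
    qed
    from fun_cong[OF this]
    have "\<zero>\<^bsub>D_ring x0\<^esub> \<one>\<^bsub>O_ring x0\<^esub> = \<one>\<^bsub>D_ring x0\<^esub> \<one>\<^bsub>O_ring x0\<^esub>" by (simp only:)
    then have "germ x0 (\<lambda>_. 0 :: complex) = germ x0 (\<lambda>_. 1)"
      by (simp add: D_ring_apply) (simp add: O_one O_zero)
    then show False by (simp add: germ_eq_iff)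
  qed
  moreover have "(\<forall>i. lincomb x0 ?U (E i) \<Psi> = scale x0 ?U l (\<Psi> i)) \<longleftrightarrow> E = D l"
    if "l \<in> carrier ?A" "E \<in> carrier ?S" for l E
    using rel_D[OF that(1)] D_eq[OF that(1), of E] that(2) by (auto simp: rel_def)
  ultimately show ?thesis unfolding ring_embedding_def f_def[symmetric] by blast
qed

theorem corollary1:
  fixes a1 a2 b1 b2 A \<Lambda> :: complex
    and Pm :: "complex ^ 'n ^ 'n::finite"
    and ev :: "'n \<Rightarrow> complex" and w :: "'n \<Rightarrow> complex ^ 'n"
    and \<alpha> \<beta> c x0 :: "complex ^ 'n"
    and \<alpha>s \<beta>s :: "complex ^ 'n ^ 'n"
    and f :: "'n point \<Rightarrow> complex" and fs :: "'n \<Rightarrow> 'n point \<Rightarrow> complex"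
  defines "f \<equiv> form \<alpha> \<beta>"
    and "fs \<equiv> \<lambda>i. form (\<alpha>s $ i) (\<beta>s $ i)"
  assumes "(a1, b1) \<noteq> (0, 0)" and "(a2, b2) \<noteq> (0, 0)" and "cp1 a1 b1 \<noteq> cp1 a2 b2"
    and "invertible Pm"
    and "\<And>j. w j \<noteq> 0 \<and> Pm *v w j = ev j *s w j" and "inj ev"
    and "A \<noteq> 0"
    and "\<And>t. f (a1, b1, t) - A * f (a2, b2, Pm *v t) = 0"
    and "\<And>j. f (a1, b1, w j) \<noteq> 0"
    and "\<And>i t. fs i (a1, b1, t) - A * fs i (a2, b2, Pm *v t) - c $ i * f (a1, b1, t) = 0"
    and "\<And>s0 s. (\<And>p. s0 * f p + (\<Sum>i\<in>UNIV. s i * fs i p) = 0) \<Longrightarrow> s0 = 0 \<and> (\<forall>i. s i = 0)"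
    and "\<And>k. card {cp1 z1 z2 | z1 z2. (z1, z2) \<noteq> (0, 0) \<and>
          det (\<chi> i j. if i = k then \<alpha> $ j * z1 + \<beta> $ j * z2
                      else \<alpha>s $ i $ j * z1 + \<beta>s $ i $ j * z2) = 0} = CARD('n)"
  shows "(\<exists>D. ring_embedding D (A_ring a1 b1 a2 b2 Pm f)
            (Mat_ring (D_ring x0) :: ('n \<Rightarrow> 'n \<Rightarrow> _) ring)) \<and>
    (\<forall>\<Psi>. D_basis x0 (off f) (M_module a1 b1 a2 b2 Pm f fs \<Lambda> x0) \<Psi> \<longrightarrow>
      (\<exists>D. ring_embedding D (A_ring a1 b1 a2 b2 Pm f)
            (Mat_ring (D_ring x0) :: ('n \<Rightarrow> 'n \<Rightarrow> _) ring) \<and>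
        (\<forall>l\<in>carrier (A_ring a1 b1 a2 b2 Pm f).
          \<forall>E\<in>carrier (Mat_ring (D_ring x0) :: ('n \<Rightarrow> 'n \<Rightarrow> _) ring).
            (\<forall>i. lincomb x0 (off f) (E i) \<Psi> = scale x0 (off f) l (\<Psi> i)) \<longleftrightarrow> E = D l)))"
proof -
  have p0: "form \<alpha> \<beta> (a1, b1, w j) \<noteq> 0" for j
    using assms(11)[of j] by (simp add: f_def)
  have "form \<alpha> \<beta> (a1, b1, t) = A * form \<alpha> \<beta> (a2, b2, Pm *v t)" for t
    using assms(10)[of t] by (simp add: f_def)
  then have glue: "(a2, b2, Pm *v t) \<in> off (form \<alpha> \<beta>)" if "(a1, b1, t) \<in> off (form \<alpha> \<beta>)" for t
    using that by (auto simp: off_form)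
  obtain h where h: "ring_embedding h (A_ring a1 b1 a2 b2 Pm f) (D_ring x0)"
    using A_ring_embeds_in_D_ring[OF glue p0] unfolding f_def by blast
  have "\<exists>D. ring_embedding D (A_ring a1 b1 a2 b2 Pm f)
      (Mat_ring (D_ring x0) :: ('n \<Rightarrow> 'n \<Rightarrow> _) ring)"
    by (rule exI) (rule scalar_matrix_embedding[OF h])
  then show ?thesis
    using spectral_embedding[OF glue p0] unfolding f_def by blast
qed

end
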